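(* Let $G$ be a connected 3-dimensional unimodular Lie group with a left-invariant contact sub-Riemannian structure, and let $f_0,f_1,f_2$ be a left-invariant frame on $G$ such that $f_1,f_2$ is an orthonormal frame of the structure and $$[f_2,f_1]=f_0,\qquad [f_1,f_0]=(\chi+\kappa)f_2,\qquad [f_2,f_0]=(\chi-\kappa)f_1$$ for some constants $\chi\ge 0$, $\kappa\in\mathbb{R}$. Let $h_i$, $g_i$ ($i=0,1,2$) and $H=\frac12(h_1^2+h_2^2)$ be the functions on $T^*G$ defined in the context, and let $\overrightarrow{H}$ be the Hamiltonian vector field of $H$ on $T^*G$. Then the integrals $H,g_0,g_1,g_2$ of $\overrightarrow{H}$ are functionally independent on the set $\{\lambda\in T^*G\mid h_0(\lambda)h_1(\lambda)\neq 0\}$. Moreover, the Hamiltonian vector field $\overrightarrow{H}$ is superintegrable.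
   Context: Let $G$ be a connected 3-dimensional Lie group and $L$ the Lie algebra of left-invariant vector fields on $G$. A left-invariant contact sub-Riemannian structure on $G$ is a rank 2 left-invariant subbundle $\Delta\subset TG$ with $\Delta+[\Delta,\Delta]=TG$, endowed with a left-invariant inner product in $\Delta$. If $G$ is unimodular (in this setting: its Lie algebra is the Heisenberg algebra $\mathrm{h}_3$, $\mathrm{so}(3)$, $\mathrm{sl}(2)$, the Lie algebra $\mathrm{se}(2)$ of the group of Euclidean motions of the plane, or the Lie algebra $\mathrm{sh}(2)$ of the group of hyperbolic motions of the plane), it is known that there is a left-invariant frame $f_0,f_1,f_2$ with $f_1,f_2$ an orthonormal frame of $\Delta$, satisfying the bracket relations of the claim for some $\chi\ge0$, $\kappa\in\mathbb{R}$; such a frame is fixed. Let $\pi:T^*G\to G$ be the canonical projection. Set $h_i(\lambda)=\langle\lambda,f_i(q)\rangle$, $q=\pi(\lambda)$, $i=0,1,2$. Let $i:G\to G$, $i(q)=q^{-1}$, be the inversion, and $e_j=i_*f_j$ the right-invariant vector field on $G$ with $e_j(\mathrm{Id})=-f_j(\mathrm{Id})$, $j=0,1,2$, where $\mathrm{Id}$ is the identity of $G$. Set $g_j(\lambda)=\langle\lambda,e_j(q)\rangle$, $q=\pi(\lambda)$. $T^*G$ carries the symplectic form $\sigma=ds$, $s_\lambda=\lambda\circ\pi_*$. The Hamiltonian vector field $\overrightarrow{a}$ of $a\in C^\infty(T^*G)$ is defined by $\sigma_\lambda(\cdot,\overrightarrow{a})=d_\lambda a$, and the Poisson bracket is $\{a,b\}=\overrightarrow{a}\,b$;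 with this convention, for vector fields $X,Y$ on $G$ the functions $h_X(\lambda)=\langle\lambda,X\rangle$ satisfy $\{h_X,h_Y\}=h_{[X,Y]}$. An integral of $\overrightarrow{H}$ is a function $a\in C^\infty(T^*G)$ with $\{H,a\}=0$. Functions are functionally independent on a set if their differentials are linearly independent at each point of that set. A Hamiltonian vector field $\overrightarrow{H}$ on a symplectic manifold $M$, $\dim M=2d$, is called superintegrable (or integrable in the noncommutative sense) if there exist (for some $n$) functions $f=(f_1=H,f_2,\dots,f_{2d-n})$, $f_i\in C^\infty(M)$, functionally independent on an open dense subset of $M$, such that $\{f_i,f_j\}=P_{ij}\circ f$ with $P_{ij}:f(M)\to\mathbb{R}$, $i,j=1,\dots,2d-n$, and the matrix $(P_{ij})$ has rank $2d-2n$ on an open dense subset of $f(M)$. In the case $n=d$ superintegrability reduces to Liouville integrability. In the claim, $M=T^*G$. *)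

theory Defs
  imports
    "HOL-Analysis.Analysis"
    "HOL-Algebra.Group"
    "HOL-Library.Function_Algebras"
begin

section \<open>Functions into a real vector space\<close>

instantiation "fun" :: (type, real_vector) real_vector
begin

definition scaleR_fun :: "real \<Rightarrow> ('a \<Rightarrow> 'b) \<Rightarrow> 'a \<Rightarrow> 'b"
  where "scaleR_fun r f = (\<lambda>x. r *\<^sub>R f x)"

instance
  by standard (auto simp: scaleR_fun_def fun_eq_iff scaleR_add_right scaleR_add_left)

end

section \<open>Smooth manifolds\<close>

text \<open>All sets on which smoothness is used below are open.\<close>

primrec Ck_on :: "nat \<Rightarrow> 'a::euclidean_space set \<Rightarrow> ('a \<Rightarrow> 'b::real_normed_vector) \<Rightarrow> bool"
  where
    "Ck_on 0 S f \<longleftrightarrow> continuous_on S f"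
  | "Ck_on (Suc k) S f \<longleftrightarrow>
       (\<forall>x\<in>S. f differentiable (at x)) \<and> (\<forall>v. Ck_on k S (\<lambda>x. frechet_derivative f (at x) v))"

definition smooth_on :: "'a::euclidean_space set \<Rightarrow> ('a \<Rightarrow> 'b::real_normed_vector) \<Rightarrow> bool"
  where "smooth_on S f \<longleftrightarrow> (\<forall>k. Ck_on k S f)"

text \<open>A chart is a domain together with a coordinate map, whose values outside of the domain
  are irrelevant. A manifold is given by an atlas, which determines both the set of points and
  the topology.\<close>

type_synonym ('p, 'e) chart = "'p set \<times> ('p \<Rightarrow> 'e)"

definition cinv :: "('p, 'e) chart \<Rightarrow> 'e \<Rightarrow> 'p"
  where "cinv c = inv_into (fst c) (snd c)"

definition points :: "('p, 'e) chart set \<Rightarrow> 'p set"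
  where "points A = \<Union> (fst ` A)"

definition mtop :: "('p, 'e::euclidean_space) chart set \<Rightarrow> 'p topology"
  where "mtop A = topology (\<lambda>S. S \<subseteq> points A \<and> (\<forall>c\<in>A. open (snd c ` (S \<inter> fst c))))"

definition manifold :: "('p, 'e::euclidean_space) chart set \<Rightarrow> bool"
  where "manifold A \<longleftrightarrow>
    (\<forall>c\<in>A. inj_on (snd c) (fst c) \<and> open (snd c ` fst c)) \<and>
    (\<forall>c\<in>A. \<forall>c'\<in>A. open (snd c ` (fst c \<inter> fst c')) \<and>
       smooth_on (snd c ` (fst c \<inter> fst c')) (snd c' \<circ> cinv c)) \<and>
    Hausdorff_space (mtop A) \<and> second_countable (mtop A)"

lemma openin_mtop:
  assumes "\<forall>c\<in>A. inj_on (snd c) (fst c) \<and> open (snd c ` fst c)"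
  shows "openin (mtop A) S \<longleftrightarrow> S \<subseteq> points A \<and> (\<forall>c\<in>A. open (snd c ` (S \<inter> fst c)))"
proof -
  have "istopology (\<lambda>S. S \<subseteq> points A \<and> (\<forall>c\<in>A. open (snd c ` (S \<inter> fst c))))"
    unfolding istopology_def
  proof (intro conjI allI impI ballI; (elim conjE)?)
    fix S T c
    assume c: "c \<in> A" and S: "\<forall>c\<in>A. open (snd c ` (S \<inter> fst c))"
      and T: "\<forall>c\<in>A. open (snd c ` (T \<inter> fst c))"
    have "snd c ` (S \<inter> T \<inter> fst c) = snd c ` (S \<inter> fst c) \<inter> snd c ` (T \<inter> fst c)"
      using assms c by (auto simp: inj_on_def)
    then show "open (snd c ` (S \<inter> T \<inter> fst c))" using S T c by auto
  next
    fix \<K> c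
    assume c: "c \<in> A"
      and K: "\<forall>K\<in>\<K>. K \<subseteq> points A \<and> (\<forall>c\<in>A. open (snd c ` (K \<inter> fst c)))"
    have "snd c ` (\<Union>\<K> \<inter> fst c) = (\<Union>K\<in>\<K>. snd c ` (K \<inter> fst c))" by auto
    then show "open (snd c ` (\<Union>\<K> \<inter> fst c))" using K c by auto
  qed auto
  then show ?thesis unfolding mtop_def by (simp add: topology_inverse')
qed

definition open_dense_in :: "'p topology \<Rightarrow> 'p set \<Rightarrow> bool"
  where "open_dense_in X U \<longleftrightarrow> openin X U \<and> X closure_of U = topspace X"

definition smooth_fun :: "('p, 'e::euclidean_space) chart set \<Rightarrow> ('p \<Rightarrow> real) \<Rightarrow> bool"
  where "smooth_fun A a \<longleftrightarrow> (\<forall>c\<in>A. smooth_on (snd c ` fst c) (a \<circ> cinv c))"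

definition smooth_map :: "('p, 'e::euclidean_space) chart set \<Rightarrow> ('q, 'f::euclidean_space) chart set
    \<Rightarrow> ('p \<Rightarrow> 'q) \<Rightarrow> bool"
  where "smooth_map A B F \<longleftrightarrow> continuous_map (mtop A) (mtop B) F \<and>
    (\<forall>c\<in>A. \<forall>c'\<in>B. smooth_on (snd c ` (fst c \<inter> F -` fst c')) (snd c' \<circ> F \<circ> cinv c))"

definition prod_atlas :: "('p, 'e) chart set \<Rightarrow> ('q, 'f) chart set \<Rightarrow> ('p \<times> 'q, 'e \<times> 'f) chart set"
  where "prod_atlas A B = (\<lambda>(c, c'). (fst c \<times> fst c', map_prod (snd c) (snd c'))) ` (A \<times> B)"

section \<open>Tangent vectors, vector fields, covectors\<close>

text \<open>A tangent vector at \<open>p\<close> is the family of its components in all the charts around \<open>p\<close>; the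
  components in different charts are related by the derivative of the coordinate change.\<close>

type_synonym ('p, 'e) tvec = "('p, 'e) chart \<Rightarrow> 'e"

definition tangent_space :: "('p, 'e::euclidean_space) chart set \<Rightarrow> 'p \<Rightarrow> ('p, 'e) tvec set"
  where "tangent_space A p = {v.
    (\<forall>c\<in>A. \<forall>c'\<in>A. p \<in> fst c \<inter> fst c' \<longrightarrow>
       v c' = frechet_derivative (snd c' \<circ> cinv c) (at (snd c p)) (v c)) \<and>
    (\<forall>c. c \<notin> A \<or> p \<notin> fst c \<longrightarrow> v c = 0)}"

definition chart_at :: "('p, 'e) chart set \<Rightarrow> 'p \<Rightarrow> ('p, 'e) chart"
  where "chart_at A p = (SOME c. c \<in> A \<and> p \<in> fst c)"

text \<open>The tangent vector at \<open>p\<close> with component \<open>w\<close> in the chart \<open>c\<close>; in classical notation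
  \<open>\<Sum>i. w\<^sub>i \<partial>/\<partial>x\<^sub>i\<close> with respect to the coordinates \<open>x\<^sub>i\<close> of \<open>c\<close>.\<close>

definition coord_vec :: "('p, 'e::euclidean_space) chart set \<Rightarrow> ('p, 'e) chart \<Rightarrow> 'p \<Rightarrow> 'e
    \<Rightarrow> ('p, 'e) tvec"
  where "coord_vec A c p w = (\<lambda>c'. if c' \<in> A \<and> p \<in> fst c'
     then frechet_derivative (snd c' \<circ> cinv c) (at (snd c p)) w else 0)"

definition tangent_map :: "('p, 'e::euclidean_space) chart set \<Rightarrow> ('q, 'f::euclidean_space) chart set
    \<Rightarrow> ('p \<Rightarrow> 'q) \<Rightarrow> 'p \<Rightarrow> ('p, 'e) tvec \<Rightarrow> ('q, 'f) tvec"
  where "tangent_map A B F p v = (\<lambda>c'. if c' \<in> B \<and> F p \<in> fst c'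
     then let c = chart_at A p in frechet_derivative (snd c' \<circ> F \<circ> cinv c) (at (snd c p)) (v c)
     else 0)"

text \<open>The differential of a function, extended by zero to families which are not tangent vectors
  at \<open>p\<close>; covectors are normalised in the same way.\<close>

definition differential :: "('p, 'e::euclidean_space) chart set \<Rightarrow> ('p \<Rightarrow> real) \<Rightarrow> 'p
    \<Rightarrow> ('p, 'e) tvec \<Rightarrow> real"
  where "differential A a p v = (if v \<in> tangent_space A p
     then let c = chart_at A p in frechet_derivative (a \<circ> cinv c) (at (snd c p)) (v c)
     else 0)"

definition cotangent_space :: "('p, 'e::euclidean_space) chart set \<Rightarrow> 'p
    \<Rightarrow> (('p, 'e) tvec \<Rightarrow> real) set"
  where "cotangent_space A p = {l.
    (\<forall>v\<in>tangent_space A p. \<forall>w\<in>tangent_space A p. l (v + w) = l v + l w) \<and>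
    (\<forall>r. \<forall>v\<in>tangent_space A p. l (r *\<^sub>R v) = r * l v) \<and>
    (\<forall>v. v \<notin> tangent_space A p \<longrightarrow> l v = 0)}"

type_synonym ('p, 'e) vfield = "'p \<Rightarrow> ('p, 'e) tvec"

definition smooth_vf_on :: "('p, 'e::euclidean_space) chart set \<Rightarrow> 'p set \<Rightarrow> ('p, 'e) vfield \<Rightarrow> bool"
  where "smooth_vf_on A U X \<longleftrightarrow> (\<forall>q\<in>U. X q \<in> tangent_space A q) \<and>
    (\<forall>c\<in>A. smooth_on (snd c ` (fst c \<inter> U)) (\<lambda>x. X (cinv c x) c))"

text \<open>\<open>[X,Y] = XY - YX\<close> as derivations, that is \<open>DY X - DX Y\<close> in coordinates.\<close>

definition lie_bracket :: "('p, 'e::euclidean_space) chart set \<Rightarrow> ('p, 'e) vfield \<Rightarrow> ('p, 'e) vfield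
    \<Rightarrow> ('p, 'e) vfield"
  where "lie_bracket A X Y q = (\<lambda>c. if c \<in> A \<and> q \<in> fst c
     then frechet_derivative (\<lambda>x. Y (cinv c x) c) (at (snd c q)) (X q c) -
          frechet_derivative (\<lambda>x. X (cinv c x) c) (at (snd c q)) (Y q c)
     else 0)"

text \<open>\<open>F\<^sub>*X\<close> for a diffeomorphism \<open>F\<close> of the manifold.\<close>

definition push_vf :: "('p, 'e::euclidean_space) chart set \<Rightarrow> ('p \<Rightarrow> 'p) \<Rightarrow> ('p, 'e) vfield
    \<Rightarrow> ('p, 'e) vfield"
  where "push_vf A F X q =
    (let p = inv_into (points A) F q in tangent_map A A F p (X p))"

text \<open>\<open>X 0, \<dots>, X (k - 1)\<close> is a smooth frame on \<open>U\<close> of the family of subspaces \<open>D\<close>. For a frame of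
  the tangent bundle take \<open>D = tangent_space A\<close>.\<close>

definition frame_on :: "('p, 'e::euclidean_space) chart set \<Rightarrow> ('p \<Rightarrow> ('p, 'e) tvec set) \<Rightarrow> nat
    \<Rightarrow> 'p set \<Rightarrow> (nat \<Rightarrow> ('p, 'e) vfield) \<Rightarrow> bool"
  where "frame_on A D k U X \<longleftrightarrow> (\<forall>i<k. smooth_vf_on A U (X i)) \<and>
    (\<forall>q\<in>U. inj_on (\<lambda>i. X i q) {..<k} \<and> independent ((\<lambda>i. X i q) ` {..<k}) \<and>
       span ((\<lambda>i. X i q) ` {..<k}) = D q)"

definition subbundle :: "('p, 'e::euclidean_space) chart set \<Rightarrow> nat \<Rightarrow> ('p \<Rightarrow> ('p, 'e) tvec set) \<Rightarrow> bool"
  where "subbundle A k D \<longleftrightarrow>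
    (\<forall>p\<in>points A. \<exists>U X. openin (mtop A) U \<and> p \<in> U \<and> frame_on A D k U X)"

definition smooth_section :: "('p, 'e::euclidean_space) chart set \<Rightarrow> ('p \<Rightarrow> ('p, 'e) tvec set)
    \<Rightarrow> ('p, 'e) vfield \<Rightarrow> bool"
  where "smooth_section A D X \<longleftrightarrow> smooth_vf_on A (points A) X \<and> (\<forall>q\<in>points A. X q \<in> D q)"

section \<open>Lie groups\<close>

locale lie_group = group G for G (structure) +
  fixes A :: "('p, 'e::euclidean_space) chart set"
  assumes manifold: "manifold A"
    and carrier_eq: "carrier G = points A"
    and smooth_mult: "smooth_map (prod_atlas A A) A (\<lambda>(x, y). x \<otimes> y)"
    and smooth_inv: "smooth_map A A (m_inv G)"

definition left_invariant_vf :: "('p, 'm) monoid_scheme \<Rightarrow> ('p, 'e::euclidean_space) chart set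
    \<Rightarrow> ('p, 'e) vfield \<Rightarrow> bool"
  where "left_invariant_vf G A X \<longleftrightarrow> smooth_vf_on A (carrier G) X \<and>
    (\<forall>a\<in>carrier G. \<forall>q\<in>carrier G.
       tangent_map A A (\<lambda>x. a \<otimes>\<^bsub>G\<^esub> x) q (X q) = X (a \<otimes>\<^bsub>G\<^esub> q))"

text \<open>Manifolds are second countable and locally compact, so a Borel measure which is finite on
  compact sets is automatically regular.\<close>

definition left_haar_measure :: "('p, 'm) monoid_scheme \<Rightarrow> ('p, 'e::euclidean_space) chart set
    \<Rightarrow> 'p measure \<Rightarrow> bool"
  where "left_haar_measure G A \<mu> \<longleftrightarrow>
    space \<mu> = carrier G \<and> sets \<mu> = sigma_sets (carrier G) {U. openin (mtop A) U} \<and>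
    (\<forall>K. compactin (mtop A) K \<longrightarrow> emeasure \<mu> K < \<infinity>) \<and> emeasure \<mu> (carrier G) \<noteq> 0 \<and>
    (\<forall>a\<in>carrier G. \<forall>S\<in>sets \<mu>. emeasure \<mu> ((\<lambda>x. a \<otimes>\<^bsub>G\<^esub> x) ` S) = emeasure \<mu> S)"

definition unimodular :: "('p, 'm) monoid_scheme \<Rightarrow> ('p, 'e::euclidean_space) chart set \<Rightarrow> bool"
  where "unimodular G A \<longleftrightarrow> (\<exists>\<mu>. left_haar_measure G A \<mu> \<and>
    (\<forall>a\<in>carrier G. \<forall>S\<in>sets \<mu>. emeasure \<mu> ((\<lambda>x. x \<otimes>\<^bsub>G\<^esub> a) ` S) = emeasure \<mu> S))"

section \<open>Left-invariant contact sub-Riemannian structures\<close>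

text \<open>\<open>D + [D,D] = TG\<close>, where \<open>[D,D]\<close> at \<open>q\<close> consists of the values of brackets of sections.\<close>

definition left_invariant_contact :: "('p, 'm) monoid_scheme \<Rightarrow> ('p, 'e::euclidean_space) chart set
    \<Rightarrow> ('p \<Rightarrow> ('p, 'e) tvec set) \<Rightarrow> bool"
  where "left_invariant_contact G A D \<longleftrightarrow> subbundle A 2 D \<and>
    (\<forall>a\<in>carrier G. \<forall>q\<in>carrier G.
       tangent_map A A (\<lambda>x. a \<otimes>\<^bsub>G\<^esub> x) q ` D q = D (a \<otimes>\<^bsub>G\<^esub> q)) \<and>
    (\<forall>q\<in>carrier G.
       span (D q \<union> {lie_bracket A X Y q | X Y. smooth_section A D X \<and> smooth_section A D Y}) =
       tangent_space A q)"

definition left_invariant_inner :: "('p, 'm) monoid_scheme \<Rightarrow> ('p, 'e::euclidean_space) chart set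
    \<Rightarrow> ('p \<Rightarrow> ('p, 'e) tvec set) \<Rightarrow> ('p \<Rightarrow> ('p, 'e) tvec \<Rightarrow> ('p, 'e) tvec \<Rightarrow> real) \<Rightarrow> bool"
  where "left_invariant_inner G A D ip \<longleftrightarrow>
    (\<forall>q\<in>carrier G. \<forall>u\<in>D q. \<forall>v\<in>D q. ip q u v = ip q v u \<and>
       (\<forall>w\<in>D q. ip q (u + v) w = ip q u w + ip q v w) \<and>
       (\<forall>r. ip q (r *\<^sub>R u) v = r * ip q u v) \<and>
       (u \<noteq> 0 \<longrightarrow> ip q u u > 0)) \<and>
    (\<forall>X Y. smooth_section A D X \<and> smooth_section A D Y \<longrightarrow> smooth_fun A (\<lambda>q. ip q (X q) (Y q))) \<and>
    (\<forall>a\<in>carrier G. \<forall>q\<in>carrier G. \<forall>u\<in>D q. \<forall>v\<in>D q.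
       ip (a \<otimes>\<^bsub>G\<^esub> q) (tangent_map A A (\<lambda>x. a \<otimes>\<^bsub>G\<^esub> x) q u) (tangent_map A A (\<lambda>x. a \<otimes>\<^bsub>G\<^esub> x) q v)
       = ip q u v)"

definition contact_subriemannian :: "('p, 'm) monoid_scheme \<Rightarrow> ('p, 'e::euclidean_space) chart set
    \<Rightarrow> ('p \<Rightarrow> ('p, 'e) tvec set) \<Rightarrow> ('p \<Rightarrow> ('p, 'e) tvec \<Rightarrow> ('p, 'e) tvec \<Rightarrow> real) \<Rightarrow> bool"
  where "contact_subriemannian G A D ip \<longleftrightarrow>
    left_invariant_contact G A D \<and> left_invariant_inner G A D ip"

definition orthonormal_frame2 :: "('p, 'e::euclidean_space) chart set \<Rightarrow> ('p \<Rightarrow> ('p, 'e) tvec set)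
    \<Rightarrow> ('p \<Rightarrow> ('p, 'e) tvec \<Rightarrow> ('p, 'e) tvec \<Rightarrow> real) \<Rightarrow> ('p, 'e) vfield \<Rightarrow> ('p, 'e) vfield \<Rightarrow> bool"
  where "orthonormal_frame2 A D ip X Y \<longleftrightarrow>
    frame_on A D 2 (points A) (\<lambda>i. if i = 0 then X else Y) \<and>
    (\<forall>q\<in>points A. ip q (X q) (X q) = 1 \<and> ip q (Y q) (Y q) = 1 \<and> ip q (X q) (Y q) = 0)"

section \<open>The cotangent bundle\<close>

type_synonym ('p, 'e) covec = "'p \<times> (('p, 'e) tvec \<Rightarrow> real)"

definition cot_chart :: "('p, 'e::euclidean_space) chart set \<Rightarrow> ('p, 'e) chart
    \<Rightarrow> (('p, 'e) covec, 'e \<times> 'e) chart"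
  where "cot_chart A c = (Sigma (fst c) (cotangent_space A),
    \<lambda>(p, l). (snd c p, \<Sum>b\<in>Basis. l (coord_vec A c p b) *\<^sub>R b))"

definition cot_atlas :: "('p, 'e::euclidean_space) chart set
    \<Rightarrow> (('p, 'e) covec, 'e \<times> 'e) chart set"
  where "cot_atlas A = cot_chart A ` A"

definition momentum :: "('p, 'e) vfield \<Rightarrow> ('p, 'e) covec \<Rightarrow> real"
  where "momentum X = (\<lambda>(q, l). l (X q))"

text \<open>The 1-form \<open>s\<^sub>\<lambda> = \<lambda> \<circ> \<pi>\<^sub>*\<close>, with \<open>\<pi> = fst\<close>.\<close>

definition tautological_form :: "('p, 'e::euclidean_space) chart set \<Rightarrow> ('p, 'e) covec
    \<Rightarrow> (('p, 'e) covec, 'e \<times> 'e) tvec \<Rightarrow> real"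
  where "tautological_form A = (\<lambda>(p, l) w. l (tangent_map (cot_atlas A) A fst (p, l) w))"

text \<open>\<open>d\<omega>(V,W) = V(\<omega>(W)) - W(\<omega>(V)) - \<omega>([V,W])\<close>, evaluated on vector fields with constant
  components in a chart, for which the last term vanishes.\<close>

definition ext_deriv :: "('p, 'e::euclidean_space) chart set \<Rightarrow> ('p \<Rightarrow> ('p, 'e) tvec \<Rightarrow> real)
    \<Rightarrow> 'p \<Rightarrow> ('p, 'e) tvec \<Rightarrow> ('p, 'e) tvec \<Rightarrow> real"
  where "ext_deriv A \<omega> p v w = (let c = chart_at A p in
    frechet_derivative (\<lambda>x. \<omega> (cinv c x) (coord_vec A c (cinv c x) (w c))) (at (snd c p)) (v c) -
    frechet_derivative (\<lambda>x. \<omega> (cinv c x) (coord_vec A c (cinv c x) (v c))) (at (snd c p)) (w c))"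

definition symplectic_form :: "('p, 'e::euclidean_space) chart set \<Rightarrow> ('p, 'e) covec
    \<Rightarrow> (('p, 'e) covec, 'e \<times> 'e) tvec \<Rightarrow> (('p, 'e) covec, 'e \<times> 'e) tvec \<Rightarrow> real"
  where "symplectic_form A = ext_deriv (cot_atlas A) (tautological_form A)"

section \<open>Hamiltonian vector fields and superintegrability\<close>

text \<open>Below \<open>M\<close> is the atlas of a manifold with symplectic form \<open>\<sigma>\<close>. The sign convention is
  \<open>\<sigma>(\<sqdot>, V) = da\<close> for the Hamiltonian vector field \<open>V\<close> of \<open>a\<close>.\<close>

definition hamiltonian_vf :: "('p, 'e::euclidean_space) chart set
    \<Rightarrow> ('p \<Rightarrow> ('p, 'e) tvec \<Rightarrow> ('p, 'e) tvec \<Rightarrow> real) \<Rightarrow> ('p \<Rightarrow> real) \<Rightarrow> ('p, 'e) vfield"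
  where "hamiltonian_vf M \<sigma> a p = (THE v. v \<in> tangent_space M p \<and>
    (\<forall>w\<in>tangent_space M p. \<sigma> p w v = differential M a p w))"

definition poisson :: "('p, 'e::euclidean_space) chart set
    \<Rightarrow> ('p \<Rightarrow> ('p, 'e) tvec \<Rightarrow> ('p, 'e) tvec \<Rightarrow> real) \<Rightarrow> ('p \<Rightarrow> real) \<Rightarrow> ('p \<Rightarrow> real) \<Rightarrow> 'p \<Rightarrow> real"
  where "poisson M \<sigma> a b p = differential M b p (hamiltonian_vf M \<sigma> a p)"

definition integral_of :: "('p, 'e::euclidean_space) chart set
    \<Rightarrow> ('p \<Rightarrow> ('p, 'e) tvec \<Rightarrow> ('p, 'e) tvec \<Rightarrow> real) \<Rightarrow> ('p \<Rightarrow> real) \<Rightarrow> ('p \<Rightarrow> real) \<Rightarrow> bool"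
  where "integral_of M \<sigma> H a \<longleftrightarrow> smooth_fun M a \<and> (\<forall>p\<in>points M. poisson M \<sigma> H a p = 0)"

definition functionally_independent :: "('p, 'e::euclidean_space) chart set \<Rightarrow> 'p set \<Rightarrow> nat
    \<Rightarrow> (nat \<Rightarrow> 'p \<Rightarrow> real) \<Rightarrow> bool"
  where "functionally_independent M U k F \<longleftrightarrow>
    (\<forall>p\<in>U. inj_on (\<lambda>i. differential M (F i) p) {..<k} \<and>
       independent ((\<lambda>i. differential M (F i) p) ` {..<k}))"

definition matrix_rank :: "nat \<Rightarrow> (nat \<Rightarrow> nat \<Rightarrow> real) \<Rightarrow> nat"
  where "matrix_rank k P = dim ((\<lambda>i j. if j < k then P i j else 0) ` {..<k})"

text \<open>Here \<open>d\<close> is half the dimension, \<open>k = 2d - n\<close> is the number of functions, indexed from 0,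
  and \<open>\<Phi>\<close> is the map \<open>(F 0, \<dots>, F (k - 1))\<close> into \<open>\<real>\<^sup>k = Euclidean_space k\<close>.\<close>

definition superintegrable :: "('p, 'e::euclidean_space) chart set
    \<Rightarrow> ('p \<Rightarrow> ('p, 'e) tvec \<Rightarrow> ('p, 'e) tvec \<Rightarrow> real) \<Rightarrow> ('p \<Rightarrow> real) \<Rightarrow> bool"
  where "superintegrable M \<sigma> H \<longleftrightarrow>
    (\<exists>d n k F P U V. \<exists>\<Phi> :: 'p \<Rightarrow> nat \<Rightarrow> real.
       DIM('e) = 2 * d \<and> 1 \<le> n \<and> n \<le> d \<and> k = 2 * d - n \<and>
       \<Phi> = (\<lambda>p i. if i < k then F i p else 0) \<and>
       F 0 = H \<and> (\<forall>i<k. smooth_fun M (F i)) \<and>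
       open_dense_in (mtop M) U \<and> functionally_independent M U k F \<and>
       (\<forall>i<k. \<forall>j<k. \<forall>p\<in>points M. poisson M \<sigma> (F i) (F j) p = P i j (\<Phi> p)) \<and>
       open_dense_in (subtopology (Euclidean_space k) (\<Phi> ` points M)) V \<and>
       (\<forall>y\<in>V. matrix_rank k (\<lambda>i j. P i j y) = 2 * d - 2 * n))"

section \<open>The sub-Riemannian Hamiltonian and the momenta of the frame\<close>

definition hfun :: "(nat \<Rightarrow> ('p, 'e) vfield) \<Rightarrow> nat \<Rightarrow> ('p, 'e) covec \<Rightarrow> real"
  where "hfun f i = momentum (f i)"

definition gfun :: "('p, 'm) monoid_scheme \<Rightarrow> ('p, 'e::euclidean_space) chart set
    \<Rightarrow> (nat \<Rightarrow> ('p, 'e) vfield) \<Rightarrow> nat \<Rightarrow> ('p, 'e) covec \<Rightarrow> real"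
  where "gfun G A f j = momentum (push_vf A (m_inv G) (f j))"

definition Ham :: "(nat \<Rightarrow> ('p, 'e) vfield) \<Rightarrow> ('p, 'e) covec \<Rightarrow> real"
  where "Ham f = (\<lambda>l. ((hfun f 1 l)\<^sup>2 + (hfun f 2 l)\<^sup>2) / 2)"

end

theory Submission
  imports Defs
begin

text \<open>Write \<open>h\<^sub>X\<close> for the momentum of a vector field \<open>X\<close> on \<open>G\<close>, so that \<open>{h\<^sub>X, h\<^sub>Y} = h\<^bsub>[X,Y]\<^esub>\<close>
  (\<open>poisson_momentum\<close>, from the expression of the symplectic form in canonical coordinates). Left- and
  right-invariant fields commute, because \<open>(0, X)\<close> and \<open>(Y, 0)\<close> commute on \<open>G \<times> G\<close> and the
  multiplication relates them to \<open>X\<close> and \<open>Y\<close> if \<open>X\<close> is left-invariant and \<open>Y\<close> right-invariant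
  (\<open>left_right_invariant_commute\<close>). Hence \<open>{h\<^sub>i, g\<^sub>j} = 0\<close>, and the \<open>g\<^sub>j\<close> are integrals of every function
  of the \<open>h\<^sub>i\<close>, in particular of \<open>H\<close>. The inversion is a diffeomorphism with \<open>e\<^sub>j = i\<^sub>* f\<^sub>j\<close>, so the
  \<open>e\<^sub>j\<close> are a frame with the structure constants of the \<open>f\<^sub>j\<close> (\<open>push_inv_bracket\<close>), and the brackets
  of the \<open>g\<^sub>j\<close> are linear in the \<open>g\<^sub>j\<close>. Both facts about brackets of fields come from
  \<open>bracket_of_related_fields\<close>, that is, from the symmetry of second derivatives.

  Independence: suppose that \<open>c dH + \<Sum> c\<^sub>j dg\<^sub>j = 0\<close> at a covector. On the Hamiltonian field of
  \<open>h\<^sub>2\<close> this relation reads \<open>c {h\<^sub>2, H} = c h\<^sub>0 h\<^sub>1 = 0\<close>, whence \<open>c = 0\<close> where \<open>h\<^sub>0 h\<^sub>1 \<noteq> 0\<close>. On the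
  vertical vector of a covector \<open>m\<close> it then reads \<open>\<Sum> c\<^sub>j m(e\<^sub>j) = 0\<close>, whence \<open>c\<^sub>j = 0\<close>, since the
  \<open>e\<^sub>j\<close> are a frame (\<open>integrals_independent\<close>).

  Superintegrability holds with \<open>d = 3\<close>, \<open>n = 2\<close> and the four integrals \<open>H, g\<^sub>0, g\<^sub>1, g\<^sub>2\<close>. Their
  Poisson matrix is a function of the \<open>g\<^sub>j\<close>; it is an antisymmetric \<open>3 \<times> 3\<close> matrix bordered by
  zeros, one of its entries is \<open>g\<^sub>0\<close>, and its rank is \<open>2\<close> where \<open>g\<^sub>0 \<noteq> 0\<close> (\<open>rank_poisson_matrix\<close>).
  The conditions \<open>h\<^sub>0 h\<^sub>1 \<noteq> 0\<close> and \<open>g\<^sub>0 \<noteq> 0\<close> are open and dense because the momenta of a frame are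
  linear coordinates on the fibres of the cotangent bundle.\<close>

section \<open>Calculus of smooth maps\<close>

lemma Ck_on_cong:
  assumes "open S" "\<And>x. x \<in> S \<Longrightarrow> f x = g x"
  shows "Ck_on k S f \<longleftrightarrow> Ck_on k S g"
proof -
  have imp: "Ck_on k S g" if "Ck_on k S f" "\<And>x. x \<in> S \<Longrightarrow> f x = g x" for f g :: "'a \<Rightarrow> 'b"
    using that
  proof (induction k arbitrary: f g)
    case 0 then show ?case by (simp cong: continuous_on_cong)
  next
    case (Suc k)
    have d: "f differentiable at x" if "x \<in> S" for x using Suc.prems that by simp
    have e: "frechet_derivative f (at x) = frechet_derivative g (at x)" if "x \<in> S" for x
      using frechet_derivative_transform_within_open[OF d[OF that] assms(1) that] Suc.prems(2) by blast
    have "g differentiable at x" if "x \<in> S" for x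
      using has_derivative_transform_within_open[OF _ assms(1) that, of f _ UNIV g] d[OF that] Suc.prems(2)
      unfolding differentiable_def by metis
    moreover have "Ck_on k S (\<lambda>x. frechet_derivative g (at x) v)" for v
      using Suc.IH[of "\<lambda>x. frechet_derivative f (at x) v"] Suc.prems e by simp
    ultimately show ?case by simp
  qed
  show ?thesis by (rule iffI; erule imp) (simp_all add: assms(2))
qed

lemma Ck_on_Suc_imp: "Ck_on (Suc k) S f \<Longrightarrow> Ck_on k S f"
proof (induction k arbitrary: f)
  case 0
  then show ?case
    by (auto intro!: continuous_at_imp_continuous_on differentiable_imp_continuous_within)
next
  case (Suc k) then show ?case by simp
qed

lemma Ck_on_local:
  assumes "\<And>x. x \<in> S \<Longrightarrow> \<exists>T. open T \<and> x \<in> T \<and> Ck_on k T f"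
  shows "Ck_on k S f"
  using assms
proof (induction k arbitrary: f)
  case 0
  show ?case
    unfolding Ck_on.simps
  proof (rule continuous_at_imp_continuous_on, intro ballI)
    fix x assume "x \<in> S"
    then obtain T where "open T" "x \<in> T" "Ck_on 0 T f" using 0 by blast
    then show "isCont f x" by (auto simp: continuous_on_eq_continuous_at)
  qed
next
  case (Suc k)
  have "f differentiable at x" if "x \<in> S" for x using Suc.prems[OF that] by auto
  moreover have "Ck_on k S (\<lambda>x. frechet_derivative f (at x) v)" for v
    by (rule Suc.IH) (use Suc.prems in force)
  ultimately show ?case by simp
qed

lemma Ck_on_const: "Ck_on k S (\<lambda>x. c)"
proof (induction k arbitrary: c)
  case (Suc k) then show ?case by simp
qed simp

lemma Ck_on_bounded_linear: "bounded_linear f \<Longrightarrow> Ck_on k S f"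
proof (cases k)
  case 0
  assume "bounded_linear f" then show ?thesis using 0 by (simp add: linear_continuous_on)
next
  case (Suc n)
  assume f: "bounded_linear f"
  then have "frechet_derivative f (at x) = f" for x
    by (metis bounded_linear_imp_has_derivative frechet_derivative_at)
  then show ?thesis using f Suc by (simp add: Ck_on_const bounded_linear_imp_differentiable)
qed

lemma Ck_on_add:
  assumes "open S"
  shows "Ck_on k S u \<Longrightarrow> Ck_on k S w \<Longrightarrow> Ck_on k S (\<lambda>x. u x + w x)"
proof (induction k arbitrary: u w)
  case 0 then show ?case by (simp add: continuous_on_add)
next
  case (Suc k)
  have h: "((\<lambda>x. u x + w x) has_derivative
      (\<lambda>v. frechet_derivative u (at x) v + frechet_derivative w (at x) v)) (at x)" if "x \<in> S" for x
    using that Suc.prems by (intro has_derivative_add) (auto simp: frechet_derivative_works)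
  have e: "frechet_derivative (\<lambda>x. u x + w x) (at x) v
      = frechet_derivative u (at x) v + frechet_derivative w (at x) v" if "x \<in> S" for x v
    using frechet_derivative_at[OF h[OF that]] by metis
  have "Ck_on k S (\<lambda>x. frechet_derivative u (at x) v + frechet_derivative w (at x) v)" for v
    using Suc by simp
  then have "Ck_on k S (\<lambda>x. frechet_derivative (\<lambda>x. u x + w x) (at x) v)" for v
    by (subst Ck_on_cong[OF assms e])
  then show ?case using h by (auto simp: differentiable_def)
qed

lemma Ck_on_bounded_bilinear:
  assumes "bounded_bilinear B" "open S"
  shows "Ck_on k S f \<Longrightarrow> Ck_on k S g \<Longrightarrow> Ck_on k S (\<lambda>x. B (f x) (g x))"
proof -
  interpret bounded_bilinear B by fact
  show "Ck_on k S f \<Longrightarrow> Ck_on k S g \<Longrightarrow> Ck_on k S (\<lambda>x. B (f x) (g x))"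
  proof (induction k arbitrary: f g)
    case 0 then show ?case by (simp add: continuous_on)
  next
    case (Suc k)
    have h: "((\<lambda>x. B (f x) (g x)) has_derivative (\<lambda>v. B (f x) (frechet_derivative g (at x) v)
        + B (frechet_derivative f (at x) v) (g x))) (at x)" if "x \<in> S" for x
      using that Suc.prems by (intro FDERIV) (auto simp: frechet_derivative_works)
    have e: "frechet_derivative (\<lambda>x. B (f x) (g x)) (at x) v
        = B (f x) (frechet_derivative g (at x) v) + B (frechet_derivative f (at x) v) (g x)"
      if "x \<in> S" for x v
      using frechet_derivative_at[OF h[OF that]] by metis
    have "Ck_on k S (\<lambda>x. B (f x) (frechet_derivative g (at x) v)
        + B (frechet_derivative f (at x) v) (g x))" for v
      using Suc Ck_on_Suc_imp[of k S f] Ck_on_Suc_imp[of k S g]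
      by (intro Ck_on_add[OF assms(2)] Suc.IH) auto
    then have "Ck_on k S (\<lambda>x. frechet_derivative (\<lambda>x. B (f x) (g x)) (at x) v)" for v
      by (subst Ck_on_cong[OF assms(2) e])
    then show ?case using h by (auto simp: differentiable_def)
  qed
qed

lemma Ck_on_sum:
  fixes f :: "'i \<Rightarrow> 'a::euclidean_space \<Rightarrow> 'b::real_normed_vector"
  assumes "open S" "\<And>i. i \<in> I \<Longrightarrow> Ck_on k S (f i)"
  shows "Ck_on k S (\<lambda>x. \<Sum>i\<in>I. f i x)"
  using assms(2)
  by (induction I rule: infinite_finite_induct)
     (auto simp: Ck_on_const intro!: Ck_on_add[OF assms(1)])

text \<open>The derivative is evaluated on the components of the direction in an orthonormal basis, so
  that only derivatives in constant directions occur, as in the definition of \<open>Ck_on\<close>.\<close>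

lemma linear_expand_Basis:
  fixes L :: "'a::euclidean_space \<Rightarrow> 'b::real_vector"
  assumes "linear L"
  shows "L v = (\<Sum>b\<in>Basis. (v \<bullet> b) *\<^sub>R L b)"
proof -
  have "L v = L (\<Sum>b\<in>Basis. (v \<bullet> b) *\<^sub>R b)" by (simp add: euclidean_representation)
  also have "\<dots> = (\<Sum>b\<in>Basis. (v \<bullet> b) *\<^sub>R L b)"
    using assms by (simp add: linear_sum linear_cmul)
  finally show ?thesis .
qed

lemma Ck_on_inner_left:
  assumes "open S" "Ck_on k S f"
  shows "Ck_on k S (\<lambda>x. f x \<bullet> b)"
  by (rule Ck_on_bounded_bilinear[OF bounded_bilinear_inner assms Ck_on_const])

lemma Ck_on_compose:
  fixes g :: "'a::euclidean_space \<Rightarrow> 'b::euclidean_space"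
  assumes "open S" "open T" "g ` S \<subseteq> T"
  shows "Ck_on k T f \<Longrightarrow> Ck_on k S g \<Longrightarrow> Ck_on k S (f \<circ> g)"
proof (induction k arbitrary: f)
  case 0
  then show ?case using assms(3) by (auto intro!: continuous_on_compose intro: continuous_on_subset simp del: comp_apply)
next
  case (Suc k)
  have d: "f differentiable at (g x)" "g differentiable at x" if "x \<in> S" for x
    using that Suc.prems assms(3) by auto
  have e: "frechet_derivative (f \<circ> g) (at x) v = (\<Sum>b\<in>Basis.
      (frechet_derivative g (at x) v \<bullet> b) *\<^sub>R ((\<lambda>y. frechet_derivative f (at y) b) \<circ> g) x)"
    if "x \<in> S" for x v
    unfolding frechet_derivative_compose[OF d(2)[OF that] d(1)[OF that]] comp_apply
    by (rule linear_expand_Basis[OF linear_frechet_derivative[OF d(1)[OF that]]])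
  have "Ck_on k S (\<lambda>x. \<Sum>b\<in>Basis.
      (frechet_derivative g (at x) v \<bullet> b) *\<^sub>R ((\<lambda>y. frechet_derivative f (at y) b) \<circ> g) x)" for v
    using Suc.prems
    by (intro Ck_on_sum Ck_on_bounded_bilinear[OF bounded_bilinear_scaleR] Ck_on_inner_left assms(1)
        Suc.IH Ck_on_Suc_imp[OF Suc.prems(2)]) simp_all
  then have "Ck_on k S (\<lambda>x. frechet_derivative (f \<circ> g) (at x) v)" for v
    by (subst Ck_on_cong[OF assms(1) e])
  then show ?case unfolding Ck_on.simps using d differentiable_chain_at by blast
qed

lemma smooth_on_cong:
  "open S \<Longrightarrow> (\<And>x. x \<in> S \<Longrightarrow> f x = g x) \<Longrightarrow> smooth_on S f \<longleftrightarrow> smooth_on S g"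
  unfolding smooth_on_def by (intro iff_allI Ck_on_cong)

lemma smooth_on_local:
  assumes "\<And>x. x \<in> S \<Longrightarrow> \<exists>T. open T \<and> x \<in> T \<and> smooth_on T f"
  shows "smooth_on S f"
  unfolding smooth_on_def by (intro allI Ck_on_local) (use assms in \<open>auto simp: smooth_on_def\<close>)

lemma smooth_on_differentiable: "smooth_on S f \<Longrightarrow> x \<in> S \<Longrightarrow> f differentiable at x"
  unfolding smooth_on_def by (drule spec[of _ 1]) simp

lemma smooth_on_continuous: "smooth_on S f \<Longrightarrow> continuous_on S f"
  unfolding smooth_on_def by (drule spec[of _ 0]) simp

lemma smooth_on_derivative: "smooth_on S f \<Longrightarrow> smooth_on S (\<lambda>x. frechet_derivative f (at x) v)"
  unfolding smooth_on_def by (rule allI, drule_tac x = "Suc k" in spec) simp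

lemma smooth_on_bounded_linear: "bounded_linear f \<Longrightarrow> smooth_on S f"
  unfolding smooth_on_def using Ck_on_bounded_linear by blast

lemma smooth_on_bounded_bilinear:
  assumes "bounded_bilinear B" "open S" "smooth_on S f" "smooth_on S g"
  shows "smooth_on S (\<lambda>x. B (f x) (g x))"
  using assms(3,4) unfolding smooth_on_def by (blast intro: Ck_on_bounded_bilinear[OF assms(1,2)])

lemma smooth_on_add:
  assumes "open S" "smooth_on S f" "smooth_on S g"
  shows "smooth_on S (\<lambda>x. f x + g x)"
  using assms(2,3) unfolding smooth_on_def by (blast intro: Ck_on_add[OF assms(1)])

lemma smooth_on_sum:
  "open S \<Longrightarrow> (\<And>i. i \<in> I \<Longrightarrow> smooth_on S (f i)) \<Longrightarrow> smooth_on S (\<lambda>x. \<Sum>i\<in>I. f i x)"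
  unfolding smooth_on_def by (intro allI Ck_on_sum) simp_all

lemma smooth_on_compose:
  fixes g :: "'a::euclidean_space \<Rightarrow> 'b::euclidean_space"
  assumes "open S" "open T" "g ` S \<subseteq> T" "smooth_on T f" "smooth_on S g"
  shows "smooth_on S (f \<circ> g)"
  using assms(4,5) unfolding smooth_on_def by (blast intro: Ck_on_compose[OF assms(1-3)])

lemma smooth_on_derivative_along:
  fixes g :: "'a::euclidean_space \<Rightarrow> 'b::euclidean_space"
  assumes "open S" "open T" "g ` S \<subseteq> T" "smooth_on T f" "smooth_on S g" "smooth_on S u"
  shows "smooth_on S (\<lambda>x. frechet_derivative f (at (g x)) (u x))"
proof -
  have e: "frechet_derivative f (at (g x)) (u x)
      = (\<Sum>b\<in>Basis. (u x \<bullet> b) *\<^sub>R ((\<lambda>y. frechet_derivative f (at y) b) \<circ> g) x)" if "x \<in> S" for x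
    using linear_expand_Basis[OF linear_frechet_derivative[OF smooth_on_differentiable[OF assms(4)]],
        of "g x" "u x"] that assms(3) by (simp add: image_subset_iff)
  have "smooth_on S (\<lambda>x. \<Sum>b\<in>Basis. (u x \<bullet> b) *\<^sub>R ((\<lambda>y. frechet_derivative f (at y) b) \<circ> g) x)"
    using assms
    by (intro smooth_on_sum smooth_on_bounded_bilinear[OF bounded_bilinear_scaleR]
        smooth_on_bounded_bilinear[OF bounded_bilinear_inner] smooth_on_compose[of _ T]
        smooth_on_derivative)
       (auto simp: smooth_on_def Ck_on_const)
  then show ?thesis by (subst smooth_on_cong[OF assms(1) e])
qed

section \<open>Symmetry of the second derivative\<close>

text \<open>The mean value theorem is applied twice: along \<open>u\<close> to the difference of \<open>F\<close> between the two
  sides of the parallelogram, then along \<open>v\<close> to the derivative of \<open>F\<close> in the direction \<open>u\<close>.\<close>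

lemma second_difference_mvt:
  fixes F :: "'a::euclidean_space \<Rightarrow> real"
  assumes "0 < h" and C2: "Ck_on 2 S F"
    and S: "\<And>s t. 0 \<le> s \<Longrightarrow> s \<le> h \<Longrightarrow> 0 \<le> t \<Longrightarrow> t \<le> h \<Longrightarrow> x + s *\<^sub>R u + t *\<^sub>R v \<in> S"
  shows "\<exists>s t. 0 \<le> s \<and> s \<le> h \<and> 0 \<le> t \<and> t \<le> h \<and>
    F (x + h *\<^sub>R u + h *\<^sub>R v) - F (x + h *\<^sub>R u) - F (x + h *\<^sub>R v) + F x
    = h^2 * frechet_derivative (\<lambda>y. frechet_derivative F (at y) u) (at (x + s *\<^sub>R u + t *\<^sub>R v)) v"
proof -
  have d1: "F differentiable at y" and d2: "(\<lambda>y. frechet_derivative F (at y) u) differentiable at y"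
    if "y \<in> S" for y
    using C2 that by (simp_all add: numeral_2_eq_2)
  let ?p = "\<lambda>s. F (x + s *\<^sub>R u + h *\<^sub>R v) - F (x + s *\<^sub>R u)"
  have c1: "(F \<circ> (\<lambda>s. x + s *\<^sub>R u + t *\<^sub>R v) has_derivative
      frechet_derivative F (at (x + s *\<^sub>R u + t *\<^sub>R v)) \<circ> (\<lambda>r. r *\<^sub>R u)) (at s)"
    if "0 \<le> s" "s \<le> h" "0 \<le> t" "t \<le> h" for s t
    by (intro diff_chain_at) (auto intro!: derivative_eq_intros simp: frechet_derivative_works[symmetric] d1 S that)
  have "\<exists>s\<in>{0<..<h}. ?p h - ?p 0 = (\<lambda>r. r * (frechet_derivative F (at (x + s *\<^sub>R u + h *\<^sub>R v)) u
      - frechet_derivative F (at (x + s *\<^sub>R u)) u)) (h - 0)"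
  proof (rule mvt_simple[OF \<open>0 < h\<close>])
    fix s assume s: "0 \<le> s" "s \<le> h"
    have "(?p has_derivative (\<lambda>r. frechet_derivative F (at (x + s *\<^sub>R u + h *\<^sub>R v)) (r *\<^sub>R u)
      - frechet_derivative F (at (x + s *\<^sub>R u)) (r *\<^sub>R u))) (at s)"
      using has_derivative_diff[OF c1[OF s, of h] c1[OF s, of 0]] \<open>0 < h\<close> by (simp add: o_def)
    moreover have "linear (frechet_derivative F (at (x + s *\<^sub>R u + h *\<^sub>R v)))"
      using s S[of s h] \<open>0 < h\<close> by (intro linear_frechet_derivative d1) simp
    moreover have "linear (frechet_derivative F (at (x + s *\<^sub>R u)))"
      using s S[of s 0] \<open>0 < h\<close> by (intro linear_frechet_derivative d1) simp
    ultimately show "(?p has_derivative (\<lambda>r. r * (frechet_derivative F (at (x + s *\<^sub>R u + h *\<^sub>R v)) u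
      - frechet_derivative F (at (x + s *\<^sub>R u)) u))) (at s within {0..h})"
      by (simp only: linear_cmul real_scaleR_def right_diff_distrib has_derivative_at_withinI)
  qed
  then obtain s where s: "0 \<le> s" "s \<le> h" and e1: "?p h - ?p 0
      = h * (frechet_derivative F (at (x + s *\<^sub>R u + h *\<^sub>R v)) u - frechet_derivative F (at (x + s *\<^sub>R u)) u)"
    by (simp only: diff_zero) (meson greaterThanLessThan_iff less_imp_le)
  let ?q = "\<lambda>t. frechet_derivative F (at (x + s *\<^sub>R u + t *\<^sub>R v)) u"
  let ?D = "\<lambda>t. frechet_derivative (\<lambda>y. frechet_derivative F (at y) u) (at (x + s *\<^sub>R u + t *\<^sub>R v))"
  have "\<exists>t\<in>{0<..<h}. ?q h - ?q 0 = (\<lambda>r. r * ?D t v) (h - 0)"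
  proof (rule mvt_simple[OF \<open>0 < h\<close>])
    fix t assume t: "0 \<le> t" "t \<le> h"
    have "((\<lambda>y. frechet_derivative F (at y) u) \<circ> (\<lambda>t. x + s *\<^sub>R u + t *\<^sub>R v) has_derivative
      ?D t \<circ> (\<lambda>r. r *\<^sub>R v)) (at t)"
      by (intro diff_chain_at) (auto intro!: derivative_eq_intros simp: frechet_derivative_works[symmetric] d2 S s t)
    moreover have "linear (?D t)" by (intro linear_frechet_derivative d2 S s t)
    ultimately show "(?q has_derivative (\<lambda>r. r * ?D t v)) (at t within {0..h})"
      by (simp add: o_def linear_cmul has_derivative_at_withinI)
  qed
  then obtain t where t: "0 \<le> t" "t \<le> h" and e2: "?q h - ?q 0 = h * ?D t v"
    by (simp only: diff_zero) (meson greaterThanLessThan_iff less_imp_le)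
  have "?p h - ?p 0 = h * (h * ?D t v)" using e1 e2 by simp
  moreover have "?p h - ?p 0 = F (x + h *\<^sub>R u + h *\<^sub>R v) - F (x + h *\<^sub>R u) - F (x + h *\<^sub>R v) + F x"
    by simp
  ultimately show ?thesis using s t
    by (intro exI[of _ s] exI[of _ t]) (simp add: power2_eq_square mult.assoc)
qed

text \<open>Both iterated derivatives are limits of the same second difference quotient, which is
  symmetric in the two directions.\<close>

lemma second_derivative_symmetric_real:
  fixes F :: "'a::euclidean_space \<Rightarrow> real"
  assumes "open S" "x \<in> S" and C2: "Ck_on 2 S F"
  shows "frechet_derivative (\<lambda>y. frechet_derivative F (at y) u) (at x) v
    = frechet_derivative (\<lambda>y. frechet_derivative F (at y) v) (at x) u"
proof -
  let ?D = "\<lambda>u v y. frechet_derivative (\<lambda>y. frechet_derivative F (at y) u) (at y) v"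
  have cont: "isCont (?D u v) x" for u v
    using C2 assms(1,2) by (simp add: numeral_2_eq_2 continuous_on_eq_continuous_at)
  have "\<bar>?D u v x - ?D v u x\<bar> \<le> e" if "0 < e" for e
  proof -
    have near: "\<forall>\<^sub>F y in nhds x. \<bar>?D u v y - ?D u v x\<bar> < e / 2" for u v
      using cont[of u v] that
      by (auto simp: isCont_def filterlim_at_within_not_equal tendsto_iff dist_real_def eventually_at_filter
          dest!: spec[of _ "e / 2"] elim: eventually_mono)
    have "\<forall>\<^sub>F y in nhds x. y \<in> S \<and> \<bar>?D u v y - ?D u v x\<bar> < e / 2 \<and> \<bar>?D v u y - ?D v u x\<bar> < e / 2"
      by (intro eventually_conj near eventually_nhds_in_open assms)
    then obtain r where r: "0 < r" and rS: "\<And>y. dist y x < r \<Longrightarrow>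
        y \<in> S \<and> \<bar>?D u v y - ?D u v x\<bar> < e / 2 \<and> \<bar>?D v u y - ?D v u x\<bar> < e / 2"
      unfolding eventually_nhds_metric by blast
    \<comment> \<open>The parallelogram spanned by \<open>h u\<close> and \<open>h v\<close> has to fit into the ball of radius \<open>r\<close>.\<close>
    define h where "h = r / (norm u + norm v + 1)"
    have pos: "norm u + norm v + 1 > 0" by (simp add: add_nonneg_pos)
    have h: "0 < h" using r pos by (simp add: h_def)
    have hr: "h * norm u + h * norm v < r"
      using pos r by (simp add: h_def divide_simps distrib_left[symmetric])
    have small: "dist (x + s *\<^sub>R a + t *\<^sub>R b) x < r"
      if "0 \<le> s" "s \<le> h" "0 \<le> t" "t \<le> h" "a = u \<and> b = v \<or> a = v \<and> b = u" for s t a b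
    proof -
      have "dist (x + s *\<^sub>R a + t *\<^sub>R b) x = norm (s *\<^sub>R a + t *\<^sub>R b)"
        by (simp add: dist_norm add.assoc)
      also have "\<dots> \<le> norm (s *\<^sub>R a) + norm (t *\<^sub>R b)" by (rule norm_triangle_ineq)
      also have "\<dots> \<le> h * norm a + h * norm b" using that by (auto intro!: add_mono mult_right_mono)
      finally show ?thesis using hr that(5) by auto
    qed
    obtain s t where st: "0 \<le> s" "s \<le> h" "0 \<le> t" "t \<le> h"
      "F (x + h *\<^sub>R u + h *\<^sub>R v) - F (x + h *\<^sub>R u) - F (x + h *\<^sub>R v) + F x
        = h^2 * ?D u v (x + s *\<^sub>R u + t *\<^sub>R v)"
      using second_difference_mvt[OF h C2, of x u v] rS small by blast
    obtain s' t' where st': "0 \<le> s'" "s' \<le> h" "0 \<le> t'" "t' \<le> h"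
      "F (x + h *\<^sub>R v + h *\<^sub>R u) - F (x + h *\<^sub>R v) - F (x + h *\<^sub>R u) + F x
        = h^2 * ?D v u (x + s' *\<^sub>R v + t' *\<^sub>R u)"
      using second_difference_mvt[OF h C2, of x v u] rS small by blast
    have "h^2 * ?D u v (x + s *\<^sub>R u + t *\<^sub>R v) = h^2 * ?D v u (x + s' *\<^sub>R v + t' *\<^sub>R u)"
      using st(5) st'(5) by (simp only: add.assoc add.commute[of "h *\<^sub>R u" "h *\<^sub>R v"])
    then have "?D u v (x + s *\<^sub>R u + t *\<^sub>R v) = ?D v u (x + s' *\<^sub>R v + t' *\<^sub>R u)"
      using h mult_left_cancel[of "h^2"] by simp
    moreover have "\<bar>?D u v (x + s *\<^sub>R u + t *\<^sub>R v) - ?D u v x\<bar> < e / 2"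
      using rS small[of s t u v] st by blast
    moreover have "\<bar>?D v u (x + s' *\<^sub>R v + t' *\<^sub>R u) - ?D v u x\<bar> < e / 2"
      using rS small[of s' t' v u] st' by blast
    ultimately show ?thesis by linarith
  qed
  then show ?thesis by (metis abs_le_zero_iff eq_iff_diff_eq_0 field_le_epsilon add.left_neutral)
qed

lemma frechet_derivative_inner:
  assumes "f differentiable at x"
  shows "frechet_derivative (\<lambda>y. f y \<bullet> b) (at x) v = frechet_derivative f (at x) v \<bullet> b"
  using frechet_derivative_at[OF has_derivative_inner_left[OF assms[unfolded frechet_derivative_works], of b]]
  by (rule fun_cong[OF sym])

lemma second_derivative_symmetric:
  fixes F :: "'a::euclidean_space \<Rightarrow> 'b::euclidean_space"
  assumes "open S" "x \<in> S" and F: "smooth_on S F"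
  shows "frechet_derivative (\<lambda>y. frechet_derivative F (at y) u) (at x) v
    = frechet_derivative (\<lambda>y. frechet_derivative F (at y) v) (at x) u"
proof (rule euclidean_eqI)
  fix b :: 'b
  have Fb: "smooth_on S (\<lambda>y. F y \<bullet> b)"
    using Ck_on_inner_left[OF assms(1)] F unfolding smooth_on_def by blast
  have "frechet_derivative (\<lambda>y. frechet_derivative (\<lambda>y. F y \<bullet> b) (at y) u) (at x) v
      = frechet_derivative (\<lambda>y. frechet_derivative F (at y) u) (at x) v \<bullet> b" for u v
  proof -
    have "frechet_derivative (\<lambda>y. frechet_derivative (\<lambda>y. F y \<bullet> b) (at y) u) (at x)
      = frechet_derivative (\<lambda>y. frechet_derivative F (at y) u \<bullet> b) (at x)"
      by (rule frechet_derivative_transform_within_open[OF _ assms(1,2)])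
         (auto intro!: smooth_on_differentiable[OF _ assms(2)] smooth_on_derivative Fb
           frechet_derivative_inner smooth_on_differentiable[OF F])
    then show ?thesis
      by (simp add: frechet_derivative_inner smooth_on_differentiable[OF smooth_on_derivative[OF F] assms(2)])
  qed
  then show "frechet_derivative (\<lambda>y. frechet_derivative F (at y) u) (at x) v \<bullet> b
    = frechet_derivative (\<lambda>y. frechet_derivative F (at y) v) (at x) u \<bullet> b"
    using second_derivative_symmetric_real[OF assms(1,2), of "\<lambda>y. F y \<bullet> b" u v] Fb
    unfolding smooth_on_def by simp
qed

text \<open>Differentiating \<open>X' (F y) = DF(y) (X y)\<close> along \<open>Y\<close> produces \<open>D\<^sup>2F(Y, X)\<close>, which cancels
  against \<open>D\<^sup>2F(X, Y)\<close> when the roles of the two fields are exchanged.\<close>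

lemma bracket_of_related_fields:
  fixes F :: "'a::euclidean_space \<Rightarrow> 'b::euclidean_space"
  assumes "open S" "x \<in> S" and F: "smooth_on S F"
    and "X differentiable at x" "Y differentiable at x"
    and "X' differentiable at (F x)" "Y' differentiable at (F x)"
    and X': "\<And>y. y \<in> S \<Longrightarrow> X' (F y) = frechet_derivative F (at y) (X y)"
    and Y': "\<And>y. y \<in> S \<Longrightarrow> Y' (F y) = frechet_derivative F (at y) (Y y)"
  shows "frechet_derivative Y' (at (F x)) (X' (F x)) - frechet_derivative X' (at (F x)) (Y' (F x))
    = frechet_derivative F (at x)
        (frechet_derivative Y (at x) (X x) - frechet_derivative X (at x) (Y x))"
proof -
  let ?D2 = "\<lambda>u v. frechet_derivative (\<lambda>y. frechet_derivative F (at y) u) (at x) v"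
  note dF = smooth_on_differentiable[OF F]
  note d2F = smooth_on_differentiable[OF smooth_on_derivative[OF F] \<open>x \<in> S\<close>]
  have linF: "linear (frechet_derivative F (at y))" if "y \<in> S" for y
    using linear_frechet_derivative dF that by blast
  \<comment> \<open>\<open>?D2 u v\<close> is linear in the outer direction \<open>v\<close>; symmetry makes it linear in the inner
    direction \<open>u\<close>, along which the fields are expanded below.\<close>
  have D2sum: "(\<Sum>b\<in>Basis. (w \<bullet> b) *\<^sub>R ?D2 b v) = ?D2 v w" for w v
  proof -
    have "(\<Sum>b\<in>Basis. (w \<bullet> b) *\<^sub>R ?D2 b v) = (\<Sum>b\<in>Basis. (w \<bullet> b) *\<^sub>R ?D2 v b)"
      using second_derivative_symmetric[OF assms(1-3)] by simp
    also have "\<dots> = ?D2 v w"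
      using linear_expand_Basis[OF linear_frechet_derivative[OF d2F], of v w] by simp
    finally show ?thesis .
  qed
  have diff: "frechet_derivative Z' (at (F x)) (frechet_derivative F (at x) v)
      = ?D2 v (Z x) + frechet_derivative F (at x) (frechet_derivative Z (at x) v)"
    if Z: "Z differentiable at x" "Z' differentiable at (F x)"
      and Z': "\<And>y. y \<in> S \<Longrightarrow> Z' (F y) = frechet_derivative F (at y) (Z y)" for Z Z' v
  proof -
    have "((\<lambda>y. \<Sum>b\<in>Basis. (Z y \<bullet> b) *\<^sub>R frechet_derivative F (at y) b) has_derivative
        (\<lambda>v. \<Sum>b\<in>Basis. (Z x \<bullet> b) *\<^sub>R ?D2 b v +
          (frechet_derivative Z (at x) v \<bullet> b) *\<^sub>R frechet_derivative F (at x) b)) (at x)"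
      by (intro has_derivative_sum has_derivative_scaleR has_derivative_inner_left)
         (use Z d2F in \<open>simp_all add: frechet_derivative_works[symmetric]\<close>)
    moreover have "(\<Sum>b\<in>Basis. (Z y \<bullet> b) *\<^sub>R frechet_derivative F (at y) b) = (Z' \<circ> F) y" if "y \<in> S" for y
      using Z' linear_expand_Basis[OF linF] that by simp
    ultimately have "(Z' \<circ> F has_derivative (\<lambda>v. \<Sum>b\<in>Basis. (Z x \<bullet> b) *\<^sub>R ?D2 b v +
          (frechet_derivative Z (at x) v \<bullet> b) *\<^sub>R frechet_derivative F (at x) b)) (at x)"
      using has_derivative_transform_within_open[OF _ assms(1,2)] by blast
    moreover have "(Z' \<circ> F has_derivative
        frechet_derivative Z' (at (F x)) \<circ> frechet_derivative F (at x)) (at x)"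
      using Z(2) dF[OF assms(2)] unfolding frechet_derivative_works by (rule diff_chain_at[rotated])
    ultimately have "(\<lambda>v. \<Sum>b\<in>Basis. (Z x \<bullet> b) *\<^sub>R ?D2 b v +
          (frechet_derivative Z (at x) v \<bullet> b) *\<^sub>R frechet_derivative F (at x) b)
        = frechet_derivative Z' (at (F x)) \<circ> frechet_derivative F (at x)"
      by (rule has_derivative_unique)
    note fun_cong[OF this, of v]
    then show ?thesis
      by (simp add: sum.distrib D2sum linear_expand_Basis[OF linF[OF assms(2)], of "frechet_derivative Z (at x) v"])
  qed
  show ?thesis
    using diff[OF assms(4,6) X', of "Y x"] diff[OF assms(5,7) Y', of "X x"]
      second_derivative_symmetric[OF assms(1-3), of "X x" "Y x"] X'[OF assms(2)] Y'[OF assms(2)]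
    by (simp add: linear_diff[OF linF[OF assms(2)]])
qed

section \<open>Tangent vectors in charts\<close>

lemma chart_cinv:
  assumes "x \<in> snd c ` fst c"
  shows "snd c (cinv c x) = x" "cinv c x \<in> fst c"
  using assms by (auto simp: cinv_def f_inv_into_f inv_into_into)

text \<open>Tangent spaces, tangent maps and differentials rest on nothing but the chain rule between
  charts. The following conditions make it available, and hold alike for the atlas of a manifold,
  for the product atlas on \<open>G \<times> G\<close> and for the atlas of the cotangent bundle.\<close>

locale diff_atlas =
  fixes M :: "('p, 'e::euclidean_space) chart set"
  assumes chart_inj: "\<And>c. c \<in> M \<Longrightarrow> inj_on (snd c) (fst c)"
    and chart_open: "\<And>c. c \<in> M \<Longrightarrow> open (snd c ` fst c)"
    and overlap_open: "\<And>c c'. c \<in> M \<Longrightarrow> c' \<in> M \<Longrightarrow> open (snd c ` (fst c \<inter> fst c'))"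
    and transition_differentiable: "\<And>c c' p. c \<in> M \<Longrightarrow> c' \<in> M \<Longrightarrow> p \<in> fst c \<Longrightarrow> p \<in> fst c' \<Longrightarrow>
      (snd c' \<circ> cinv c) differentiable at (snd c p)"
begin

lemma cinv_chart: "c \<in> M \<Longrightarrow> p \<in> fst c \<Longrightarrow> cinv c (snd c p) = p"
  using chart_inj by (simp add: cinv_def inv_into_f_f)

lemma openin_iff: "openin (mtop M) S \<longleftrightarrow> S \<subseteq> points M \<and> (\<forall>c\<in>M. open (snd c ` (S \<inter> fst c)))"
  by (rule openin_mtop) (simp add: chart_inj chart_open)

lemma topspace_mtop: "topspace (mtop M) = points M"
proof -
  have "points M \<inter> fst c = fst c" if "c \<in> M" for c using that by (auto simp: points_def)
  then have "openin (mtop M) (points M)" by (simp add: openin_iff chart_open)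
  then show ?thesis using openin_iff openin_subset by (metis openin_topspace subset_antisym)
qed

lemma chart_at:
  assumes "p \<in> points M"
  shows "chart_at M p \<in> M" "p \<in> fst (chart_at M p)"
proof -
  have "\<exists>c. c \<in> M \<and> p \<in> fst c" using assms by (auto simp: points_def)
  then show "chart_at M p \<in> M" "p \<in> fst (chart_at M p)"
    unfolding chart_at_def by (metis (mono_tags, lifting) someI_ex)+
qed

lemma in_points: "c \<in> M \<Longrightarrow> p \<in> fst c \<Longrightarrow> p \<in> points M"
  by (auto simp: points_def)

lemma chart_change:
  fixes F :: "'p \<Rightarrow> 'b::real_normed_vector"
  assumes c: "c \<in> M" "p \<in> fst c" and c2: "c2 \<in> M" "p \<in> fst c2"
    and F: "(F \<circ> cinv c) differentiable at (snd c p)"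
  shows "(F \<circ> cinv c2) differentiable at (snd c2 p)"
    and "frechet_derivative (F \<circ> cinv c2) (at (snd c2 p)) w = frechet_derivative (F \<circ> cinv c)
      (at (snd c p)) (frechet_derivative (snd c \<circ> cinv c2) (at (snd c2 p)) w)"
proof -
  have "((F \<circ> cinv c) \<circ> (snd c \<circ> cinv c2) has_derivative frechet_derivative (F \<circ> cinv c) (at (snd c p))
      \<circ> frechet_derivative (snd c \<circ> cinv c2) (at (snd c2 p))) (at (snd c2 p))"
    using transition_differentiable[OF c2(1) c(1) c2(2) c(2)] F
    unfolding frechet_derivative_works by (intro diff_chain_at) (simp_all add: cinv_chart c2)
  then have h: "(F \<circ> cinv c2 has_derivative frechet_derivative (F \<circ> cinv c) (at (snd c p))
      \<circ> frechet_derivative (snd c \<circ> cinv c2) (at (snd c2 p))) (at (snd c2 p))"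
    by (rule has_derivative_transform_within_open[OF _ overlap_open[OF c2(1) c(1)]])
       (use c c2 in \<open>auto simp: cinv_chart\<close>)
  then show "(F \<circ> cinv c2) differentiable at (snd c2 p)" unfolding differentiable_def by blast
  show "frechet_derivative (F \<circ> cinv c2) (at (snd c2 p)) w = frechet_derivative (F \<circ> cinv c)
      (at (snd c p)) (frechet_derivative (snd c \<circ> cinv c2) (at (snd c2 p)) w)"
    by (simp add: frechet_derivative_at[OF h, symmetric])
qed

lemma transition_id:
  assumes "c \<in> M" "p \<in> fst c"
  shows "frechet_derivative (snd c \<circ> cinv c) (at (snd c p)) w = w"
proof -
  have "(snd c \<circ> cinv c has_derivative (\<lambda>x. x)) (at (snd c p))"
    by (rule has_derivative_transform_within_open[OF has_derivative_ident chart_open[OF assms(1)]])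
       (use assms in \<open>auto simp: cinv_chart\<close>)
  then show ?thesis by (metis frechet_derivative_at)
qed

lemma tangent_transition:
  "v \<in> tangent_space M p \<Longrightarrow> c \<in> M \<Longrightarrow> c' \<in> M \<Longrightarrow> p \<in> fst c \<Longrightarrow> p \<in> fst c' \<Longrightarrow>
    v c' = frechet_derivative (snd c' \<circ> cinv c) (at (snd c p)) (v c)"
  unfolding tangent_space_def by blast

lemma tangent_outside: "v \<in> tangent_space M p \<Longrightarrow> \<not> (c \<in> M \<and> p \<in> fst c) \<Longrightarrow> v c = 0"
  unfolding tangent_space_def by blast

lemma tangentI:
  assumes "\<And>c c'. c \<in> M \<Longrightarrow> c' \<in> M \<Longrightarrow> p \<in> fst c \<Longrightarrow> p \<in> fst c' \<Longrightarrow>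
      v c' = frechet_derivative (snd c' \<circ> cinv c) (at (snd c p)) (v c)"
    and "\<And>c. \<not> (c \<in> M \<and> p \<in> fst c) \<Longrightarrow> v c = 0"
  shows "v \<in> tangent_space M p"
  using assms unfolding tangent_space_def by blast

lemma tangent_eqI:
  assumes "v \<in> tangent_space M p" "w \<in> tangent_space M p" "c \<in> M" "p \<in> fst c" "v c = w c"
  shows "v = w"
proof
  fix c' show "v c' = w c'"
  proof (cases "c' \<in> M \<and> p \<in> fst c'")
    case True
    then show ?thesis
      using tangent_transition[OF assms(1,3) _ assms(4), of c'] assms(5)
        tangent_transition[OF assms(2,3) _ assms(4), of c'] by (metis (no_types))
  next
    case False
    then show ?thesis using assms(1,2) tangent_outside by metis
  qed
qed

text \<open>The compatibility between two charts is the cocycle property of the coordinate changes, which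
  is the chain rule applied to a chart as a function on the manifold.\<close>

lemma coord_vec_tangent:
  assumes "c \<in> M" "p \<in> fst c"
  shows "coord_vec M c p w \<in> tangent_space M p"
proof -
  have "coord_vec M c p w c2
      = frechet_derivative (snd c2 \<circ> cinv c1) (at (snd c1 p)) (coord_vec M c p w c1)"
    if "c1 \<in> M" "p \<in> fst c1" "c2 \<in> M" "p \<in> fst c2" for c1 c2
  proof -
    have e: "coord_vec M c p w c' = frechet_derivative (snd c' \<circ> cinv c) (at (snd c p)) w"
      if "c' \<in> M" "p \<in> fst c'" for c'
      using that by (simp add: coord_vec_def)
    show ?thesis
      unfolding e[OF that(1,2)] e[OF that(3,4)]
      using that by (intro chart_change(2) assms transition_differentiable)
  qed
  moreover have "coord_vec M c p w c' = 0" if "c' \<notin> M \<or> p \<notin> fst c'" for c'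
    using that by (auto simp: coord_vec_def)
  ultimately show ?thesis unfolding tangent_space_def by blast
qed

lemma coord_vec_chart: "c \<in> M \<Longrightarrow> p \<in> fst c \<Longrightarrow> coord_vec M c p w c = w"
  by (simp add: coord_vec_def transition_id)

lemma coord_vec_of_tangent:
  "v \<in> tangent_space M p \<Longrightarrow> c \<in> M \<Longrightarrow> p \<in> fst c \<Longrightarrow> coord_vec M c p (v c) = v"
  by (rule tangent_eqI) (auto simp: coord_vec_tangent coord_vec_chart)

lemma subspace_tangent: "subspace (tangent_space M p)"
proof -
  have lin: "linear (frechet_derivative (snd c' \<circ> cinv c) (at (snd c p)))"
    if "c \<in> M" "c' \<in> M" "p \<in> fst c" "p \<in> fst c'" for c c'
    using that by (intro linear_frechet_derivative transition_differentiable)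
  show ?thesis
    unfolding subspace_def
  proof (intro conjI ballI allI)
    show "0 \<in> tangent_space M p"
      by (rule tangentI) (simp_all add: zero_fun_def linear_0[OF lin])
  next
    fix v w assume v: "v \<in> tangent_space M p" and w: "w \<in> tangent_space M p"
    show "v + w \<in> tangent_space M p"
    proof (rule tangentI)
      fix c c' assume c: "c \<in> M" "c' \<in> M" "p \<in> fst c" "p \<in> fst c'"
      show "(v + w) c' = frechet_derivative (snd c' \<circ> cinv c) (at (snd c p)) ((v + w) c)"
        by (simp only: plus_fun_def linear_add[OF lin[OF c]] tangent_transition[OF v c, symmetric]
            tangent_transition[OF w c, symmetric])
    qed (simp add: plus_fun_def tangent_outside[OF v] tangent_outside[OF w])
  next
    fix r v assume v: "v \<in> tangent_space M p"
    show "r *\<^sub>R v \<in> tangent_space M p"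
    proof (rule tangentI)
      fix c c' assume c: "c \<in> M" "c' \<in> M" "p \<in> fst c" "p \<in> fst c'"
      show "(r *\<^sub>R v) c' = frechet_derivative (snd c' \<circ> cinv c) (at (snd c p)) ((r *\<^sub>R v) c)"
        by (simp only: scaleR_fun_def linear_cmul[OF lin[OF c]] tangent_transition[OF v c, symmetric])
    qed (simp add: scaleR_fun_def tangent_outside[OF v])
  qed
qed

text \<open>Differentials and tangent maps are computed in the chart selected by \<open>chart_at\<close>; on tangent
  vectors, every other chart gives the same value.\<close>

lemma derivative_chart_indep:
  assumes "v \<in> tangent_space M p" "c \<in> M" "p \<in> fst c" "c2 \<in> M" "p \<in> fst c2"
    and "(F \<circ> cinv c) differentiable at (snd c p)"
  shows "frechet_derivative (F \<circ> cinv c2) (at (snd c2 p)) (v c2)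
    = frechet_derivative (F \<circ> cinv c) (at (snd c p)) (v c)"
  using chart_change(2)[OF assms(2-6)] tangent_transition[OF assms(1) assms(4,2,5,3)] by (simp only:)

lemma differential_chart:
  assumes "v \<in> tangent_space M p" "c \<in> M" "p \<in> fst c"
    and "(a \<circ> cinv c) differentiable at (snd c p)"
  shows "differential M a p v = frechet_derivative (a \<circ> cinv c) (at (snd c p)) (v c)"
  using derivative_chart_indep[OF assms(1-3) chart_at assms(4)] assms in_points
  by (simp add: differential_def Let_def)

lemma tangent_map_chart:
  assumes "v \<in> tangent_space M p" "c \<in> M" "p \<in> fst c" "c' \<in> B" "F p \<in> fst c'"
    and "(snd c' \<circ> F \<circ> cinv c) differentiable at (snd c p)"
  shows "tangent_map M B F p v c' = frechet_derivative (snd c' \<circ> F \<circ> cinv c) (at (snd c p)) (v c)"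
  using derivative_chart_indep[OF assms(1-3) chart_at assms(6)] assms in_points
  by (simp add: tangent_map_def Let_def)

end

text \<open>Differentiability at a point, together with the part of continuity that makes the coordinate
  representations compose.\<close>

definition diff_map :: "('p, 'e::euclidean_space) chart set \<Rightarrow> ('q, 'f::euclidean_space) chart set
    \<Rightarrow> ('p \<Rightarrow> 'q) \<Rightarrow> 'p \<Rightarrow> bool"
  where "diff_map A B F p \<longleftrightarrow> p \<in> points A \<and> F p \<in> points B \<and>
    (\<forall>c\<in>A. \<forall>c'\<in>B. p \<in> fst c \<longrightarrow> F p \<in> fst c' \<longrightarrow>
      (snd c' \<circ> F \<circ> cinv c) differentiable at (snd c p) \<and>
      (\<exists>U. open U \<and> snd c p \<in> U \<and> U \<subseteq> snd c ` (fst c \<inter> F -` fst c')))"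

lemma smooth_map_coordinates:
  assumes A: "diff_atlas A" and B: "diff_atlas B" and F: "smooth_map A B F"
    and c: "c \<in> A" and c': "c' \<in> B"
  shows "open (snd c ` (fst c \<inter> F -` fst c'))"
    and "smooth_on (snd c ` (fst c \<inter> F -` fst c')) (snd c' \<circ> F \<circ> cinv c)"
proof -
  have "openin (mtop B) (fst c')"
    using diff_atlas.openin_iff[OF B] diff_atlas.overlap_open[OF B] c'
    by (auto simp: points_def Int_commute)
  then have "openin (mtop A) {x \<in> topspace (mtop A). F x \<in> fst c'}"
    using F openin_continuous_map_preimage unfolding smooth_map_def by blast
  then have "open (snd c ` ({x \<in> topspace (mtop A). F x \<in> fst c'} \<inter> fst c))"
    using diff_atlas.openin_iff[OF A] c by blast
  moreover have "{x \<in> topspace (mtop A). F x \<in> fst c'} \<inter> fst c = fst c \<inter> F -` fst c'"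
    using c by (auto simp: diff_atlas.topspace_mtop[OF A] points_def)
  ultimately show "open (snd c ` (fst c \<inter> F -` fst c'))" by simp
  show "smooth_on (snd c ` (fst c \<inter> F -` fst c')) (snd c' \<circ> F \<circ> cinv c)"
    using F c c' unfolding smooth_map_def by blast
qed

lemma smooth_map_imp_diff_map:
  assumes A: "diff_atlas A" and B: "diff_atlas B" and F: "smooth_map A B F" and p: "p \<in> points A"
  shows "diff_map A B F p"
proof -
  have "F p \<in> points B"
    using F p continuous_map_image_subset_topspace[of "mtop A" "mtop B" F]
    by (auto simp: smooth_map_def diff_atlas.topspace_mtop[OF A] diff_atlas.topspace_mtop[OF B])
  moreover have "(snd c' \<circ> F \<circ> cinv c) differentiable at (snd c p) \<and>
      (\<exists>U. open U \<and> snd c p \<in> U \<and> U \<subseteq> snd c ` (fst c \<inter> F -` fst c'))"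
    if "c \<in> A" "c' \<in> B" "p \<in> fst c" "F p \<in> fst c'" for c c'
  proof -
    have "snd c p \<in> snd c ` (fst c \<inter> F -` fst c')" using that by blast
    then show ?thesis
      using smooth_map_coordinates[OF A B F that(1,2)] smooth_on_differentiable by blast
  qed
  ultimately show ?thesis using p unfolding diff_map_def by blast
qed

lemma tangent_map_tangent:
  assumes A: "diff_atlas A" and B: "diff_atlas B" and F: "diff_map A B F p"
    and v: "v \<in> tangent_space A p"
  shows "tangent_map A B F p v \<in> tangent_space B (F p)"
proof -
  interpret A: diff_atlas A by fact
  interpret B: diff_atlas B by fact
  obtain c where c: "c \<in> A" "p \<in> fst c" using F by (auto simp: diff_map_def points_def)
  have rep: "tangent_map A B F p v c' = frechet_derivative (snd c' \<circ> F \<circ> cinv c) (at (snd c p)) (v c)"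
    if "c' \<in> B" "F p \<in> fst c'" for c'
    using F c that by (intro A.tangent_map_chart v) (auto simp: diff_map_def)
  have "tangent_map A B F p v c2 = frechet_derivative (snd c2 \<circ> cinv c1) (at (snd c1 (F p)))
      (tangent_map A B F p v c1)" if c1: "c1 \<in> B" "F p \<in> fst c1" and c2: "c2 \<in> B" "F p \<in> fst c2" for c1 c2
  proof -
    obtain U where U: "open U" "snd c p \<in> U" "U \<subseteq> snd c ` (fst c \<inter> F -` fst c1)"
      and d: "(snd c1 \<circ> F \<circ> cinv c) differentiable at (snd c p)"
      using F c c1 unfolding diff_map_def by blast
    have "((snd c2 \<circ> cinv c1) \<circ> (snd c1 \<circ> F \<circ> cinv c) has_derivative
        frechet_derivative (snd c2 \<circ> cinv c1) (at (snd c1 (F p))) \<circ>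
        frechet_derivative (snd c1 \<circ> F \<circ> cinv c) (at (snd c p))) (at (snd c p))"
      using d B.transition_differentiable[OF c1(1) c2(1) c1(2) c2(2)]
      unfolding frechet_derivative_works by (intro diff_chain_at) (simp_all add: A.cinv_chart c)
    then have "(snd c2 \<circ> F \<circ> cinv c has_derivative
        frechet_derivative (snd c2 \<circ> cinv c1) (at (snd c1 (F p))) \<circ>
        frechet_derivative (snd c1 \<circ> F \<circ> cinv c) (at (snd c p))) (at (snd c p))"
      by (rule has_derivative_transform_within_open[OF _ U(1,2)])
         (use U(3) c c1 in \<open>auto simp: A.cinv_chart B.cinv_chart\<close>)
    then show ?thesis unfolding rep[OF c1] rep[OF c2] by (simp add: frechet_derivative_at[symmetric])
  qed
  moreover have "tangent_map A B F p v c' = 0" if "c' \<notin> B \<or> F p \<notin> fst c'" for c'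
    using that by (auto simp: tangent_map_def)
  ultimately show ?thesis unfolding tangent_space_def by blast
qed

lemma diff_map_compose:
  assumes A: "diff_atlas A" and B: "diff_atlas B"
    and F: "diff_map A B F p" and H: "diff_map B C H (F p)"
  shows "diff_map A C (\<lambda>x. H (F x)) p"
  unfolding diff_map_def
proof (intro conjI ballI impI)
  interpret A: diff_atlas A by fact
  interpret B: diff_atlas B by fact
  show "p \<in> points A" "H (F p) \<in> points C" using F H by (auto simp: diff_map_def)
  fix c c' assume c: "c \<in> A" "p \<in> fst c" and c': "c' \<in> C" "H (F p) \<in> fst c'"
  obtain b where b: "b \<in> B" "F p \<in> fst b" using F by (auto simp: diff_map_def points_def)
  obtain U where U: "open U" "snd c p \<in> U" "U \<subseteq> snd c ` (fst c \<inter> F -` fst b)"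
    and dF: "(snd b \<circ> F \<circ> cinv c) differentiable at (snd c p)"
    using F c b unfolding diff_map_def by blast
  obtain V where V: "open V" "snd b (F p) \<in> V" "V \<subseteq> snd b ` (fst b \<inter> H -` fst c')"
    and dH: "(snd c' \<circ> H \<circ> cinv b) differentiable at (snd b (F p))"
    using H b c' unfolding diff_map_def by blast
  have Fp: "(snd b \<circ> F \<circ> cinv c) (snd c p) = snd b (F p)" by (simp add: A.cinv_chart c)
  have "((snd c' \<circ> H \<circ> cinv b) \<circ> (snd b \<circ> F \<circ> cinv c) has_derivative
      frechet_derivative (snd c' \<circ> H \<circ> cinv b) (at (snd b (F p))) \<circ>
      frechet_derivative (snd b \<circ> F \<circ> cinv c) (at (snd c p))) (at (snd c p))"
    using dF dH unfolding frechet_derivative_works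
    by (intro diff_chain_at) (simp_all add: A.cinv_chart c)
  then have "(snd c' \<circ> (\<lambda>x. H (F x)) \<circ> cinv c has_derivative
      frechet_derivative (snd c' \<circ> H \<circ> cinv b) (at (snd b (F p))) \<circ>
      frechet_derivative (snd b \<circ> F \<circ> cinv c) (at (snd c p))) (at (snd c p))"
    by (rule has_derivative_transform_within_open[OF _ U(1,2)])
       (use U(3) c b in \<open>auto simp: A.cinv_chart B.cinv_chart\<close>)
  then show "(snd c' \<circ> (\<lambda>x. H (F x)) \<circ> cinv c) differentiable at (snd c p)"
    unfolding differentiable_def by blast
  \<comment> \<open>Continuity at the point provides an open set of coordinates that \<open>F\<close> sends into the
    neighbourhood \<open>V\<close> on which \<open>H\<close> is represented.\<close>
  have "\<forall>\<^sub>F x in nhds (snd c p). (snd b \<circ> F \<circ> cinv c) x \<in> V"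
    using topological_tendstoD[OF isContD[OF differentiable_imp_continuous_within[OF dF]] V(1)]
      V(2) Fp unfolding eventually_at_filter by (auto elim: eventually_mono)
  then obtain W where W: "open W" "snd c p \<in> W" "\<And>x. x \<in> W \<Longrightarrow> (snd b \<circ> F \<circ> cinv c) x \<in> V"
    unfolding eventually_nhds by blast
  have "x \<in> snd c ` (fst c \<inter> (\<lambda>x. H (F x)) -` fst c')" if x: "x \<in> U \<inter> W" for x
  proof -
    obtain y where y: "x = snd c y" "y \<in> fst c" "F y \<in> fst b" using x U(3) by auto
    have "(snd b \<circ> F \<circ> cinv c) x \<in> snd b ` (fst b \<inter> H -` fst c')" using W(3) V(3) x by blast
    then obtain z where "snd b (F y) = snd b z" "z \<in> fst b" "H z \<in> fst c'"
      using y by (auto simp: A.cinv_chart c)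
    then have "H (F y) \<in> fst c'" using inj_onD[OF B.chart_inj[OF b(1)]] y(3) by metis
    then show ?thesis using y by blast
  qed
  then show "\<exists>U. open U \<and> snd c p \<in> U \<and> U \<subseteq> snd c ` (fst c \<inter> (\<lambda>x. H (F x)) -` fst c')"
    using U W by (intro exI[of _ "U \<inter> W"]) auto
qed

lemma linear_tangent_map:
  assumes A: "diff_atlas A" and F: "diff_map A B F p"
  shows "linear (tangent_map A B F p)"
proof -
  interpret A: diff_atlas A by fact
  let ?c = "chart_at A p"
  have c: "?c \<in> A" "p \<in> fst ?c" using A.chart_at F by (auto simp: diff_map_def)
  have lin: "linear (frechet_derivative (snd c' \<circ> F \<circ> cinv ?c) (at (snd ?c p)))"
    if "c' \<in> B" "F p \<in> fst c'" for c'
    using F c that by (auto simp: diff_map_def intro!: linear_frechet_derivative)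
  show ?thesis
    by (rule linearI; rule ext) (simp_all add: tangent_map_def scaleR_fun_def plus_fun_def Let_def
        linear_add[OF lin] linear_cmul[OF lin])
qed

lemma tangent_map_cong:
  assumes A: "diff_atlas A" and F: "diff_map A B F p" and e: "\<And>x. x \<in> points A \<Longrightarrow> F x = H x"
  shows "tangent_map A B F p = tangent_map A B H p"
proof (intro ext)
  fix v c'
  interpret A: diff_atlas A by fact
  let ?c = "chart_at A p"
  have p: "p \<in> points A" and c: "?c \<in> A" "p \<in> fst ?c" using A.chart_at F by (auto simp: diff_map_def)
  show "tangent_map A B F p v c' = tangent_map A B H p v c'"
  proof (cases "c' \<in> B \<and> F p \<in> fst c'")
    case True
    then have d: "(snd c' \<circ> F \<circ> cinv ?c) differentiable at (snd ?c p)"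
      using F c unfolding diff_map_def by blast
    have "frechet_derivative (snd c' \<circ> F \<circ> cinv ?c) (at (snd ?c p))
        = frechet_derivative (snd c' \<circ> H \<circ> cinv ?c) (at (snd ?c p))"
      by (rule frechet_derivative_transform_within_open[OF d A.chart_open[OF c(1)]])
         (use c e in \<open>auto simp: A.cinv_chart A.in_points\<close>)
    then show ?thesis using True e[OF p] by (simp add: tangent_map_def Let_def)
  next
    case False
    then show ?thesis using e[OF p] by (auto simp: tangent_map_def)
  qed
qed

lemma tangent_map_compose:
  assumes A: "diff_atlas A" and B: "diff_atlas B"
    and F: "diff_map A B F p" and H: "diff_map B C H (F p)" and v: "v \<in> tangent_space A p"
  shows "tangent_map A C (\<lambda>x. H (F x)) p v = tangent_map B C H (F p) (tangent_map A B F p v)"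
proof
  fix c'
  interpret A: diff_atlas A by fact
  interpret B: diff_atlas B by fact
  obtain c where c: "c \<in> A" "p \<in> fst c" using F by (auto simp: diff_map_def points_def)
  obtain b where b: "b \<in> B" "F p \<in> fst b" using F by (auto simp: diff_map_def points_def)
  show "tangent_map A C (\<lambda>x. H (F x)) p v c' = tangent_map B C H (F p) (tangent_map A B F p v) c'"
  proof (cases "c' \<in> C \<and> H (F p) \<in> fst c'")
    case True
    obtain U where U: "open U" "snd c p \<in> U" "U \<subseteq> snd c ` (fst c \<inter> F -` fst b)"
      and dF: "(snd b \<circ> F \<circ> cinv c) differentiable at (snd c p)"
      using F c b unfolding diff_map_def by blast
    have dH: "(snd c' \<circ> H \<circ> cinv b) differentiable at (snd b (F p))"
      using H b True unfolding diff_map_def by blast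
    have "((snd c' \<circ> H \<circ> cinv b) \<circ> (snd b \<circ> F \<circ> cinv c) has_derivative
        frechet_derivative (snd c' \<circ> H \<circ> cinv b) (at (snd b (F p))) \<circ>
        frechet_derivative (snd b \<circ> F \<circ> cinv c) (at (snd c p))) (at (snd c p))"
      using dF dH unfolding frechet_derivative_works
      by (intro diff_chain_at) (simp_all add: A.cinv_chart c)
    then have h: "(snd c' \<circ> (\<lambda>x. H (F x)) \<circ> cinv c has_derivative
        frechet_derivative (snd c' \<circ> H \<circ> cinv b) (at (snd b (F p))) \<circ>
        frechet_derivative (snd b \<circ> F \<circ> cinv c) (at (snd c p))) (at (snd c p))"
      by (rule has_derivative_transform_within_open[OF _ U(1,2)])
         (use U(3) c b in \<open>auto simp: A.cinv_chart B.cinv_chart\<close>)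
    have "tangent_map A C (\<lambda>x. H (F x)) p v c'
        = frechet_derivative (snd c' \<circ> (\<lambda>x. H (F x)) \<circ> cinv c) (at (snd c p)) (v c)"
      using True h by (intro A.tangent_map_chart v c) (auto simp: differentiable_def)
    also have "\<dots> = frechet_derivative (snd c' \<circ> H \<circ> cinv b) (at (snd b (F p)))
        (frechet_derivative (snd b \<circ> F \<circ> cinv c) (at (snd c p)) (v c))"
      by (simp add: frechet_derivative_at[OF h, symmetric])
    also have "\<dots> = frechet_derivative (snd c' \<circ> H \<circ> cinv b) (at (snd b (F p)))
        (tangent_map A B F p v b)"
      using A.tangent_map_chart[OF v c b dF] by simp
    also have "\<dots> = tangent_map B C H (F p) (tangent_map A B F p v) c'"
      using True by (intro B.tangent_map_chart[symmetric] tangent_map_tangent A B F v b dH) auto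
    finally show ?thesis .
  qed (auto simp: tangent_map_def)
qed

lemma tangent_map_ident:
  assumes A: "diff_atlas A" and p: "p \<in> points A" and v: "v \<in> tangent_space A p"
  shows "tangent_map A A (\<lambda>x. x) p v = v"
proof
  fix c'
  interpret A: diff_atlas A by fact
  note c = A.chart_at[OF p]
  show "tangent_map A A (\<lambda>x. x) p v c' = v c'"
  proof (cases "c' \<in> A \<and> p \<in> fst c'")
    case True
    then show ?thesis
      using A.tangent_transition[OF v c(1) _ c(2), of c'] by (simp add: tangent_map_def Let_def comp_def)
  next
    case False
    then have "v c' = 0" using v A.tangent_outside by blast
    then show ?thesis using False by (auto simp: tangent_map_def)
  qed
qed

lemma manifold_imp_diff_atlas: "manifold A \<Longrightarrow> diff_atlas A"
  unfolding manifold_def by unfold_locales (auto intro!: smooth_on_differentiable)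

section \<open>The cotangent bundle in coordinates\<close>

lemma differentiable_Pair:
  "f differentiable (at x) \<Longrightarrow> g differentiable (at x) \<Longrightarrow> (\<lambda>x. (f x, g x)) differentiable (at x)"
  unfolding differentiable_def by (elim exE, rule exI, rule has_derivative_Pair)

lemma differentiable_inner:
  fixes f g :: "'a::real_normed_vector \<Rightarrow> 'b::real_inner"
  shows "f differentiable (at x) \<Longrightarrow> g differentiable (at x) \<Longrightarrow> (\<lambda>x. f x \<bullet> g x) differentiable (at x)"
  unfolding differentiable_def by (elim exE, rule exI, rule has_derivative_inner)

text \<open>Coordinate changes of the cotangent bundle contain the derivatives of those of the base, so
  their differentiability requires second derivatives of the latter.\<close>

locale smooth_atlas = diff_atlas M for M :: "('p, 'e::euclidean_space) chart set" +
  assumes transition_smooth: "\<And>c c'. c \<in> M \<Longrightarrow> c' \<in> M \<Longrightarrow>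
    smooth_on (snd c ` (fst c \<inter> fst c')) (snd c' \<circ> cinv c)"
begin

text \<open>Position and momentum coordinates: \<open>covec\<close> is the inverse of \<open>covec_coords\<close> and, like every
  covector, vanishes on families that are not tangent vectors.\<close>

definition covec :: "('p, 'e) chart \<Rightarrow> 'p \<Rightarrow> 'e \<Rightarrow> ('p, 'e) tvec \<Rightarrow> real"
  where "covec c p \<xi> = (\<lambda>v. if v \<in> tangent_space M p then \<xi> \<bullet> v c else 0)"

definition covec_coords :: "('p, 'e) chart \<Rightarrow> 'p \<Rightarrow> (('p, 'e) tvec \<Rightarrow> real) \<Rightarrow> 'e"
  where "covec_coords c p l = (\<Sum>b\<in>Basis. l (coord_vec M c p b) *\<^sub>R b)"

lemma covec_cotangent: "covec c p \<xi> \<in> cotangent_space M p"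
  using subspace_add[OF subspace_tangent] subspace_scale[OF subspace_tangent]
  by (simp add: cotangent_space_def covec_def plus_fun_def scaleR_fun_def inner_add_right)

lemma covec_coords_covec: "c \<in> M \<Longrightarrow> p \<in> fst c \<Longrightarrow> covec_coords c p (covec c p \<xi>) = \<xi>"
  by (simp add: covec_coords_def covec_def coord_vec_tangent coord_vec_chart euclidean_representation)

text \<open>A covector is linear on tangent vectors only, and \<open>coord_vec\<close> transports it to a linear form on
  the model space.\<close>

lemma covector_in_coords:
  assumes l: "l \<in> cotangent_space M p" and c: "c \<in> M" "p \<in> fst c" and v: "v \<in> tangent_space M p"
  shows "l v = covec_coords c p l \<bullet> v c"
proof -
  note T = coord_vec_tangent[OF c]
  have "coord_vec M c p (x + y) = coord_vec M c p x + coord_vec M c p y" for x y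
    by (rule tangent_eqI[OF T subspace_add[OF subspace_tangent T T] c])
       (simp add: coord_vec_chart c plus_fun_def)
  moreover have "coord_vec M c p (r *\<^sub>R x) = r *\<^sub>R coord_vec M c p x" for r x
    by (rule tangent_eqI[OF T subspace_scale[OF subspace_tangent T] c])
       (simp add: coord_vec_chart c scaleR_fun_def)
  ultimately have "linear (\<lambda>x. l (coord_vec M c p x))"
    using l T by (intro linearI) (simp_all add: cotangent_space_def)
  from linear_expand_Basis[OF this, of "v c"]
  show ?thesis
    by (simp add: coord_vec_of_tangent[OF v c] covec_coords_def inner_sum_left inner_sum_right inner_commute mult.commute)
qed

lemma covec_covec_coords:
  assumes "l \<in> cotangent_space M p" "c \<in> M" "p \<in> fst c"
  shows "covec c p (covec_coords c p l) = l"
  using assms covector_in_coords[OF assms] by (auto simp: covec_def cotangent_space_def fun_eq_iff)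

lemma fst_cot_chart: "fst (cot_chart M c) = Sigma (fst c) (cotangent_space M)"
  by (simp add: cot_chart_def)

lemma snd_cot_chart: "snd (cot_chart M c) (p, l) = (snd c p, covec_coords c p l)"
  by (simp add: cot_chart_def covec_coords_def)

lemma cot_chart_image:
  assumes "c \<in> M" "S \<subseteq> fst c"
  shows "snd (cot_chart M c) ` Sigma S (cotangent_space M) = snd c ` S \<times> UNIV"
proof
  show "snd c ` S \<times> UNIV \<subseteq> snd (cot_chart M c) ` Sigma S (cotangent_space M)"
  proof clarify
    fix p \<xi> assume "p \<in> S"
    then have "(snd c p, \<xi>) = snd (cot_chart M c) (p, covec c p \<xi>)"
      using assms by (auto simp: snd_cot_chart covec_coords_covec subset_eq)
    then show "(snd c p, \<xi>) \<in> snd (cot_chart M c) ` Sigma S (cotangent_space M)"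
      using \<open>p \<in> S\<close> covec_cotangent by (metis SigmaI imageI)
  qed
qed (auto simp: snd_cot_chart)

lemma cot_chart_inj:
  assumes "c \<in> M" shows "inj_on (snd (cot_chart M c)) (fst (cot_chart M c))"
proof (rule inj_onI)
  fix x y assume x: "x \<in> fst (cot_chart M c)" and y: "y \<in> fst (cot_chart M c)"
    and e: "snd (cot_chart M c) x = snd (cot_chart M c) y"
  obtain p l q m where xy: "x = (p, l)" "y = (q, m)" by (metis surj_pair)
  have *: "p \<in> fst c" "q \<in> fst c" "l \<in> cotangent_space M p" "m \<in> cotangent_space M q"
    using x y by (auto simp: xy fst_cot_chart)
  have "snd c p = snd c q" using e by (simp add: xy snd_cot_chart)
  then have "p = q" using chart_inj[OF assms] * by (simp add: inj_on_def)
  moreover have "covec_coords c p l = covec_coords c q m" using e by (simp add: xy snd_cot_chart)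
  ultimately show "x = y" using covec_covec_coords[OF _ assms] * xy by metis
qed

lemma cinv_cot_chart:
  assumes "c \<in> M" "x \<in> snd c ` fst c"
  shows "cinv (cot_chart M c) (x, \<xi>) = (cinv c x, covec c (cinv c x) \<xi>)"
proof -
  have "(cinv c x, covec c (cinv c x) \<xi>) \<in> fst (cot_chart M c)"
    using chart_cinv[OF assms(2)] by (simp add: fst_cot_chart covec_cotangent)
  moreover have "snd (cot_chart M c) (cinv c x, covec c (cinv c x) \<xi>) = (x, \<xi>)"
    using chart_cinv[OF assms(2)] by (simp add: snd_cot_chart covec_coords_covec assms(1))
  ultimately show ?thesis
    unfolding cinv_def[of "cot_chart M c"] using inv_into_f_f[OF cot_chart_inj[OF assms(1)]] by metis
qed

text \<open>Momentum coordinates change by the transpose of the derivative of the inverse change of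
  position coordinates.\<close>

lemma cot_transition:
  assumes c: "c \<in> M" and c': "c' \<in> M" and x: "x \<in> snd c ` (fst c \<inter> fst c')"
  shows "(snd (cot_chart M c') \<circ> cinv (cot_chart M c)) (x, \<xi>) = ((snd c' \<circ> cinv c) x,
    \<Sum>b\<in>Basis. (\<xi> \<bullet> frechet_derivative (snd c \<circ> cinv c') (at ((snd c' \<circ> cinv c) x)) b) *\<^sub>R b)"
proof -
  have p: "x \<in> snd c ` fst c" "cinv c x \<in> fst c" "cinv c x \<in> fst c'"
    using x c by (auto simp: cinv_chart)
  show ?thesis
    by (simp add: cinv_cot_chart c p snd_cot_chart covec_coords_def covec_def coord_vec_tangent[OF c' p(3)])
       (simp add: coord_vec_def c p)
qed

lemma cot_overlap:
  "fst (cot_chart M c) \<inter> fst (cot_chart M c') = Sigma (fst c \<inter> fst c') (cotangent_space M)"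
  by (auto simp: fst_cot_chart)

lemma cot_diff_atlas: "diff_atlas (cot_atlas M)"
proof
  fix C assume "C \<in> cot_atlas M"
  then obtain c where c: "c \<in> M" "C = cot_chart M c" by (auto simp: cot_atlas_def)
  show "inj_on (snd C) (fst C)" using cot_chart_inj c by simp
  show "open (snd C ` fst C)"
    using cot_chart_image[OF c(1), of "fst c"] chart_open[OF c(1)]
    by (simp add: c(2) fst_cot_chart open_Times)
  fix C' assume "C' \<in> cot_atlas M"
  then obtain c' where c': "c' \<in> M" "C' = cot_chart M c'" by (auto simp: cot_atlas_def)
  have img: "snd C ` (fst C \<inter> fst C') = snd c ` (fst c \<inter> fst c') \<times> UNIV"
    unfolding c(2) c'(2) cot_overlap by (rule cot_chart_image[OF c(1)]) simp
  show op: "open (snd C ` (fst C \<inter> fst C'))"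
    unfolding img by (intro open_Times overlap_open c c') simp
  fix z assume z: "z \<in> fst C" "z \<in> fst C'"
  then have "snd C z \<in> snd c ` (fst c \<inter> fst c') \<times> UNIV" using img by blast
  then obtain p \<xi> where p: "snd C z = (snd c p, \<xi>)" "p \<in> fst c" "p \<in> fst c'" by auto
  let ?\<phi> = "snd c' \<circ> cinv c"
  let ?\<psi> = "\<lambda>b y. frechet_derivative (snd c \<circ> cinv c') (at y) b"
  have d\<phi>: "?\<phi> differentiable (at (fst (snd c p, \<xi>)))"
    using transition_differentiable[OF c(1) c'(1) p(2,3)] by simp
  have d\<psi>: "?\<psi> b differentiable (at ((?\<phi> \<circ> fst) (snd c p, \<xi>)))" for b
  proof -
    have "(?\<phi> \<circ> fst) (snd c p, \<xi>) \<in> snd c' ` (fst c' \<inter> fst c)"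
      using p by (auto simp: cinv_chart[OF c(1)])
    then show ?thesis
      by (rule smooth_on_differentiable[OF smooth_on_derivative[OF transition_smooth[OF c'(1) c(1)]]])
  qed
  have dfst: "fst differentiable (at (snd c p, \<xi>))" and dsnd: "snd differentiable (at (snd c p, \<xi>))"
    by (simp_all add: bounded_linear_imp_differentiable bounded_linear_fst bounded_linear_snd)
  have d\<phi>': "(?\<phi> \<circ> fst) differentiable (at (snd c p, \<xi>))"
    by (rule differentiable_chain_at[OF dfst d\<phi>])
  have "(\<lambda>w. ((?\<phi> \<circ> fst) w, \<Sum>b\<in>Basis. (snd w \<bullet> (?\<psi> b \<circ> (?\<phi> \<circ> fst)) w) *\<^sub>R b)) differentiable (at (snd c p, \<xi>))"
    by (intro differentiable_Pair d\<phi>' differentiable_sum ballI differentiable_scaleR differentiable_inner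
        dsnd differentiable_const differentiable_chain_at[OF d\<phi>' d\<psi>]) simp
  then obtain D where D: "((\<lambda>w. ((?\<phi> \<circ> fst) w, \<Sum>b\<in>Basis. (snd w \<bullet> (?\<psi> b \<circ> (?\<phi> \<circ> fst)) w) *\<^sub>R b))
      has_derivative D) (at (snd C z))"
    unfolding differentiable_def p(1) by blast
  have "(snd C' \<circ> cinv C has_derivative D) (at (snd C z))"
  proof (rule has_derivative_transform_within_open[OF D op])
    show "snd C z \<in> snd C ` (fst C \<inter> fst C')" using z by blast
    fix w assume "w \<in> snd C ` (fst C \<inter> fst C')"
    then have "fst w \<in> snd c ` (fst c \<inter> fst c')" unfolding img by auto
    from cot_transition[OF c(1) c'(1) this, of "snd w"]
    show "((?\<phi> \<circ> fst) w, \<Sum>b\<in>Basis. (snd w \<bullet> (?\<psi> b \<circ> (?\<phi> \<circ> fst)) w) *\<^sub>R b) = (snd C' \<circ> cinv C) w"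
      by (simp add: c(2) c'(2))
  qed
  then show "(snd C' \<circ> cinv C) differentiable (at (snd C z))" unfolding differentiable_def by blast
qed

lemma points_cot_atlas: "(p, l) \<in> points (cot_atlas M) \<longleftrightarrow> p \<in> points M \<and> l \<in> cotangent_space M p"
  by (auto simp: points_def cot_atlas_def fst_cot_chart)

lemma chart_at_cot_atlas:
  assumes "(p, l) \<in> points (cot_atlas M)"
  obtains c where "c \<in> M" "p \<in> fst c" "l \<in> cotangent_space M p"
    "chart_at (cot_atlas M) (p, l) = cot_chart M c" "cot_chart M c \<in> cot_atlas M"
    "(p, l) \<in> fst (cot_chart M c)"
  using diff_atlas.chart_at[OF cot_diff_atlas assms] that by (auto simp: cot_atlas_def fst_cot_chart)

section \<open>The canonical symplectic form and the Poisson bracket\<close>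

text \<open>The form \<open>\<xi> dx\<close>, because the projection to the base is \<open>(x, \<xi>) \<mapsto> x\<close> in coordinates.\<close>

lemma tautological_form_coords:
  assumes c: "c \<in> M" and x: "x \<in> snd c ` fst c"
  shows "tautological_form M (cinv (cot_chart M c) (x, \<xi>))
    (coord_vec (cot_atlas M) (cot_chart M c) (cinv (cot_chart M c) (x, \<xi>)) w) = \<xi> \<bullet> fst w"
proof -
  interpret cot: diff_atlas "cot_atlas M" by (rule cot_diff_atlas)
  let ?C = "cot_chart M c" let ?p = "cinv c x" let ?z = "(?p, covec c ?p \<xi>)"
  have C: "?C \<in> cot_atlas M" using c by (simp add: cot_atlas_def)
  have p: "?p \<in> fst c" "snd c ?p = x" using chart_cinv[OF x] by auto
  have z: "?z \<in> fst ?C" "snd ?C ?z = (x, \<xi>)"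
    using p c by (auto simp: fst_cot_chart covec_cotangent snd_cot_chart covec_coords_covec)
  let ?v = "coord_vec (cot_atlas M) ?C ?z w"
  have v: "?v \<in> tangent_space (cot_atlas M) ?z" "?v ?C = w"
    using cot.coord_vec_tangent[OF C z(1)] cot.coord_vec_chart[OF C z(1)] by auto
  have "tangent_map (cot_atlas M) M fst ?z ?v = coord_vec M c ?p (fst w)"
  proof
    fix c'
    show "tangent_map (cot_atlas M) M fst ?z ?v c' = coord_vec M c ?p (fst w) c'"
    proof (cases "c' \<in> M \<and> ?p \<in> fst c'")
      case True
      have "((snd c' \<circ> cinv c) \<circ> fst has_derivative
          frechet_derivative (snd c' \<circ> cinv c) (at (snd c ?p)) \<circ> fst) (at (x, \<xi>))"
        using transition_differentiable[OF c _ p(1), of c'] True p(2)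
        unfolding frechet_derivative_works
        by (intro diff_chain_at) (auto intro: bounded_linear_imp_has_derivative bounded_linear_fst)
      then have h: "(snd c' \<circ> fst \<circ> cinv ?C has_derivative
          frechet_derivative (snd c' \<circ> cinv c) (at (snd c ?p)) \<circ> fst) (at (snd ?C ?z))"
        unfolding z(2)
        by (rule has_derivative_transform_within_open[where s = "snd c ` fst c \<times> UNIV"])
           (use x in \<open>auto simp: cinv_cot_chart[OF c] intro!: open_Times chart_open c\<close>)
      have "tangent_map (cot_atlas M) M fst ?z ?v c'
          = frechet_derivative (snd c' \<circ> fst \<circ> cinv ?C) (at (snd ?C ?z)) (?v ?C)"
        using True h by (intro cot.tangent_map_chart v C z) (auto simp: differentiable_def)
      also have "\<dots> = frechet_derivative (snd c' \<circ> cinv c) (at (snd c ?p)) (fst w)"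
        by (simp add: frechet_derivative_at[OF h, symmetric] v(2))
      also have "\<dots> = coord_vec M c ?p (fst w) c'"
        using True by (simp add: coord_vec_def)
      finally show ?thesis .
    next
      case False
      then show ?thesis by (auto simp: tangent_map_def coord_vec_def)
    qed
  qed
  then show ?thesis
    by (simp add: cinv_cot_chart[OF c x] tautological_form_def covec_def coord_vec_tangent[OF c p(1)]
        coord_vec_chart[OF c p(1)])
qed

text \<open>The form \<open>d\<xi> \<and> dx\<close>.\<close>

lemma symplectic_form_coords:
  assumes c: "c \<in> M" "p \<in> fst c" and l: "l \<in> cotangent_space M p"
    and C: "chart_at (cot_atlas M) (p, l) = cot_chart M c"
  shows "symplectic_form M (p, l) v w = snd (v (cot_chart M c)) \<bullet> fst (w (cot_chart M c))
    - snd (w (cot_chart M c)) \<bullet> fst (v (cot_chart M c))"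
proof -
  let ?C = "cot_chart M c"
  have "frechet_derivative (\<lambda>x. tautological_form M (cinv ?C x)
      (coord_vec (cot_atlas M) ?C (cinv ?C x) u)) (at (snd ?C (p, l))) u' = snd u' \<bullet> fst u" for u u'
  proof -
    have "((\<lambda>x. snd x \<bullet> fst u) has_derivative (\<lambda>x. snd x \<bullet> fst u)) (at (snd ?C (p, l)))"
      by (intro bounded_linear_imp_has_derivative bounded_linear_compose[OF bounded_linear_inner_left bounded_linear_snd])
    then have "((\<lambda>x. tautological_form M (cinv ?C x) (coord_vec (cot_atlas M) ?C (cinv ?C x) u))
        has_derivative (\<lambda>x. snd x \<bullet> fst u)) (at (snd ?C (p, l)))"
      by (rule has_derivative_transform_within_open[where s = "snd c ` fst c \<times> UNIV"])
         (use c in \<open>auto simp: tautological_form_coords snd_cot_chart intro!: open_Times chart_open\<close>)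
    then show ?thesis by (simp add: frechet_derivative_at[symmetric])
  qed
  then show ?thesis by (simp add: symplectic_form_def ext_deriv_def C Let_def)
qed

text \<open>In canonical coordinates the Hamiltonian field of \<open>a\<close> is \<open>(\<partial>a/\<partial>\<xi>, - \<partial>a/\<partial>x)\<close>; the directions
  \<open>(b, 0)\<close> and \<open>(0, b)\<close> are those of the position and of the momentum coordinates.\<close>

lemma poisson_coords:
  assumes "(p, l) \<in> points (cot_atlas M)"
  obtains c where "c \<in> M" "p \<in> fst c"
    "\<And>a b. (a \<circ> cinv (cot_chart M c)) differentiable (at (snd (cot_chart M c) (p, l))) \<Longrightarrow>
      (b \<circ> cinv (cot_chart M c)) differentiable (at (snd (cot_chart M c) (p, l))) \<Longrightarrow>
      poisson (cot_atlas M) (symplectic_form M) a b (p, l) =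
        (\<Sum>i\<in>Basis. frechet_derivative (a \<circ> cinv (cot_chart M c)) (at (snd (cot_chart M c) (p, l))) (0, i)
          * frechet_derivative (b \<circ> cinv (cot_chart M c)) (at (snd (cot_chart M c) (p, l))) (i, 0))
      - (\<Sum>i\<in>Basis. frechet_derivative (a \<circ> cinv (cot_chart M c)) (at (snd (cot_chart M c) (p, l))) (i, 0)
          * frechet_derivative (b \<circ> cinv (cot_chart M c)) (at (snd (cot_chart M c) (p, l))) (0, i))"
proof -
  interpret cot: diff_atlas "cot_atlas M" by (rule cot_diff_atlas)
  obtain c where c: "c \<in> M" "p \<in> fst c" "l \<in> cotangent_space M p"
    and Cat: "chart_at (cot_atlas M) (p, l) = cot_chart M c"
    and C: "cot_chart M c \<in> cot_atlas M" "(p, l) \<in> fst (cot_chart M c)"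
    using chart_at_cot_atlas[OF assms] .
  let ?C = "cot_chart M c" let ?z = "snd (cot_chart M c) (p, l)"
  let ?T = "tangent_space (cot_atlas M) (p, l)"
  have split: "L w = (\<Sum>i\<in>Basis. (fst w \<bullet> i) * L (i, 0)) + (\<Sum>i\<in>Basis. (snd w \<bullet> i) * L (0, i))"
    if L: "linear L" for L :: "'e \<times> 'e \<Rightarrow> real" and w
  proof -
    have l1: "linear (\<lambda>x. L (x, 0))" and l2: "linear (\<lambda>x. L (0, x))"
      using linear_add[OF L, of "(_, 0)" "(_, 0)"] linear_cmul[OF L, of _ "(_, 0)"]
        linear_add[OF L, of "(0, _)" "(0, _)"] linear_cmul[OF L, of _ "(0, _)"]
      by (auto intro!: linearI)
    have "L w = L (fst w, 0) + L (0, snd w)" using linear_add[OF L, of "(fst w, 0)" "(0, snd w)"] by simp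
    then show ?thesis using linear_expand_Basis[OF l1, of "fst w"] linear_expand_Basis[OF l2, of "snd w"] by simp
  qed
  show thesis
  proof (rule that[OF c(1,2)])
    fix a b :: "'p \<times> (('p, 'e) tvec \<Rightarrow> real) \<Rightarrow> real"
    assume a: "(a \<circ> cinv ?C) differentiable (at ?z)" and b: "(b \<circ> cinv ?C) differentiable (at ?z)"
    let ?Da = "frechet_derivative (a \<circ> cinv ?C) (at ?z)"
    let ?Db = "frechet_derivative (b \<circ> cinv ?C) (at ?z)"
    note la = linear_frechet_derivative[OF a] and lb = linear_frechet_derivative[OF b]
    define V where "V = (\<Sum>i\<in>Basis. ?Da (0, i) *\<^sub>R i, - (\<Sum>i\<in>Basis. ?Da (i, 0) *\<^sub>R i))"
    have V: "fst V \<bullet> i = ?Da (0, i)" "snd V \<bullet> i = - ?Da (i, 0)" if "i \<in> Basis" for i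
      using that by (simp_all add: V_def inner_sum_left_Basis)
    have ham: "hamiltonian_vf (cot_atlas M) (symplectic_form M) a (p, l) = coord_vec (cot_atlas M) ?C (p, l) V"
      unfolding hamiltonian_vf_def
    proof (rule the_equality)
      have "snd (w ?C) \<bullet> fst V - snd V \<bullet> fst (w ?C) = ?Da (w ?C)" for w
      proof -
        have "snd (w ?C) \<bullet> fst V = (\<Sum>i\<in>Basis. (snd (w ?C) \<bullet> i) * ?Da (0, i))"
          by (subst euclidean_inner) (simp add: V)
        moreover have "snd V \<bullet> fst (w ?C) = - (\<Sum>i\<in>Basis. (fst (w ?C) \<bullet> i) * ?Da (i, 0))"
          by (subst euclidean_inner) (simp add: V sum_negf[symmetric] mult.commute)
        ultimately show ?thesis using split[OF la, of "w ?C"] by simp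
      qed
      then show "coord_vec (cot_atlas M) ?C (p, l) V \<in> ?T \<and> (\<forall>w\<in>?T. symplectic_form M (p, l) w
          (coord_vec (cot_atlas M) ?C (p, l) V) = differential (cot_atlas M) a (p, l) w)"
        using cot.coord_vec_tangent[OF C] cot.coord_vec_chart[OF C] cot.differential_chart[OF _ C a]
        by (simp add: symplectic_form_coords[OF c Cat])
    next
      fix v assume v: "v \<in> ?T \<and> (\<forall>w\<in>?T. symplectic_form M (p, l) w v = differential (cot_atlas M) a (p, l) w)"
      have t: "snd u \<bullet> fst (v ?C) - snd (v ?C) \<bullet> fst u = ?Da u" for u
      proof -
        let ?u = "coord_vec (cot_atlas M) ?C (p, l) u"
        have "symplectic_form M (p, l) ?u v = differential (cot_atlas M) a (p, l) ?u"
          using v cot.coord_vec_tangent[OF C] by blast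
        then show ?thesis
          using cot.differential_chart[OF cot.coord_vec_tangent[OF C] C a, of u]
          by (simp add: symplectic_form_coords[OF c Cat] cot.coord_vec_chart[OF C])
      qed
      have "fst (v ?C) = fst V"
      proof (rule euclidean_eqI)
        fix i :: 'e assume "i \<in> Basis"
        then show "fst (v ?C) \<bullet> i = fst V \<bullet> i" using t[of "(0, i)"] by (simp add: V inner_commute[of i])
      qed
      moreover have "snd (v ?C) = snd V"
      proof (rule euclidean_eqI)
        fix i :: 'e assume "i \<in> Basis"
        then show "snd (v ?C) \<bullet> i = snd V \<bullet> i" using t[of "(i, 0)"] by (simp add: V)
      qed
      ultimately have "v ?C = coord_vec (cot_atlas M) ?C (p, l) V ?C"
        by (simp add: cot.coord_vec_chart[OF C] prod_eq_iff)
      then show "v = coord_vec (cot_atlas M) ?C (p, l) V"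
        using cot.tangent_eqI[OF _ cot.coord_vec_tangent[OF C] C] v by blast
    qed
    have "poisson (cot_atlas M) (symplectic_form M) a b (p, l) = ?Db V"
      using cot.differential_chart[OF cot.coord_vec_tangent[OF C] C b]
      by (simp add: poisson_def ham cot.coord_vec_chart[OF C])
    also have "\<dots> = (\<Sum>i\<in>Basis. ?Da (0, i) * ?Db (i, 0)) - (\<Sum>i\<in>Basis. ?Da (i, 0) * ?Db (0, i))"
      by (simp add: split[OF lb, of V] V sum_negf)
    finally show "poisson (cot_atlas M) (symplectic_form M) a b (p, l)
      = (\<Sum>i\<in>Basis. ?Da (0, i) * ?Db (i, 0)) - (\<Sum>i\<in>Basis. ?Da (i, 0) * ?Db (0, i))" .
  qed
qed


lemma smooth_fun_differentiable:
  assumes "smooth_fun (cot_atlas M) a" "c \<in> M" "p \<in> fst c"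
  shows "(a \<circ> cinv (cot_chart M c)) differentiable (at (snd (cot_chart M c) (p, l)))"
proof -
  have "snd (cot_chart M c) (p, l) \<in> snd (cot_chart M c) ` fst (cot_chart M c)"
    using cot_chart_image[OF assms(2) order_refl] assms(3) by (simp add: fst_cot_chart snd_cot_chart)
  moreover have "smooth_on (snd (cot_chart M c) ` fst (cot_chart M c)) (a \<circ> cinv (cot_chart M c))"
    using assms(1,2) by (simp add: smooth_fun_def cot_atlas_def)
  ultimately show ?thesis using smooth_on_differentiable by blast
qed

lemma poisson_antisym:
  assumes "z \<in> points (cot_atlas M)" "smooth_fun (cot_atlas M) a" "smooth_fun (cot_atlas M) b"
  shows "poisson (cot_atlas M) (symplectic_form M) a b z
    = - poisson (cot_atlas M) (symplectic_form M) b a z"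
proof -
  obtain p l where z: "z = (p, l)" by (cases z)
  show ?thesis
    by (rule poisson_coords[OF assms(1)[unfolded z]])
       (simp add: z smooth_fun_differentiable[OF assms(2)] smooth_fun_differentiable[OF assms(3)] mult.commute)
qed

text \<open>The Leibniz rule for the bracket, in the form needed for the sub-Riemannian Hamiltonian.\<close>

lemma poisson_half_squares:
  assumes "z \<in> points (cot_atlas M)" and u: "smooth_fun (cot_atlas M) u"
    and w: "smooth_fun (cot_atlas M) w" and b: "smooth_fun (cot_atlas M) b"
  shows "poisson (cot_atlas M) (symplectic_form M) (\<lambda>x. ((u x)\<^sup>2 + (w x)\<^sup>2) / 2) b z
    = u z * poisson (cot_atlas M) (symplectic_form M) u b z
      + w z * poisson (cot_atlas M) (symplectic_form M) w b z"
proof -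
  obtain p l where z: "z = (p, l)" by (cases z)
  show ?thesis
    unfolding z
  proof (rule poisson_coords[OF assms(1)[unfolded z]], goal_cases)
    case (1 c)
    let ?C = "cot_chart M c" let ?z = "snd ?C (p, l)"
    let ?a = "\<lambda>x. ((u x)\<^sup>2 + (w x)\<^sup>2) / 2"
    have l: "l \<in> cotangent_space M p" using assms(1) by (simp add: z points_cot_atlas)
    have inv: "cinv ?C ?z = (p, l)"
      using 1(1,2) l by (simp add: snd_cot_chart cinv_cot_chart cinv_chart covec_covec_coords)
    note du = smooth_fun_differentiable[OF u 1(1,2), of l]
      and dw = smooth_fun_differentiable[OF w 1(1,2), of l]
      and db = smooth_fun_differentiable[OF b 1(1,2), of l]
    have h: "(?a \<circ> cinv ?C has_derivative (\<lambda>v. u (p, l) * frechet_derivative (u \<circ> cinv ?C) (at ?z) v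
        + w (p, l) * frechet_derivative (w \<circ> cinv ?C) (at ?z) v)) (at ?z)"
      using du dw unfolding frechet_derivative_works comp_def
      by (auto intro!: derivative_eq_intros simp: inv[unfolded snd_cot_chart] snd_cot_chart)
    then have da: "(?a \<circ> cinv ?C) differentiable (at ?z)" unfolding differentiable_def by blast
    show ?case
      unfolding 1(3)[OF da db] 1(3)[OF du db] 1(3)[OF dw db] frechet_derivative_at[OF h, symmetric]
      by (simp add: sum_distrib_left distrib_right sum.distrib right_diff_distrib mult.assoc)
  qed
qed

lemma momentum_coords:
  assumes "c \<in> M" "x \<in> snd c ` fst c" "X (cinv c x) \<in> tangent_space M (cinv c x)"
  shows "momentum X (cinv (cot_chart M c) (x, \<xi>)) = \<xi> \<bullet> X (cinv c x) c"
  using assms by (simp add: momentum_def cinv_cot_chart covec_def)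

lemma smooth_vf_points:
  assumes "smooth_vf_on M (points M) X" "c \<in> M"
  shows "smooth_on (snd c ` fst c) (\<lambda>x. X (cinv c x) c)"
proof -
  have "fst c \<inter> points M = fst c" using assms(2) by (auto simp: points_def)
  then show ?thesis using assms unfolding smooth_vf_on_def by metis
qed

lemma momentum_coords_eq:
  assumes X: "smooth_vf_on M (points M) X" and "c \<in> M" "z \<in> snd c ` fst c \<times> UNIV"
  shows "snd z \<bullet> X (cinv c (fst z)) c = (momentum X \<circ> cinv (cot_chart M c)) z"
proof -
  have x: "fst z \<in> snd c ` fst c" using assms(3) by auto
  then have "cinv c (fst z) \<in> points M"
    by (intro in_points[OF assms(2)] chart_cinv(2))
  then have "X (cinv c (fst z)) \<in> tangent_space M (cinv c (fst z))" using X by (simp add: smooth_vf_on_def)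
  with momentum_coords[of c "fst z" X "snd z", OF assms(2) x] show ?thesis by simp
qed

lemma smooth_fun_momentum:
  assumes X: "smooth_vf_on M (points M) X"
  shows "smooth_fun (cot_atlas M) (momentum X)"
  unfolding smooth_fun_def
proof
  fix C assume "C \<in> cot_atlas M"
  then obtain c where c: "c \<in> M" "C = cot_chart M c" by (auto simp: cot_atlas_def)
  have img: "snd C ` fst C = snd c ` fst c \<times> UNIV"
    unfolding c(2) fst_cot_chart by (rule cot_chart_image[OF c(1) order_refl])
  have op: "open (snd c ` fst c \<times> (UNIV :: 'e set))" by (intro open_Times chart_open c) simp
  have "smooth_on (snd c ` fst c \<times> UNIV) (\<lambda>z. snd z \<bullet> ((\<lambda>x. X (cinv c x) c) \<circ> fst) z)"
    by (intro smooth_on_bounded_bilinear[OF bounded_bilinear_inner op]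
        smooth_on_compose[OF op chart_open[OF c(1)] _ smooth_vf_points[OF X c(1)]]
        smooth_on_bounded_linear bounded_linear_fst bounded_linear_snd) auto
  moreover have "smooth_on (snd c ` fst c \<times> UNIV) (\<lambda>z. snd z \<bullet> X (cinv c (fst z)) c)
      \<longleftrightarrow> smooth_on (snd c ` fst c \<times> UNIV) (momentum X \<circ> cinv (cot_chart M c))"
    by (rule smooth_on_cong[OF op momentum_coords_eq[OF X c(1)]])
  ultimately show "smooth_on (snd C ` fst C) (momentum X \<circ> cinv C)"
    unfolding img unfolding c(2) by (simp only: comp_apply)
qed

lemma momentum_derivative:
  assumes X: "smooth_vf_on M (points M) X" and c: "c \<in> M" "p \<in> fst c"
  shows "frechet_derivative (momentum X \<circ> cinv (cot_chart M c)) (at (snd (cot_chart M c) (p, l))) w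
    = snd w \<bullet> X p c
      + covec_coords c p l \<bullet> frechet_derivative (\<lambda>x. X (cinv c x) c) (at (snd c p)) (fst w)"
proof -
  let ?X = "\<lambda>x. X (cinv c x) c" let ?z = "(snd c p, covec_coords c p l)"
  have "(?X has_derivative frechet_derivative ?X (at (snd c p))) (at (fst ?z))"
    using smooth_on_differentiable[OF smooth_vf_points[OF X c(1)]] c(2)
    by (simp add: frechet_derivative_works[symmetric])
  from diff_chain_at[OF bounded_linear_imp_has_derivative[OF bounded_linear_fst] this]
  have "(?X \<circ> fst has_derivative frechet_derivative ?X (at (snd c p)) \<circ> fst) (at ?z)" .
  from has_derivative_inner[OF bounded_linear_imp_has_derivative[OF bounded_linear_snd] this]
  have "((\<lambda>z. snd z \<bullet> ?X (fst z)) has_derivative (\<lambda>w. covec_coords c p l \<bullet>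
      frechet_derivative ?X (at (snd c p)) (fst w) + snd w \<bullet> X p c)) (at ?z)"
    by (simp add: cinv_chart c)
  then have "(momentum X \<circ> cinv (cot_chart M c) has_derivative (\<lambda>w. covec_coords c p l \<bullet>
      frechet_derivative ?X (at (snd c p)) (fst w) + snd w \<bullet> X p c)) (at ?z)"
    by (rule has_derivative_transform_within_open[where s = "snd c ` fst c \<times> UNIV"])
       (use c in \<open>auto intro!: open_Times chart_open momentum_coords_eq[OF X, of _ "(_, _)", simplified]\<close>)
  then show ?thesis by (simp add: frechet_derivative_at[symmetric] snd_cot_chart)
qed

text \<open>\<open>{h\<^sub>X, h\<^sub>Y} = h\<^bsub>[X,Y]\<^esub>\<close>: in coordinates \<open>h\<^sub>X = \<xi> \<bullet> X(x)\<close>, so that the bracket becomes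
  \<open>\<xi> \<bullet> (DY X - DX Y)\<close>.\<close>

lemma poisson_momentum:
  assumes X: "smooth_vf_on M (points M) X" and Y: "smooth_vf_on M (points M) Y"
    and z: "(p, l) \<in> points (cot_atlas M)"
    and Z: "lie_bracket M X Y p = Z" "Z \<in> tangent_space M p"
  shows "poisson (cot_atlas M) (symplectic_form M) (momentum X) (momentum Y) (p, l) = l Z"
proof (rule poisson_coords[OF z], goal_cases)
  case (1 c)
  let ?D = "\<lambda>X. frechet_derivative (\<lambda>x. X (cinv c x) c) (at (snd c p))"
  let ?\<xi> = "covec_coords c p l"
  have lin: "linear (?D X)" if "smooth_vf_on M (points M) X" for X
    using smooth_on_differentiable[OF smooth_vf_points[OF that 1(1)]] 1(2)
    by (intro linear_frechet_derivative) simp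
  have contract: "(\<Sum>i\<in>Basis. (i \<bullet> u) * (?\<xi> \<bullet> ?D W i)) = ?\<xi> \<bullet> ?D W u"
    if "smooth_vf_on M (points M) W" for W u
    by (subst (2) linear_expand_Basis[OF lin[OF that]]) (simp add: inner_sum_right inner_commute)
  have l: "l \<in> cotangent_space M p" using z by (simp add: points_cot_atlas)
  have "poisson (cot_atlas M) (symplectic_form M) (momentum X) (momentum Y) (p, l)
    = (\<Sum>i\<in>Basis. (i \<bullet> X p c) * (?\<xi> \<bullet> ?D Y i)) - (\<Sum>i\<in>Basis. (i \<bullet> Y p c) * (?\<xi> \<bullet> ?D X i))"
    by (subst 1(3))
       (simp_all add: smooth_fun_differentiable[OF smooth_fun_momentum] 1 X Y momentum_derivative
         linear_0[OF lin] mult.commute)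
  also have "\<dots> = ?\<xi> \<bullet> lie_bracket M X Y p c"
    using 1(1,2) by (simp add: contract X Y lie_bracket_def inner_diff_right)
  finally show ?case using covector_in_coords[OF l 1(1,2) Z(2)] Z(1) by simp
qed

text \<open>On a fibre the momentum of \<open>X\<close> is linear, hence its derivative in the direction of a covector
  \<open>m\<close> is the value of \<open>m\<close> on \<open>X\<close>.\<close>

lemma vertical_vector:
  assumes z: "(p, l) \<in> points (cot_atlas M)" and m: "m \<in> cotangent_space M p"
  shows "\<exists>v\<in>tangent_space (cot_atlas M) (p, l). \<forall>X. smooth_vf_on M (points M) X \<longrightarrow>
    differential (cot_atlas M) (momentum X) (p, l) v = m (X p)"
proof -
  interpret cot: diff_atlas "cot_atlas M" by (rule cot_diff_atlas)
  obtain c where c: "c \<in> M" "p \<in> fst c" and C: "cot_chart M c \<in> cot_atlas M" "(p, l) \<in> fst (cot_chart M c)"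
    using chart_at_cot_atlas[OF z] by metis
  let ?v = "coord_vec (cot_atlas M) (cot_chart M c) (p, l) (0, covec_coords c p m)"
  have v: "?v \<in> tangent_space (cot_atlas M) (p, l)" by (rule cot.coord_vec_tangent[OF C])
  have "differential (cot_atlas M) (momentum X) (p, l) ?v = m (X p)"
    if X: "smooth_vf_on M (points M) X" for X
  proof -
    have "X p \<in> tangent_space M p" using X in_points[OF c] by (simp add: smooth_vf_on_def)
    moreover have "linear (frechet_derivative (\<lambda>x. X (cinv c x) c) (at (snd c p)))"
      using smooth_on_differentiable[OF smooth_vf_points[OF X c(1)]] c(2)
      by (intro linear_frechet_derivative) simp
    ultimately show ?thesis
      by (simp add: cot.differential_chart[OF v C smooth_fun_differentiable[OF smooth_fun_momentum[OF X] c]]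
          cot.coord_vec_chart[OF C] momentum_derivative[OF X c] linear_0 covector_in_coords[OF m c])
  qed
  then show ?thesis using v by blast
qed

lemma cotangent_line:
  "l \<in> cotangent_space M p \<Longrightarrow> m \<in> cotangent_space M p \<Longrightarrow> (\<lambda>v. l v + t * m v) \<in> cotangent_space M p"
  by (simp add: cotangent_space_def algebra_simps)

text \<open>Density of an open condition on the momenta of a frame is checked along lines in the fibres,
  where the momenta are affine functions.\<close>

lemma fibre_line_in_open:
  assumes W: "openin (mtop (cot_atlas M)) W" "(p, l) \<in> W" and m: "m \<in> cotangent_space M p"
  shows "\<exists>e>0. \<forall>t. \<bar>t\<bar> < e \<longrightarrow> (p, \<lambda>v. l v + t * m v) \<in> W"
proof -
  interpret cot: diff_atlas "cot_atlas M" by (rule cot_diff_atlas)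
  have z: "(p, l) \<in> points (cot_atlas M)" using W by (auto simp: cot.openin_iff)
  obtain c where c: "c \<in> M" "p \<in> fst c" "l \<in> cotangent_space M p"
    and C: "cot_chart M c \<in> cot_atlas M" "(p, l) \<in> fst (cot_chart M c)"
    using chart_at_cot_atlas[OF z] by metis
  let ?C = "cot_chart M c" let ?\<gamma> = "\<lambda>t. (p, \<lambda>v. l v + t * m v)"
  have \<gamma>: "?\<gamma> t \<in> fst ?C" for t using c m cotangent_line by (simp add: fst_cot_chart)
  have coords: "snd ?C (?\<gamma> t) = (snd c p, covec_coords c p l + t *\<^sub>R covec_coords c p m)" for t
    by (simp add: snd_cot_chart covec_coords_def scaleR_add_left sum.distrib scaleR_sum_right)
  have "continuous_on UNIV (\<lambda>t. snd ?C (?\<gamma> t))" unfolding coords by (intro continuous_intros)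
  moreover have "open (snd ?C ` (W \<inter> fst ?C))" using W C by (simp add: cot.openin_iff)
  ultimately have "open ((\<lambda>t. snd ?C (?\<gamma> t)) -` (snd ?C ` (W \<inter> fst ?C)))"
    by (rule open_vimage[rotated])
  moreover have "0 \<in> (\<lambda>t. snd ?C (?\<gamma> t)) -` (snd ?C ` (W \<inter> fst ?C))" using W C by auto
  ultimately obtain e where e: "e > 0" "ball 0 e \<subseteq> (\<lambda>t. snd ?C (?\<gamma> t)) -` (snd ?C ` (W \<inter> fst ?C))"
    by (rule openE)
  have "?\<gamma> t \<in> W" if "\<bar>t\<bar> < e" for t
  proof -
    have "t \<in> ball 0 e" using that by simp
    then obtain w where "w \<in> W" "w \<in> fst ?C" "snd ?C (?\<gamma> t) = snd ?C w" using e(2) by blast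
    then show ?thesis using inj_onD[OF cot_chart_inj[OF c(1)], of "?\<gamma> t" w] \<gamma>[of t] by simp
  qed
  then show ?thesis using e(1) by blast
qed

text \<open>Tangent vectors live in a vector space of families of components; a linear form on this space
  with prescribed values is cut off outside of the tangent space at \<open>p\<close>.\<close>

lemma covector_extension:
  assumes "independent B"
  shows "\<exists>m\<in>cotangent_space M p. \<forall>v\<in>B \<inter> tangent_space M p. m v = (g v :: real)"
proof -
  obtain h where h: "linear h" "\<forall>v\<in>B. h v = g v"
    using linear_independent_extend[OF assms] by blast
  have "(\<lambda>v. if v \<in> tangent_space M p then h v else 0) \<in> cotangent_space M p"
    using subspace_add[OF subspace_tangent] subspace_scale[OF subspace_tangent]
    by (simp add: cotangent_space_def linear_add[OF h(1)] linear_cmul[OF h(1)])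
  then show ?thesis using h(2) by (intro bexI) auto
qed

end

context diff_atlas
begin

lemma smooth_fun_mult:
  assumes "smooth_fun M a" "smooth_fun M b"
  shows "smooth_fun M (\<lambda>x. a x * b x)"
proof -
  have "smooth_on (snd c ` fst c) (\<lambda>y. (a \<circ> cinv c) y * (b \<circ> cinv c) y)" if "c \<in> M" for c
    using assms that unfolding smooth_fun_def
    by (intro smooth_on_bounded_bilinear[OF bounded_bilinear_mult chart_open]) blast+
  then show ?thesis by (simp add: smooth_fun_def comp_def)
qed

lemma smooth_fun_half_squares:
  assumes "smooth_fun M a" "smooth_fun M b"
  shows "smooth_fun M (\<lambda>x. ((a x)\<^sup>2 + (b x)\<^sup>2) / 2)"
proof -
  have "smooth_on (snd c ` fst c) (\<lambda>y. ((\<lambda>x. a x * a x) \<circ> cinv c) y + ((\<lambda>x. b x * b x) \<circ> cinv c) y)"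
    if "c \<in> M" for c
    using smooth_fun_mult[OF assms(1,1)] smooth_fun_mult[OF assms(2,2)] that unfolding smooth_fun_def
    by (intro smooth_on_add chart_open) blast+
  then have "smooth_fun M (\<lambda>x. (a x)\<^sup>2 + (b x)\<^sup>2)" by (simp add: smooth_fun_def comp_def power2_eq_square)
  moreover have "smooth_fun M (\<lambda>x. 1 / 2)" by (simp add: smooth_fun_def comp_def smooth_on_def Ck_on_const)
  ultimately show ?thesis using smooth_fun_mult by fastforce
qed

lemma openin_smooth_fun_preimage:
  assumes "smooth_fun M a" "open S"
  shows "openin (mtop M) {x \<in> points M. a x \<in> S}"
  unfolding openin_iff
proof (intro conjI ballI)
  fix c assume c: "c \<in> M"
  have "continuous_on (snd c ` fst c) (a \<circ> cinv c)"
    using assms c smooth_on_continuous unfolding smooth_fun_def by blast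
  then have "open ((a \<circ> cinv c) -` S \<inter> snd c ` fst c)"
    using continuous_on_open_vimage[OF chart_open[OF c]] assms(2) by blast
  moreover have "snd c ` ({x \<in> points M. a x \<in> S} \<inter> fst c) = (a \<circ> cinv c) -` S \<inter> snd c ` fst c"
    using c by (auto simp: cinv_chart in_points image_iff)
  ultimately show "open (snd c ` ({x \<in> points M. a x \<in> S} \<inter> fst c))" by simp
qed auto

lemma continuous_map_smooth_fun:
  assumes "smooth_fun M a"
  shows "continuous_map (mtop M) euclideanreal a"
  unfolding continuous_map_def
  using openin_smooth_fun_preimage[OF assms] by (simp add: topspace_mtop)

end

lemma manifold_imp_smooth_atlas: "manifold A \<Longrightarrow> smooth_atlas A"
  by (intro smooth_atlas.intro manifold_imp_diff_atlas smooth_atlas_axioms.intro) (simp_all add: manifold_def)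

section \<open>Invariant vector fields on Lie groups\<close>

lemma cinv_prod:
  assumes "inj_on (snd c) (fst c)" "inj_on (snd c') (fst c')" "x \<in> snd c ` fst c" "y \<in> snd c' ` fst c'"
  shows "cinv (fst c \<times> fst c', map_prod (snd c) (snd c')) (x, y) = (cinv c x, cinv c' y)"
proof -
  have "inj_on (map_prod (snd c) (snd c')) (fst c \<times> fst c')" using assms by (intro map_prod_inj_on)
  from inv_into_f_f[OF this, of "(cinv c x, cinv c' y)"] show ?thesis
    using chart_cinv[OF assms(3)] chart_cinv[OF assms(4)]
    by (simp add: cinv_def[of "(fst c \<times> fst c', map_prod (snd c) (snd c'))"])
qed

lemma prod_diff_atlas:
  assumes A: "diff_atlas A" and B: "diff_atlas B"
  shows "diff_atlas (prod_atlas A B)"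
proof
  interpret A: diff_atlas A by fact
  interpret B: diff_atlas B by fact
  fix C assume "C \<in> prod_atlas A B"
  then obtain c d where c: "c \<in> A" and d: "d \<in> B" and C: "C = (fst c \<times> fst d, map_prod (snd c) (snd d))"
    by (auto simp: prod_atlas_def)
  show "inj_on (snd C) (fst C)" using A.chart_inj[OF c] B.chart_inj[OF d] by (simp add: C map_prod_inj_on)
  show "open (snd C ` fst C)"
    using A.chart_open[OF c] B.chart_open[OF d] by (simp add: C map_prod_surj_on[OF refl refl] open_Times)
  fix C' assume "C' \<in> prod_atlas A B"
  then obtain c' d' where c': "c' \<in> A" and d': "d' \<in> B"
    and C': "C' = (fst c' \<times> fst d', map_prod (snd c') (snd d'))"
    by (auto simp: prod_atlas_def)
  have img: "snd C ` (fst C \<inter> fst C') = snd c ` (fst c \<inter> fst c') \<times> snd d ` (fst d \<inter> fst d')"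
    by (simp add: C C' Times_Int_Times map_prod_surj_on[OF refl refl])
  show op: "open (snd C ` (fst C \<inter> fst C'))"
    unfolding img by (intro open_Times A.overlap_open B.overlap_open c d c' d')
  fix z assume z: "z \<in> fst C" "z \<in> fst C'"
  obtain p q where pq: "z = (p, q)" "p \<in> fst c" "p \<in> fst c'" "q \<in> fst d" "q \<in> fst d'"
    using z by (auto simp: C C')
  have "((snd c' \<circ> cinv c) \<circ> fst) differentiable (at (snd c p, snd d q))"
    "((snd d' \<circ> cinv d) \<circ> snd) differentiable (at (snd c p, snd d q))"
    by (rule differentiable_chain_at[OF bounded_linear_imp_differentiable[OF bounded_linear_fst]]
        differentiable_chain_at[OF bounded_linear_imp_differentiable[OF bounded_linear_snd]],
        simp add: A.transition_differentiable B.transition_differentiable c d c' d' pq)+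
  then have "(\<lambda>w. (((snd c' \<circ> cinv c) \<circ> fst) w, ((snd d' \<circ> cinv d) \<circ> snd) w)) differentiable (at (snd c p, snd d q))"
    by (rule differentiable_Pair)
  then obtain D where "((\<lambda>w. (((snd c' \<circ> cinv c) \<circ> fst) w, ((snd d' \<circ> cinv d) \<circ> snd) w)) has_derivative D)
      (at (snd C z))"
    unfolding differentiable_def by (auto simp: C pq)
  then have "(snd C' \<circ> cinv C has_derivative D) (at (snd C z))"
  proof (rule has_derivative_transform_within_open[OF _ op])
    show "snd C z \<in> snd C ` (fst C \<inter> fst C')" using z by blast
    fix w assume "w \<in> snd C ` (fst C \<inter> fst C')"
    then have "fst w \<in> snd c ` fst c" "snd w \<in> snd d ` fst d" unfolding img by auto
    from cinv_prod[OF A.chart_inj[OF c] B.chart_inj[OF d] this]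
    show "(((snd c' \<circ> cinv c) \<circ> fst) w, ((snd d' \<circ> cinv d) \<circ> snd) w) = (snd C' \<circ> cinv C) w"
      by (simp add: C C')
  qed
  then show "(snd C' \<circ> cinv C) differentiable (at (snd C z))" unfolding differentiable_def by blast
qed

sublocale lie_group \<subseteq> smooth_atlas A
  by (rule manifold_imp_smooth_atlas[OF manifold])

context lie_group
begin

text \<open>The multiplication in coordinates is one smooth function \<open>F\<close> of two variables, and its partial
  derivatives represent the tangent maps of all left and right translations near \<open>a\<close> and \<open>q\<close>.\<close>

lemma mult_coordinates:
  assumes c: "c1 \<in> A" "c2 \<in> A" "c3 \<in> A" and a: "a \<in> fst c1" and q: "q \<in> fst c2"
    and aq: "a \<otimes> q \<in> fst c3"
  obtains S F where "open S" "(snd c1 a, snd c2 q) \<in> S" "smooth_on S F"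
    "\<And>x y. (x, y) \<in> S \<Longrightarrow> x \<in> snd c1 ` fst c1 \<and> y \<in> snd c2 ` fst c2 \<and>
      cinv c1 x \<otimes> cinv c2 y \<in> fst c3 \<and> F (x, y) = snd c3 (cinv c1 x \<otimes> cinv c2 y)"
    "\<And>x y. (x, y) \<in> S \<Longrightarrow> (snd c3 \<circ> (\<lambda>p. cinv c1 x \<otimes> p) \<circ> cinv c2 has_derivative
      (\<lambda>v. frechet_derivative F (at (x, y)) (0, v))) (at y)"
    "\<And>x y. (x, y) \<in> S \<Longrightarrow> (snd c3 \<circ> (\<lambda>p. p \<otimes> cinv c2 y) \<circ> cinv c1 has_derivative
      (\<lambda>v. frechet_derivative F (at (x, y)) (v, 0))) (at x)"
proof -
  let ?C = "(fst c1 \<times> fst c2, map_prod (snd c1) (snd c2))" let ?m = "\<lambda>(x, y). x \<otimes> y"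
  define S where "S = snd ?C ` (fst ?C \<inter> ?m -` fst c3)"
  define F where "F = (\<lambda>z. snd c3 (cinv c1 (fst z) \<otimes> cinv c2 (snd z)))"
  have C: "?C \<in> prod_atlas A A" using c by (force simp: prod_atlas_def)
  have P: "diff_atlas (prod_atlas A A)" by (rule prod_diff_atlas; unfold_locales)
  have S: "open S" and sm: "smooth_on S (snd c3 \<circ> ?m \<circ> cinv ?C)"
    using smooth_map_coordinates[OF P diff_atlas_axioms smooth_mult C c(3)] unfolding S_def by auto
  have inS: "x \<in> snd c1 ` fst c1 \<and> y \<in> snd c2 ` fst c2 \<and> cinv c1 x \<otimes> cinv c2 y \<in> fst c3"
    if "(x, y) \<in> S" for x y
    using that c by (auto simp: S_def cinv_chart)
  have cinvC: "cinv ?C (x, y) = (cinv c1 x, cinv c2 y)" if "(x, y) \<in> S" for x y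
    using inS[OF that] by (intro cinv_prod chart_inj c) auto
  have eqF: "(snd c3 \<circ> ?m \<circ> cinv ?C) z = F z" if "z \<in> S" for z
    using cinvC[of "fst z" "snd z"] that by (simp add: F_def)
  have smF: "smooth_on S F" using sm smooth_on_cong[OF S eqF] by simp
  have dF: "(F has_derivative frechet_derivative F (at z)) (at z)" if "z \<in> S" for z
    using smooth_on_differentiable[OF smF that] by (simp add: frechet_derivative_works)
  show thesis
  proof (rule that[OF S _ smF])
    show "(snd c1 a, snd c2 q) \<in> S" unfolding S_def using a q aq by force
    fix x y assume xy: "(x, y) \<in> S"
    show "x \<in> snd c1 ` fst c1 \<and> y \<in> snd c2 ` fst c2 \<and>
      cinv c1 x \<otimes> cinv c2 y \<in> fst c3 \<and> F (x, y) = snd c3 (cinv c1 x \<otimes> cinv c2 y)"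
      using inS[OF xy] by (simp add: F_def)
    have "((\<lambda>v. (x, v)) has_derivative (\<lambda>v. (0, v))) (at y)"
      "((\<lambda>v. (v, y)) has_derivative (\<lambda>v. (v, 0))) (at x)"
      by (auto intro!: derivative_eq_intros)
    from diff_chain_at[OF this(1) dF[OF xy]] diff_chain_at[OF this(2) dF[OF xy]]
    show "(snd c3 \<circ> (\<lambda>p. cinv c1 x \<otimes> p) \<circ> cinv c2 has_derivative
        (\<lambda>v. frechet_derivative F (at (x, y)) (0, v))) (at y)"
      "(snd c3 \<circ> (\<lambda>p. p \<otimes> cinv c2 y) \<circ> cinv c1 has_derivative
        (\<lambda>v. frechet_derivative F (at (x, y)) (v, 0))) (at x)"
      by (simp_all add: F_def comp_def)
  qed
qed

lemma in_carrier: "c \<in> A \<Longrightarrow> p \<in> fst c \<Longrightarrow> p \<in> carrier G"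
  using in_points carrier_eq by simp

lemma obtain_chart:
  assumes "p \<in> carrier G" obtains c where "c \<in> A" "p \<in> fst c"
  using assms carrier_eq by (auto simp: points_def)

lemma diff_map_left:
  assumes a: "a \<in> carrier G" and q: "q \<in> carrier G"
  shows "diff_map A A (\<lambda>x. a \<otimes> x) q"
  unfolding diff_map_def
proof (intro conjI ballI impI)
  show "q \<in> points A" "a \<otimes> q \<in> points A" using a q carrier_eq m_closed by auto
  fix c c' assume c: "c \<in> A" "c' \<in> A" "q \<in> fst c" "a \<otimes> q \<in> fst c'"
  obtain c1 where c1: "c1 \<in> A" "a \<in> fst c1" using obtain_chart[OF a] .
  obtain S F where S: "open S" "(snd c1 a, snd c q) \<in> S"
    and inS: "\<And>x y. (x, y) \<in> S \<Longrightarrow> x \<in> snd c1 ` fst c1 \<and> y \<in> snd c ` fst c \<and>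
      cinv c1 x \<otimes> cinv c y \<in> fst c' \<and> F (x, y) = snd c' (cinv c1 x \<otimes> cinv c y)"
    and d: "\<And>x y. (x, y) \<in> S \<Longrightarrow> (snd c' \<circ> (\<lambda>p. cinv c1 x \<otimes> p) \<circ> cinv c has_derivative
      (\<lambda>v. frechet_derivative F (at (x, y)) (0, v))) (at y)"
    by (rule mult_coordinates[OF c1(1) c(1,2) c1(2) c(3,4)]) blast
  show "(snd c' \<circ> (\<lambda>x. a \<otimes> x) \<circ> cinv c) differentiable (at (snd c q))"
    using d[OF S(2)] by (auto simp: differentiable_def cinv_chart c1)
  let ?U = "(\<lambda>y. (snd c1 a, y)) -` S"
  have "open ?U" by (intro open_vimage S continuous_intros)
  moreover have "?U \<subseteq> snd c ` (fst c \<inter> (\<lambda>x. a \<otimes> x) -` fst c')"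
  proof
    fix y assume "y \<in> ?U"
    then have y: "y \<in> snd c ` fst c" "a \<otimes> cinv c y \<in> fst c'"
      using inS[of "snd c1 a" y] by (auto simp: cinv_chart c1)
    then show "y \<in> snd c ` (fst c \<inter> (\<lambda>x. a \<otimes> x) -` fst c')"
      using chart_cinv[OF y(1)] by (auto intro!: image_eqI[of _ _ "cinv c y"])
  qed
  ultimately show "\<exists>U. open U \<and> snd c q \<in> U \<and> U \<subseteq> snd c ` (fst c \<inter> (\<lambda>x. a \<otimes> x) -` fst c')"
    using S(2) by (intro exI[of _ ?U]) simp
qed

lemma diff_map_right:
  assumes a: "a \<in> carrier G" and q: "q \<in> carrier G"
  shows "diff_map A A (\<lambda>x. x \<otimes> a) q"
  unfolding diff_map_def
proof (intro conjI ballI impI)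
  show "q \<in> points A" "q \<otimes> a \<in> points A" using a q carrier_eq m_closed by auto
  fix c c' assume c: "c \<in> A" "c' \<in> A" "q \<in> fst c" "q \<otimes> a \<in> fst c'"
  obtain c1 where c1: "c1 \<in> A" "a \<in> fst c1" using obtain_chart[OF a] .
  obtain S F where S: "open S" "(snd c q, snd c1 a) \<in> S"
    and inS: "\<And>x y. (x, y) \<in> S \<Longrightarrow> x \<in> snd c ` fst c \<and> y \<in> snd c1 ` fst c1 \<and>
      cinv c x \<otimes> cinv c1 y \<in> fst c' \<and> F (x, y) = snd c' (cinv c x \<otimes> cinv c1 y)"
    and d: "\<And>x y. (x, y) \<in> S \<Longrightarrow> (snd c' \<circ> (\<lambda>p. p \<otimes> cinv c1 y) \<circ> cinv c has_derivative
      (\<lambda>v. frechet_derivative F (at (x, y)) (v, 0))) (at x)"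
    by (rule mult_coordinates[OF c(1) c1(1) c(2,3) c1(2) c(4)]) blast
  show "(snd c' \<circ> (\<lambda>x. x \<otimes> a) \<circ> cinv c) differentiable (at (snd c q))"
    using d[OF S(2)] by (auto simp: differentiable_def cinv_chart c1)
  let ?U = "(\<lambda>y. (y, snd c1 a)) -` S"
  have "open ?U" by (intro open_vimage S continuous_intros)
  moreover have "?U \<subseteq> snd c ` (fst c \<inter> (\<lambda>x. x \<otimes> a) -` fst c')"
  proof
    fix y assume "y \<in> ?U"
    then have y: "y \<in> snd c ` fst c" "cinv c y \<otimes> a \<in> fst c'"
      using inS[of y "snd c1 a"] by (auto simp: cinv_chart c1)
    then show "y \<in> snd c ` (fst c \<inter> (\<lambda>x. x \<otimes> a) -` fst c')"
      using chart_cinv[OF y(1)] by (auto intro!: image_eqI[of _ _ "cinv c y"])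
  qed
  ultimately show "\<exists>U. open U \<and> snd c q \<in> U \<and> U \<subseteq> snd c ` (fst c \<inter> (\<lambda>x. x \<otimes> a) -` fst c')"
    using S(2) by (intro exI[of _ ?U]) simp
qed

lemma diff_map_inv: "q \<in> carrier G \<Longrightarrow> diff_map A A (m_inv G) q"
  by (rule smooth_map_imp_diff_map[OF diff_atlas_axioms diff_atlas_axioms smooth_inv]) (simp add: carrier_eq)

text \<open>On the product \<open>G \<times> G\<close> the fields \<open>(0, X)\<close> and \<open>(Y, 0)\<close> commute, and the multiplication
  relates them to the left-invariant field \<open>X\<close> and to the right-invariant field \<open>Y\<close>.\<close>

lemma left_right_invariant_commute:
  assumes X: "smooth_vf_on A (points A) X" and Y: "smooth_vf_on A (points A) Y"
    and L: "\<And>a q. a \<in> carrier G \<Longrightarrow> q \<in> carrier G \<Longrightarrow> tangent_map A A (\<lambda>x. a \<otimes> x) q (X q) = X (a \<otimes> q)"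
    and R: "\<And>a q. a \<in> carrier G \<Longrightarrow> q \<in> carrier G \<Longrightarrow> tangent_map A A (\<lambda>x. x \<otimes> a) q (Y q) = Y (q \<otimes> a)"
    and q: "q \<in> carrier G"
  shows "lie_bracket A X Y q = 0"
proof
  fix c
  show "lie_bracket A X Y q c = 0 c"
  proof (cases "c \<in> A \<and> q \<in> fst c")
    case True
    then have c: "c \<in> A" "q \<in> fst c" by auto
    obtain c1 where c1: "c1 \<in> A" "\<one> \<in> fst c1" using obtain_chart[OF one_closed] .
    \<comment> \<open>The bracket at \<open>q\<close> is computed at the point \<open>(\<one>, q)\<close> of \<open>G \<times> G\<close>.\<close>
    have 1: "\<one> \<otimes> q \<in> fst c" using c q by simp
    obtain S F where S: "open S" "(snd c1 \<one>, snd c q) \<in> S" and F: "smooth_on S F"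
      and inS: "\<And>x y. (x, y) \<in> S \<Longrightarrow> x \<in> snd c1 ` fst c1 \<and> y \<in> snd c ` fst c \<and>
        cinv c1 x \<otimes> cinv c y \<in> fst c \<and> F (x, y) = snd c (cinv c1 x \<otimes> cinv c y)"
      and d2: "\<And>x y. (x, y) \<in> S \<Longrightarrow> (snd c \<circ> (\<lambda>p. cinv c1 x \<otimes> p) \<circ> cinv c has_derivative
        (\<lambda>v. frechet_derivative F (at (x, y)) (0, v))) (at y)"
      and d1: "\<And>x y. (x, y) \<in> S \<Longrightarrow> (snd c \<circ> (\<lambda>p. p \<otimes> cinv c y) \<circ> cinv c1 has_derivative
        (\<lambda>v. frechet_derivative F (at (x, y)) (v, 0))) (at x)"
      by (rule mult_coordinates[OF c1(1) c(1,1) c1(2) c(2) 1]) blast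
    let ?X = "\<lambda>x. X (cinv c x) c" and ?Y = "\<lambda>x. Y (cinv c x) c" and ?YO = "\<lambda>x. Y (cinv c1 x) c1"
    let ?z = "(snd c1 \<one>, snd c q)"
    let ?XX = "\<lambda>z. (0, (?X \<circ> snd) z)" and ?YY = "\<lambda>z. ((?YO \<circ> fst) z, 0)"
    have Fz: "F ?z = snd c q" using inS[OF S(2)] c c1 q by (simp add: cinv_chart)
    have dX: "?X differentiable (at (snd c q))" and dY: "?Y differentiable (at (snd c q))"
      and dY1: "?YO differentiable (at (snd c1 \<one>))"
      using smooth_on_differentiable[OF smooth_vf_points[OF X c(1)]] c(2)
        smooth_on_differentiable[OF smooth_vf_points[OF Y c(1)]]
        smooth_on_differentiable[OF smooth_vf_points[OF Y c1(1)]] c1(2) by auto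
    have dX0: "(?XX has_derivative (\<lambda>v. (0, frechet_derivative ?X (at (snd c q)) (snd v)))) (at ?z)"
      using diff_chain_at[OF bounded_linear_imp_has_derivative[OF bounded_linear_snd, of "at ?z"],
          of ?X "frechet_derivative ?X (at (snd c q))"] dX
      by (intro has_derivative_Pair has_derivative_const) (simp_all add: frechet_derivative_works[symmetric] comp_def)
    have dY0: "(?YY has_derivative (\<lambda>v. (frechet_derivative ?YO (at (snd c1 \<one>)) (fst v), 0))) (at ?z)"
      using diff_chain_at[OF bounded_linear_imp_has_derivative[OF bounded_linear_fst, of "at ?z"],
          of ?YO "frechet_derivative ?YO (at (snd c1 \<one>))"] dY1
      by (intro has_derivative_Pair has_derivative_const) (simp_all add: frechet_derivative_works[symmetric] comp_def)
    have tan: "X p \<in> tangent_space A p" "Y p \<in> tangent_space A p" if "p \<in> carrier G" for p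
      using X Y that carrier_eq by (auto simp: smooth_vf_on_def)
    have relX: "?X (F w) = frechet_derivative F (at w) (?XX w)" if "w \<in> S" for w
    proof -
      obtain x y where w: "w = (x, y)" by (cases w)
      note i = inS[OF that[unfolded w]] and d = d2[OF that[unfolded w]]
      note p = chart_cinv[of x c1] chart_cinv[of y c]
      have "X (cinv c1 x \<otimes> cinv c y) c = tangent_map A A (\<lambda>p. cinv c1 x \<otimes> p) (cinv c y) (X (cinv c y)) c"
        using L[of "cinv c1 x" "cinv c y"] i p in_carrier c1 c by simp
      also have "\<dots> = frechet_derivative (snd c \<circ> (\<lambda>p. cinv c1 x \<otimes> p) \<circ> cinv c) (at (snd c (cinv c y))) (X (cinv c y) c)"
        using i p d in_carrier[OF c(1)] by (intro tangent_map_chart tan c) (auto simp: differentiable_def)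
      also have "\<dots> = frechet_derivative F (at w) (?XX w)"
        using i p by (simp add: frechet_derivative_at[OF d, symmetric] w)
      finally show ?thesis using i c by (simp add: w cinv_chart)
    qed
    have relY: "?Y (F w) = frechet_derivative F (at w) (?YY w)" if "w \<in> S" for w
    proof -
      obtain x y where w: "w = (x, y)" by (cases w)
      note i = inS[OF that[unfolded w]] and d = d1[OF that[unfolded w]]
      note p = chart_cinv[of x c1] chart_cinv[of y c]
      have "Y (cinv c1 x \<otimes> cinv c y) c = tangent_map A A (\<lambda>p. p \<otimes> cinv c y) (cinv c1 x) (Y (cinv c1 x)) c"
        using R[of "cinv c y" "cinv c1 x"] i p in_carrier c1 c by simp
      also have "\<dots> = frechet_derivative (snd c \<circ> (\<lambda>p. p \<otimes> cinv c y) \<circ> cinv c1) (at (snd c1 (cinv c1 x))) (Y (cinv c1 x) c1)"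
        using i p d in_carrier[OF c1(1)] by (intro tangent_map_chart tan c c1) (auto simp: differentiable_def)
      also have "\<dots> = frechet_derivative F (at w) (?YY w)"
        using i p by (simp add: frechet_derivative_at[OF d, symmetric] w)
      finally show ?thesis using i c by (simp add: w cinv_chart)
    qed
    have "frechet_derivative ?Y (at (F ?z)) (?X (F ?z)) - frechet_derivative ?X (at (F ?z)) (?Y (F ?z))
      = frechet_derivative F (at ?z)
          (frechet_derivative ?YY (at ?z) (?XX ?z) - frechet_derivative ?XX (at ?z) (?YY ?z))"
      by (rule bracket_of_related_fields[OF S F _ _ _ _ relX relY])
         (use dX0 dY0 dX dY Fz in \<open>auto simp: differentiable_def\<close>)
    also have "frechet_derivative ?YY (at ?z) (?XX ?z) - frechet_derivative ?XX (at ?z) (?YY ?z) = 0"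
      unfolding frechet_derivative_at[OF dX0, symmetric] frechet_derivative_at[OF dY0, symmetric]
      using linear_0[OF linear_frechet_derivative[OF dX]] linear_0[OF linear_frechet_derivative[OF dY1]]
      by simp
    also have "frechet_derivative F (at ?z) 0 = 0"
      by (rule linear_0[OF linear_frechet_derivative[OF smooth_on_differentiable[OF F S(2)]]])
    finally show ?thesis using c by (simp add: lie_bracket_def Fz cinv_chart)
  next
    case False
    then show ?thesis by (auto simp: lie_bracket_def)
  qed
qed

subsection \<open>The image of a field under the inversion\<close>

abbreviation push_inv :: "('p, 'e) vfield \<Rightarrow> ('p, 'e) vfield"
  where "push_inv \<equiv> push_vf A (m_inv G)"

lemma push_inv_apply:
  assumes "q \<in> carrier G"
  shows "push_inv X q = tangent_map A A (m_inv G) (inv q) (X (inv q))"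
proof -
  have "inv_into (points A) (m_inv G) q = inv q"
    using assms carrier_eq inv_inj by (intro inv_into_f_eq) auto
  then show ?thesis by (simp add: push_vf_def Let_def)
qed

lemma push_inv_tangent:
  assumes X: "smooth_vf_on A (points A) X" and q: "q \<in> carrier G"
  shows "push_inv X q \<in> tangent_space A q"
proof -
  have "X (inv q) \<in> tangent_space A (inv q)"
    using X inv_closed[OF q] unfolding carrier_eq smooth_vf_on_def by blast
  from tangent_map_tangent[OF diff_atlas_axioms diff_atlas_axioms diff_map_inv[OF inv_closed[OF q]] this]
  show ?thesis by (simp add: push_inv_apply q)
qed

text \<open>The inversion maps the domain of a coordinate representation into the domain of the
  representation with the two charts exchanged.\<close>

lemma inv_coordinates:
  assumes c: "c \<in> A" "c' \<in> A"
  defines "S \<equiv> snd c ` (fst c \<inter> m_inv G -` fst c')"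
  shows "open S" "smooth_on S (snd c' \<circ> m_inv G \<circ> cinv c)"
    and "\<And>x. x \<in> S \<Longrightarrow> x \<in> snd c ` fst c \<and> cinv c x \<in> fst c \<and> inv (cinv c x) \<in> fst c' \<and>
      (snd c' \<circ> m_inv G \<circ> cinv c) x \<in> snd c' ` (fst c' \<inter> m_inv G -` fst c)"
    and "\<And>p. p \<in> fst c \<Longrightarrow> inv p \<in> fst c' \<Longrightarrow> snd c p \<in> S"
proof -
  show "open S" "smooth_on S (snd c' \<circ> m_inv G \<circ> cinv c)"
    unfolding S_def by (rule smooth_map_coordinates[OF diff_atlas_axioms diff_atlas_axioms smooth_inv c])+
  show "x \<in> snd c ` fst c \<and> cinv c x \<in> fst c \<and> inv (cinv c x) \<in> fst c' \<and>
      (snd c' \<circ> m_inv G \<circ> cinv c) x \<in> snd c' ` (fst c' \<inter> m_inv G -` fst c)" if "x \<in> S" for x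
  proof -
    obtain p where p: "x = snd c p" "p \<in> fst c" "inv p \<in> fst c'" using \<open>x \<in> S\<close> by (auto simp: S_def)
    then show ?thesis using c in_carrier[OF c(1)] by (auto simp: cinv_chart)
  qed
  show "snd c p \<in> S" if "p \<in> fst c" "inv p \<in> fst c'" for p using that by (auto simp: S_def)
qed

lemma push_inv_chart:
  assumes X: "smooth_vf_on A (points A) X" and c: "c \<in> A" "c0 \<in> A"
    and p: "p \<in> fst c0" "inv p \<in> fst c"
  shows "push_inv X (inv p) c
    = frechet_derivative (snd c \<circ> m_inv G \<circ> cinv c0) (at (snd c0 p)) (X p c0)"
proof -
  have pG: "p \<in> carrier G" using in_carrier c p by blast
  then have "X p \<in> tangent_space A p" using X carrier_eq by (simp add: smooth_vf_on_def)
  moreover have "(snd c \<circ> m_inv G \<circ> cinv c0) differentiable (at (snd c0 p))"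
    using smooth_on_differentiable[OF inv_coordinates(2)[OF c(2,1)]] inv_coordinates(4)[OF c(2,1)] p by blast
  ultimately show ?thesis
    using push_inv_apply[of "inv p" X] pG tangent_map_chart[of "X p" p c0 c A "m_inv G"] c p by simp
qed

lemma push_inv_smooth:
  assumes X: "smooth_vf_on A (points A) X"
  shows "smooth_vf_on A (points A) (push_inv X)"
  unfolding smooth_vf_on_def
proof (intro conjI ballI)
  fix q assume "q \<in> points A"
  then show "push_inv X q \<in> tangent_space A q" using push_inv_tangent[OF X] carrier_eq by simp
next
  fix c assume c: "c \<in> A"
  show "smooth_on (snd c ` (fst c \<inter> points A)) (\<lambda>x. push_inv X (cinv c x) c)"
  proof (rule smooth_on_local)
    fix x assume "x \<in> snd c ` (fst c \<inter> points A)"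
    then obtain q where q: "x = snd c q" "q \<in> fst c" "q \<in> carrier G" using carrier_eq by auto
    obtain c0 where c0: "c0 \<in> A" "inv q \<in> fst c0" using obtain_chart[OF inv_closed[OF q(3)]] .
    let ?T = "snd c ` (fst c \<inter> m_inv G -` fst c0)" and ?T' = "snd c0 ` (fst c0 \<inter> m_inv G -` fst c)"
    let ?\<tau> = "snd c0 \<circ> m_inv G \<circ> cinv c" and ?\<rho> = "snd c \<circ> m_inv G \<circ> cinv c0"
    note T = inv_coordinates[OF c c0(1)] and T' = inv_coordinates[OF c0(1) c]
    have eq: "push_inv X (cinv c y) c
        = frechet_derivative ?\<rho> (at (?\<tau> y)) (((\<lambda>x. X (cinv c0 x) c0) \<circ> ?\<tau>) y)" if "y \<in> ?T" for y
    proof -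
      let ?p = "inv (cinv c y)"
      have p: "cinv c y \<in> fst c" "?p \<in> fst c0" using T(3)[OF that] by auto
      moreover have "inv ?p = cinv c y" using in_carrier[OF c p(1)] by simp
      ultimately show ?thesis
        using push_inv_chart[OF X c c0(1), of ?p] cinv_chart[OF c0(1), of ?p] by simp
    qed
    have img: "?\<tau> ` ?T \<subseteq> ?T'" using T(3) by blast
    then have img': "?\<tau> ` ?T \<subseteq> snd c0 ` fst c0" by blast
    have "smooth_on ?T (\<lambda>y. frechet_derivative ?\<rho> (at (?\<tau> y)) (((\<lambda>x. X (cinv c0 x) c0) \<circ> ?\<tau>) y))"
      by (intro smooth_on_derivative_along[OF T(1) T'(1) img T'(2) T(2)]
          smooth_on_compose[OF T(1) chart_open[OF c0(1)] img' smooth_vf_points[OF X c0(1)] T(2)])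
    then have "smooth_on ?T (\<lambda>y. push_inv X (cinv c y) c)"
      by (subst smooth_on_cong[OF T(1) eq])
    then show "\<exists>T. open T \<and> x \<in> T \<and> smooth_on T (\<lambda>y. push_inv X (cinv c y) c)"
      using T(1) T(4)[OF q(2) c0(2)] q(1) by blast
  qed
qed

text \<open>A field and its image are related by the inversion, and brackets of related fields are related.\<close>

lemma push_inv_bracket:
  assumes X: "smooth_vf_on A (points A) X" and Y: "smooth_vf_on A (points A) Y" and q: "q \<in> carrier G"
    and Z: "lie_bracket A X Y (inv q) = Z" "Z \<in> tangent_space A (inv q)"
  shows "lie_bracket A (push_inv X) (push_inv Y) q = tangent_map A A (m_inv G) (inv q) Z"
proof
  fix c
  have qq: "inv (inv q) = q" and qG: "inv q \<in> carrier G" using q by auto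
  show "lie_bracket A (push_inv X) (push_inv Y) q c = tangent_map A A (m_inv G) (inv q) Z c"
  proof (cases "c \<in> A \<and> q \<in> fst c")
    case True
    then have c: "c \<in> A" "q \<in> fst c" by auto
    obtain c0 where c0: "c0 \<in> A" "inv q \<in> fst c0" using obtain_chart[OF qG] .
    let ?S = "snd c0 ` (fst c0 \<inter> m_inv G -` fst c)" and ?F = "snd c \<circ> m_inv G \<circ> cinv c0"
    note S = inv_coordinates[OF c0(1) c(1)]
    have x: "snd c0 (inv q) \<in> ?S" by (rule S(4)) (simp_all add: c0 qq c)
    have Fx: "?F (snd c0 (inv q)) = snd c q" using c0 q by (simp add: cinv_chart)
    have diff: "(\<lambda>x. W (cinv d x) d) differentiable (at (snd d p))"
      if "smooth_vf_on A (points A) W" "d \<in> A" "p \<in> fst d" for W d p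
      using smooth_on_differentiable[OF smooth_vf_points[OF that(1,2)]] that(3) by blast
    have rel: "push_inv W (cinv c (?F y)) c = frechet_derivative ?F (at y) (W (cinv c0 y) c0)"
      if W: "smooth_vf_on A (points A) W" and y: "y \<in> ?S" for W y
    proof -
      have p: "y \<in> snd c0 ` fst c0" "cinv c0 y \<in> fst c0" "inv (cinv c0 y) \<in> fst c" using S(3)[OF y] by auto
      show ?thesis
        using push_inv_chart[OF W c(1) c0(1) p(2,3)] chart_cinv(1)[OF p(1)] cinv_chart[OF c(1) p(3)] by simp
    qed
    note dF = smooth_on_differentiable[OF S(2) x]
    have "lie_bracket A (push_inv X) (push_inv Y) q c
        = frechet_derivative (\<lambda>x. push_inv Y (cinv c x) c) (at (?F (snd c0 (inv q)))) (push_inv X (cinv c (?F (snd c0 (inv q)))) c)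
        - frechet_derivative (\<lambda>x. push_inv X (cinv c x) c) (at (?F (snd c0 (inv q)))) (push_inv Y (cinv c (?F (snd c0 (inv q)))) c)"
      using c by (simp add: lie_bracket_def Fx cinv_chart del: comp_apply)
    also have "\<dots> = frechet_derivative ?F (at (snd c0 (inv q)))
        (frechet_derivative (\<lambda>x. Y (cinv c0 x) c0) (at (snd c0 (inv q))) (X (cinv c0 (snd c0 (inv q))) c0)
       - frechet_derivative (\<lambda>x. X (cinv c0 x) c0) (at (snd c0 (inv q))) (Y (cinv c0 (snd c0 (inv q))) c0))"
    proof (rule bracket_of_related_fields[OF S(1) x S(2) _ _ _ _ rel[OF X] rel[OF Y]])
      show "(\<lambda>x. X (cinv c0 x) c0) differentiable (at (snd c0 (inv q)))" by (rule diff[OF X c0])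
      show "(\<lambda>x. Y (cinv c0 x) c0) differentiable (at (snd c0 (inv q)))" by (rule diff[OF Y c0])
      show "(\<lambda>x. push_inv X (cinv c x) c) differentiable (at (?F (snd c0 (inv q))))"
        unfolding Fx by (rule diff[OF push_inv_smooth[OF X] c])
      show "(\<lambda>x. push_inv Y (cinv c x) c) differentiable (at (?F (snd c0 (inv q))))"
        unfolding Fx by (rule diff[OF push_inv_smooth[OF Y] c])
    qed
    also have "\<dots> = frechet_derivative ?F (at (snd c0 (inv q))) (Z c0)"
      using c0 by (simp add: Z(1)[symmetric] lie_bracket_def cinv_chart)
    also have "\<dots> = tangent_map A A (m_inv G) (inv q) Z c"
      using c by (intro tangent_map_chart[symmetric] Z(2) c0 dF) (simp_all add: qq)
    finally show ?thesis .
  next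
    case False
    then show ?thesis using qq by (auto simp: lie_bracket_def tangent_map_def)
  qed
qed

text \<open>\<open>R\<^sub>a \<circ> i = i \<circ> L\<^sub>b\<close> with \<open>b = a\<^sup>-\<^sup>1\<close>, where \<open>i\<close> is the inversion.\<close>

lemma push_inv_right_invariant:
  assumes X: "smooth_vf_on A (points A) X"
    and L: "\<And>a q. a \<in> carrier G \<Longrightarrow> q \<in> carrier G \<Longrightarrow> tangent_map A A (\<lambda>x. a \<otimes> x) q (X q) = X (a \<otimes> q)"
    and a: "a \<in> carrier G" and q: "q \<in> carrier G"
  shows "tangent_map A A (\<lambda>x. x \<otimes> a) q (push_inv X q) = push_inv X (q \<otimes> a)"
proof -
  note D = diff_atlas_axioms
  have b: "inv a \<in> carrier G" and p: "inv q \<in> carrier G" using a q by auto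
  have Xp: "X (inv q) \<in> tangent_space A (inv q)" using X p carrier_eq by (simp add: smooth_vf_on_def)
  have flip: "inv (inv a \<otimes> x) = inv x \<otimes> a" if "x \<in> points A" for x
  proof -
    have "x \<in> carrier G" using that carrier_eq by simp
    then show ?thesis using a by (simp add: inv_mult_group)
  qed
  have R: "diff_map A A (\<lambda>x. x \<otimes> a) (inv (inv q))" using diff_map_right[OF a] q by simp
  have I: "diff_map A A (m_inv G) (inv a \<otimes> inv q)" using diff_map_inv b p by simp
  have comp: "diff_map A A (\<lambda>x. inv (inv a \<otimes> x)) (inv q)"
    by (rule diff_map_compose[OF D D diff_map_left[OF b p] I])
  have "tangent_map A A (\<lambda>x. x \<otimes> a) q (push_inv X q)
      = tangent_map A A (\<lambda>x. inv x \<otimes> a) (inv q) (X (inv q))"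
    using tangent_map_compose[OF D D diff_map_inv[OF p] R Xp] q by (simp add: push_inv_apply)
  also have "\<dots> = tangent_map A A (\<lambda>x. inv (inv a \<otimes> x)) (inv q) (X (inv q))"
    using tangent_map_cong[OF D comp flip] by simp
  also have "\<dots> = tangent_map A A (m_inv G) (inv a \<otimes> inv q) (X (inv a \<otimes> inv q))"
    using tangent_map_compose[OF D D diff_map_left[OF b p] I Xp] L[OF b p] by simp
  also have "\<dots> = push_inv X (q \<otimes> a)"
    using a q by (simp add: push_inv_apply inv_mult_group)
  finally show ?thesis .
qed

text \<open>The inversion is an involution, so its tangent maps are isomorphisms and preserve frames.\<close>

lemma push_inv_independent:
  assumes X: "\<And>i. i \<in> I \<Longrightarrow> smooth_vf_on A (points A) (X i)" and q: "q \<in> carrier G"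
    and inj: "inj_on (\<lambda>i. X i (inv q)) I" and ind: "independent ((\<lambda>i. X i (inv q)) ` I)"
  shows "inj_on (\<lambda>i. push_inv (X i) q) I" "independent ((\<lambda>i. push_inv (X i) q) ` I)"
proof -
  note D = diff_atlas_axioms
  let ?T = "tangent_map A A (m_inv G) (inv q)" and ?T' = "tangent_map A A (m_inv G) q"
  have p: "inv q \<in> carrier G" using q by simp
  have I: "diff_map A A (m_inv G) (inv (inv q))" using diff_map_inv[OF q] q by simp
  have "?T' (?T v) = v" if v: "v \<in> tangent_space A (inv q)" for v
  proof -
    have "?T' (?T v) = tangent_map A A (\<lambda>x. inv (inv x)) (inv q) v"
      using tangent_map_compose[OF D D diff_map_inv[OF p] I v] q by simp
    also have "\<dots> = tangent_map A A (\<lambda>x. x) (inv q) v"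
      using tangent_map_cong[OF D diff_map_compose[OF D D diff_map_inv[OF p] I], of "\<lambda>x. x"] carrier_eq by simp
    also have "\<dots> = v" using tangent_map_ident[OF D _ v] p carrier_eq by simp
    finally show ?thesis .
  qed
  then have injT: "inj_on ?T (tangent_space A (inv q))" by (intro inj_on_inverseI[of _ ?T'])
  have "(\<lambda>i. X i (inv q)) ` I \<subseteq> tangent_space A (inv q)"
    using X p carrier_eq by (auto simp: smooth_vf_on_def)
  then have "span ((\<lambda>i. X i (inv q)) ` I) \<subseteq> tangent_space A (inv q)"
    by (rule span_minimal[OF _ subspace_tangent])
  then have injS: "inj_on ?T (span ((\<lambda>i. X i (inv q)) ` I))" using injT inj_on_subset by blast
  have lin: "linear ?T" by (rule linear_tangent_map[OF D diff_map_inv[OF p]])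
  have eq: "(\<lambda>i. push_inv (X i) q) = ?T \<circ> (\<lambda>i. X i (inv q))" by (simp add: push_inv_apply q fun_eq_iff)
  show "inj_on (\<lambda>i. push_inv (X i) q) I"
    unfolding eq by (intro comp_inj_on inj inj_on_subset[OF injS span_superset])
  show "independent ((\<lambda>i. push_inv (X i) q) ` I)"
    unfolding eq image_comp[symmetric] by (rule linear_independent_injective_image[OF lin ind injS])
qed

end

\<comment> \<open>The index \<open>1\<close> stays in the form in which it occurs in the bracket relations.\<close>
declare One_nat_def [simp del]

section \<open>Linear algebra of families indexed by natural numbers\<close>

lemma independent_family:
  fixes v :: "nat \<Rightarrow> 'v::real_vector"
  assumes "\<And>c i. (\<Sum>j<k. c j *\<^sub>R v j) = 0 \<Longrightarrow> i < k \<Longrightarrow> c i = 0"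
  shows "inj_on v {..<k} \<and> independent (v ` {..<k})"
proof
  show inj: "inj_on v {..<k}"
  proof (rule inj_onI, rule ccontr)
    fix i j assume ij: "i \<in> {..<k}" "j \<in> {..<k}" "v i = v j" "i \<noteq> j"
    let ?c = "\<lambda>m. (if m = i then 1 else 0) - (if m = j then 1 else 0 :: real)"
    have "(\<Sum>m<k. ?c m *\<^sub>R v m) = v i - v j"
      using ij by (simp add: scaleR_diff_left sum_subtractf if_distrib[of "\<lambda>r. r *\<^sub>R _"] cong: if_cong)
    then show False using assms[of ?c i] ij by simp
  qed
  show "independent (v ` {..<k})"
  proof (rule independent_if_scalars_zero)
    fix f x assume f: "(\<Sum>x\<in>v ` {..<k}. f x *\<^sub>R x) = 0" and x: "x \<in> v ` {..<k}"
    then obtain i where i: "i < k" "x = v i" by auto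
    have "(\<Sum>j<k. f (v j) *\<^sub>R v j) = 0" using f by (simp add: sum.reindex[OF inj])
    then show "f x = 0" using assms[of "\<lambda>j. f (v j)" i] i by simp
  qed simp
qed

lemma obtain_small_avoiding:
  fixes e :: real
  assumes "e > 0" "finite B"
  obtains t where "\<bar>t\<bar> < e" "t \<notin> B"
proof -
  have "infinite {0<..<e}" using infinite_Ioo assms(1) by simp
  then obtain t where "t \<in> {0<..<e} - B"
    using finite_Diff2[OF assms(2), of "{0<..<e}"] by (metis ex_in_conv finite.emptyI)
  then show thesis using that[of t] by auto
qed

text \<open>The matrix of the brackets of \<open>H, g\<^sub>0, g\<^sub>1, g\<^sub>2\<close>, with \<open>a = \<chi> + \<kappa>\<close> and \<open>b = \<chi> - \<kappa>\<close>, as a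
  function of the values \<open>y\<^sub>0, \<dots>, y\<^sub>3\<close> of these integrals; the zero row and column belong to \<open>H\<close>.\<close>

definition poisson_matrix :: "real \<Rightarrow> real \<Rightarrow> nat \<Rightarrow> nat \<Rightarrow> (nat \<Rightarrow> real) \<Rightarrow> real"
  where "poisson_matrix a b i j y =
    (if (i, j) = (2, 1) then a * y 3 else if (i, j) = (1, 2) then - (a * y 3)
     else if (i, j) = (3, 1) then b * y 2 else if (i, j) = (1, 3) then - (b * y 2)
     else if (i, j) = (3, 2) then y 1 else if (i, j) = (2, 3) then - y 1 else 0)"

lemma less_4: "i < (4::nat) \<longleftrightarrow> i = 0 \<or> i = 1 \<or> i = 2 \<or> i = 3"
  by linarith

lemma lessThan_2: "{..<2::nat} = {0, 1}"
  by auto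

lemma lessThan_4: "{..<4::nat} = {0, 1, 2, 3}"
  by auto

text \<open>Two is the largest possible rank of an antisymmetric \<open>3 \<times> 3\<close> matrix: if the entry \<open>y\<^sub>1\<close> in the
  rows of \<open>g\<^sub>1\<close> and \<open>g\<^sub>2\<close> is nonzero, these rows are independent and span the row of \<open>g\<^sub>0\<close>.\<close>

lemma rank_poisson_matrix:
  assumes y: "y 1 \<noteq> 0"
  shows "matrix_rank 4 (\<lambda>i j. poisson_matrix a b i j y) = 2"
proof -
  let ?r = "\<lambda>i j. if j < 4 then poisson_matrix a b i j y else 0"
  let ?w = "\<lambda>i :: nat. if i = 0 then ?r 2 else ?r 3"
  have W: "inj_on ?w {..<2} \<and> independent (?w ` {..<2})"
  proof (rule independent_family)
    fix c :: "nat \<Rightarrow> real" and i :: nat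
    assume rel: "(\<Sum>j<2. c j *\<^sub>R ?w j) = 0" and i: "i < 2"
    have z: "c 0 * ?r 2 j + c 1 * ?r 3 j = 0" for j
      using fun_cong[OF rel, of j] by (simp add: lessThan_2 plus_fun_def scaleR_fun_def zero_fun_def)
    have "i = 0 \<or> i = 1" using i by linarith
    then show "c i = 0"
      using z[of 2] z[of 3] y by (auto simp: poisson_matrix_def)
  qed
  have w: "?w ` {..<2} = {?r 2, ?r 3}" by (simp add: lessThan_2 insert_commute)
  have rows: "?r ` {..<4} = {?r 0, ?r 1, ?r 2, ?r 3}" by (simp add: lessThan_4)
  have r0: "?r 0 = 0" by (auto simp: poisson_matrix_def fun_eq_iff)
  have r1: "?r 1 = (b * y 2 / y 1) *\<^sub>R ?r 2 - (a * y 3 / y 1) *\<^sub>R ?r 3"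
  proof
    fix j show "?r 1 j = ((b * y 2 / y 1) *\<^sub>R ?r 2 - (a * y 3 / y 1) *\<^sub>R ?r 3) j"
      using y by (cases "j < 4") (auto simp: less_4 poisson_matrix_def scaleR_fun_def fun_diff_def)
  qed
  have "?r 1 \<in> span {?r 2, ?r 3}"
    unfolding r1 by (intro span_diff span_scale span_base insertI1 insertI2)
  moreover have "?r 0 \<in> span {?r 2, ?r 3}" unfolding r0 by (rule span_zero)
  moreover have "{?r 2, ?r 3} \<subseteq> span {?r 2, ?r 3}" by (rule span_superset)
  ultimately have "?r ` {..<4} \<subseteq> span {?r 2, ?r 3}" unfolding rows by blast
  moreover have "card {?r 2, ?r 3} = 2" using card_image[of ?w "{..<2}"] W w by simp
  moreover have "independent {?r 2, ?r 3}" using W w by simp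
  moreover have "{?r 2, ?r 3} \<subseteq> ?r ` {..<4}" unfolding rows by blast
  ultimately show ?thesis unfolding matrix_rank_def by (intro dim_unique) auto
qed

section \<open>Superintegrability\<close>

text \<open>The frame of a left-invariant contact structure with its bracket relations. Below, \<open>h\<^sub>i\<close> are the
  momenta of the frame and \<open>g\<^sub>i\<close> those of the right-invariant fields \<open>e\<^sub>i = i\<^sub>* f\<^sub>i\<close>.\<close>

locale contact_frame = lie_group G A for G (structure) and A :: "('p, 'e::euclidean_space) chart set" +
  fixes f :: "nat \<Rightarrow> ('p, 'e) vfield" and chi kappa :: real
  assumes frame_smooth: "\<And>i. i < 3 \<Longrightarrow> smooth_vf_on A (points A) (f i)"
    and frame_left_invariant: "\<And>i a q. i < 3 \<Longrightarrow> a \<in> carrier G \<Longrightarrow> q \<in> carrier G \<Longrightarrow>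
      tangent_map A A (\<lambda>x. a \<otimes> x) q (f i q) = f i (a \<otimes> q)"
    and frame_inj: "\<And>q. q \<in> carrier G \<Longrightarrow> inj_on (\<lambda>i. f i q) {..<3}"
    and frame_independent: "\<And>q. q \<in> carrier G \<Longrightarrow> independent ((\<lambda>i. f i q) ` {..<3})"
    and bracket_2_1: "\<And>q. q \<in> carrier G \<Longrightarrow> lie_bracket A (f 2) (f 1) q = f 0 q"
    and bracket_1_0: "\<And>q. q \<in> carrier G \<Longrightarrow> lie_bracket A (f 1) (f 0) q = (chi + kappa) *\<^sub>R f 2 q"
    and bracket_2_0: "\<And>q. q \<in> carrier G \<Longrightarrow> lie_bracket A (f 2) (f 0) q = (chi - kappa) *\<^sub>R f 1 q"
begin

abbreviation "T_star \<equiv> cot_atlas A"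
abbreviation "pb \<equiv> poisson T_star (symplectic_form A)"
abbreviation "h \<equiv> hfun f"
abbreviation "g \<equiv> gfun G A f"
abbreviation "e \<equiv> \<lambda>i. push_inv (f i)"

lemma frame_tangent: "i < 3 \<Longrightarrow> q \<in> carrier G \<Longrightarrow> f i q \<in> tangent_space A q"
  using frame_smooth carrier_eq by (auto simp: smooth_vf_on_def)

lemma e_smooth: "i < 3 \<Longrightarrow> smooth_vf_on A (points A) (e i)"
  by (rule push_inv_smooth[OF frame_smooth])

lemma e_tangent: "i < 3 \<Longrightarrow> q \<in> carrier G \<Longrightarrow> e i q \<in> tangent_space A q"
  by (rule push_inv_tangent[OF frame_smooth])

lemma h_smooth: "i < 3 \<Longrightarrow> smooth_fun T_star (h i)"
  unfolding hfun_def by (rule smooth_fun_momentum[OF frame_smooth])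

lemma g_smooth: "i < 3 \<Longrightarrow> smooth_fun T_star (g i)"
  unfolding gfun_def by (rule smooth_fun_momentum[OF e_smooth])

lemma Ham_eq: "Ham f = (\<lambda>z. ((h 1 z)\<^sup>2 + (h 2 z)\<^sup>2) / 2)"
  by (simp add: Ham_def)

lemma Ham_smooth: "smooth_fun T_star (Ham f)"
  unfolding Ham_eq by (rule diff_atlas.smooth_fun_half_squares[OF cot_diff_atlas h_smooth h_smooth]) simp_all

lemma points_T_star: "(p, l) \<in> points T_star \<longleftrightarrow> p \<in> carrier G \<and> l \<in> cotangent_space A p"
  by (simp add: points_cot_atlas carrier_eq)

lemma cotangent_scale: "l \<in> cotangent_space A p \<Longrightarrow> v \<in> tangent_space A p \<Longrightarrow> l (r *\<^sub>R v) = r * l v"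
  by (simp add: cotangent_space_def)

lemma cotangent_zero: "l \<in> cotangent_space A p \<Longrightarrow> l 0 = 0"
  using cotangent_scale[OF _ subspace_0[OF subspace_tangent], of l p 0] by simp

lemma pb_self: "smooth_fun T_star a \<Longrightarrow> z \<in> points T_star \<Longrightarrow> pb a a z = 0"
  using poisson_antisym[of z a a] by simp

text \<open>Left- and right-invariant fields commute; hence every \<open>g\<^sub>j\<close> is an integral of every function
  of \<open>h\<^sub>0, h\<^sub>1, h\<^sub>2\<close>, in particular of \<open>H\<close>.\<close>

lemma pb_h_g:
  assumes "i < 3" "j < 3" and z: "z \<in> points T_star"
  shows "pb (h i) (g j) z = 0"
proof -
  obtain p l where pl: "z = (p, l)" by (cases z)
  have p: "p \<in> carrier G" and l: "l \<in> cotangent_space A p" using z by (auto simp: pl points_T_star)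
  have "lie_bracket A (f i) (e j) p = 0"
    using assms(1,2) p
    by (intro left_right_invariant_commute frame_smooth e_smooth push_inv_right_invariant frame_left_invariant)
  then have "pb (momentum (f i)) (momentum (e j)) (p, l) = l 0"
    using z by (intro poisson_momentum frame_smooth e_smooth assms subspace_0 subspace_tangent) (simp_all add: pl)
  then show ?thesis by (simp add: pl hfun_def gfun_def cotangent_zero[OF l])
qed

lemma pb_h_2_1:
  assumes z: "z \<in> points T_star"
  shows "pb (h 2) (h 1) z = h 0 z"
proof -
  obtain p l where pl: "z = (p, l)" by (cases z)
  have p: "p \<in> carrier G" using z by (auto simp: pl points_T_star)
  have "pb (momentum (f 2)) (momentum (f 1)) (p, l) = l (f 0 p)"
    using z by (intro poisson_momentum frame_smooth bracket_2_1 frame_tangent p) (simp_all add: pl)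
  then show ?thesis by (simp add: pl hfun_def momentum_def)
qed

text \<open>The inversion carries the bracket relations of the frame over to the fields \<open>e\<^sub>i\<close>, whence the
  \<open>g\<^sub>i\<close> span a Lie algebra with the same structure constants.\<close>

lemma pb_g:
  assumes ij: "i < 3" "j < 3" "k < 3" and z: "z \<in> points T_star"
    and br: "\<And>q. q \<in> carrier G \<Longrightarrow> lie_bracket A (f i) (f j) q = r *\<^sub>R f k q"
  shows "pb (g i) (g j) z = r * g k z"
proof -
  obtain p l where pl: "z = (p, l)" by (cases z)
  have p: "p \<in> carrier G" and l: "l \<in> cotangent_space A p" using z by (auto simp: pl points_T_star)
  have q: "inv p \<in> carrier G" using p by simp
  have "lie_bracket A (e i) (e j) p = tangent_map A A (m_inv G) (inv p) (r *\<^sub>R f k (inv p))"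
    by (intro push_inv_bracket frame_smooth ij p br q subspace_scale subspace_tangent frame_tangent)
  also have "\<dots> = r *\<^sub>R e k p"
    by (simp add: push_inv_apply p linear_cmul[OF linear_tangent_map[OF diff_atlas_axioms diff_map_inv[OF q]]])
  finally have "pb (momentum (e i)) (momentum (e j)) (p, l) = l (r *\<^sub>R e k p)"
    using z by (intro poisson_momentum e_smooth ij subspace_scale subspace_tangent e_tangent p) (simp_all add: pl)
  then show ?thesis by (simp add: pl gfun_def momentum_def cotangent_scale[OF l e_tangent[OF ij(3) p]])
qed

lemma pb_g_2_1: "z \<in> points T_star \<Longrightarrow> pb (g 2) (g 1) z = g 0 z"
  and pb_g_1_0: "z \<in> points T_star \<Longrightarrow> pb (g 1) (g 0) z = (chi + kappa) * g 2 z"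
  and pb_g_2_0: "z \<in> points T_star \<Longrightarrow> pb (g 2) (g 0) z = (chi - kappa) * g 1 z"
  using pb_g[of 2 1 0 z 1] pb_g[of 1 0 2 z "chi + kappa"] pb_g[of 2 0 1 z "chi - kappa"]
  by (simp_all add: bracket_2_1 bracket_1_0 bracket_2_0)

lemma pb_Ham:
  assumes "z \<in> points T_star" "smooth_fun T_star b"
  shows "pb (Ham f) b z = h 1 z * pb (h 1) b z + h 2 z * pb (h 2) b z"
  unfolding Ham_eq using assms by (intro poisson_half_squares h_smooth) simp_all

lemma pb_Ham_g: "j < 3 \<Longrightarrow> z \<in> points T_star \<Longrightarrow> pb (Ham f) (g j) z = 0"
  by (simp add: pb_Ham g_smooth pb_h_g)

lemma pb_h2_Ham:
  assumes z: "z \<in> points T_star"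
  shows "pb (h 2) (Ham f) z = h 0 z * h 1 z"
proof -
  have "pb (h 2) (Ham f) z = - pb (Ham f) (h 2) z"
    using z by (intro poisson_antisym h_smooth Ham_smooth) simp_all
  also have "\<dots> = - (h 1 z * pb (h 1) (h 2) z)"
    using z by (simp add: pb_Ham h_smooth pb_self)
  also have "pb (h 1) (h 2) z = - h 0 z"
    using z poisson_antisym[of z "h 1" "h 2"] by (simp add: h_smooth pb_h_2_1)
  finally show ?thesis by simp
qed

lemma nth_integrals:
  "[a, b, c, d] ! 0 = a" "[a, b, c, d] ! 1 = b" "[a, b, c, d] ! 2 = c" "[a, b, c, d] ! 3 = d"
  by (simp_all add: nth_Cons')

lemma first_integrals:
  "\<forall>a\<in>{Ham f, g 0, g 1, g 2}. integral_of T_star (symplectic_form A) (Ham f) a"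
  by (auto simp: integral_of_def Ham_smooth g_smooth pb_self pb_Ham_g)

abbreviation "integrals \<equiv> (\<lambda>i. [Ham f, g 0, g 1, g 2] ! i)"

lemma integrals_smooth: "i < 4 \<Longrightarrow> smooth_fun T_star (integrals i)"
  by (auto simp: less_4 nth_integrals Ham_smooth g_smooth)

text \<open>Evaluating a linear relation between the differentials on the Hamiltonian field of \<open>h\<^sub>2\<close>
  leaves only the coefficient of \<open>dH\<close>, times \<open>{h\<^sub>2, H} = h\<^sub>0 h\<^sub>1\<close>; on vertical vectors the
  differentials \<open>dg\<^sub>j\<close> are the independent fields \<open>e\<^sub>j\<close>.\<close>

lemma integrals_independent:
  "functionally_independent T_star {z \<in> points T_star. h 0 z * h 1 z \<noteq> 0} 4 integrals"
  unfolding functionally_independent_def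
proof (intro ballI independent_family)
  fix z and c :: "nat \<Rightarrow> real" and i :: nat
  assume "z \<in> {z \<in> points T_star. h 0 z * h 1 z \<noteq> 0}"
    and rel: "(\<Sum>j<4. c j *\<^sub>R differential T_star (integrals j) z) = 0" and i: "i < 4"
  then have z: "z \<in> points T_star" and nz: "h 0 z * h 1 z \<noteq> 0" by auto
  let ?d = "\<lambda>a. differential T_star a z"
  have rel': "c 0 * ?d (Ham f) v + c 1 * ?d (g 0) v + c 2 * ?d (g 1) v + c 3 * ?d (g 2) v = 0" for v
    using fun_cong[OF rel, of v]
    by (simp add: lessThan_4 nth_integrals plus_fun_def scaleR_fun_def zero_fun_def)
  have "c 0 * pb (h 2) (Ham f) z + c 1 * pb (h 2) (g 0) z + c 2 * pb (h 2) (g 1) z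
      + c 3 * pb (h 2) (g 2) z = 0"
    unfolding poisson_def by (rule rel')
  then have c0: "c 0 = 0" using nz by (simp add: pb_h2_Ham pb_h_g z)
  obtain p l where pl: "z = (p, l)" by (cases z)
  have p: "p \<in> carrier G" and l: "l \<in> cotangent_space A p" using z by (auto simp: pl points_T_star)
  have "c (k + 1) = 0" if k: "k < 3" for k
  proof -
    have inj: "inj_on (\<lambda>i. e i p) {..<3}" and ind: "independent ((\<lambda>i. e i p) ` {..<3})"
      using push_inv_independent[of "{..<3}" f p] frame_smooth frame_inj frame_independent p by auto
    obtain m where m: "m \<in> cotangent_space A p"
      and me: "\<forall>v\<in>(\<lambda>i. e i p) ` {..<3} \<inter> tangent_space A p. m v = (if v = e k p then 1 else 0)"
      using covector_extension[OF ind, of p "\<lambda>v. if v = e k p then 1 else 0"] by blast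
    have mj: "m (e j p) = (if j = k then 1 else 0)" if "j < 3" for j
      using me that e_tangent[OF that p] inj k by (auto simp: inj_on_def)
    obtain v where "\<forall>X. smooth_vf_on A (points A) X \<longrightarrow> ?d (momentum X) v = m (X p)"
      using vertical_vector[OF z[unfolded pl] m] pl by blast
    then have "?d (g j) v = (if j = k then 1 else 0)" if "j < 3" for j
      using mj that e_smooth unfolding gfun_def by simp
    moreover have "k = 0 \<or> k = 1 \<or> k = 2" using k by linarith
    ultimately show "c (k + 1) = 0" using rel'[of v] c0 by auto
  qed
  from this[of 0] this[of 1] this[of 2] show "c i = 0" using c0 i by (auto simp: less_4)
qed

lemma integrals_poisson:
  assumes "i < 4" "j < 4" and z: "z \<in> points T_star"
  shows "pb (integrals i) (integrals j) z
    = poisson_matrix (chi + kappa) (chi - kappa) i j (\<lambda>i. if i < 4 then integrals i z else 0)"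
proof -
  have anti: "pb (g i) (g j) z = - pb (g j) (g i) z" if "i < 3" "j < 3" for i j
    using that z by (intro poisson_antisym g_smooth)
  have "pb (g j) (Ham f) z = 0" if "j < 3" for j
    using poisson_antisym[OF z g_smooth[OF that] Ham_smooth] pb_Ham_g[OF that z] by simp
  then show ?thesis
    using assms(1,2)
    by (auto simp: less_4 nth_integrals poisson_matrix_def pb_self z Ham_smooth g_smooth pb_Ham_g
        pb_g_2_1 pb_g_1_0 pb_g_2_0 anti[of 0 1] anti[of 0 2] anti[of 1 2])
qed

text \<open>Along a fibre line in the direction of a covector \<open>m\<close> with \<open>m f\<^sub>0 = m f\<^sub>1 = 1\<close> the product
  \<open>h\<^sub>0 h\<^sub>1\<close> is a monic quadratic polynomial, which vanishes at two points at most.\<close>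

lemma h0_h1_nonzero_dense:
  "open_dense_in (mtop T_star) {z \<in> points T_star. h 0 z * h 1 z \<noteq> 0}"
proof -
  interpret cot: diff_atlas T_star by (rule cot_diff_atlas)
  let ?U = "{z \<in> points T_star. h 0 z * h 1 z \<noteq> 0}"
  have "openin (mtop T_star) {z \<in> points T_star. h 0 z * h 1 z \<in> - {0}}"
    by (rule cot.openin_smooth_fun_preimage[OF cot.smooth_fun_mult[OF h_smooth h_smooth]])
       (simp_all add: open_Compl)
  then have "openin (mtop T_star) ?U" by simp
  moreover have "?U \<inter> W \<noteq> {}" if W: "openin (mtop T_star) W" "W \<noteq> {}" for W
  proof -
    obtain p l where pl: "(p, l) \<in> W" using W(2) by auto
    have WM: "W \<subseteq> points T_star" using openin_subset[OF W(1)] by (simp add: cot.topspace_mtop)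
    then have p: "p \<in> carrier G" and l: "l \<in> cotangent_space A p" using pl by (auto simp: points_T_star)
    obtain m where m: "m \<in> cotangent_space A p"
      and "\<forall>v\<in>(\<lambda>i. f i p) ` {..<3} \<inter> tangent_space A p. m v = 1"
      using covector_extension[OF frame_independent[OF p], of p "\<lambda>_. 1"] by blast
    then have mf: "m (f i p) = 1" if "i < 3" for i using frame_tangent[OF that p] that by auto
    obtain d where d: "d > 0" "\<And>t. \<bar>t\<bar> < d \<Longrightarrow> (p, \<lambda>v. l v + t * m v) \<in> W"
      using fibre_line_in_open[OF W(1) pl m] by blast
    obtain t where t: "\<bar>t\<bar> < d" "t \<notin> {- l (f 0 p), - l (f 1 p)}"
      using obtain_small_avoiding[OF d(1), of "{- l (f 0 p), - l (f 1 p)}"] by auto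
    have "(p, \<lambda>v. l v + t * m v) \<in> ?U \<inter> W"
      using d(2)[OF t(1)] WM t(2) mf[of 0] mf[of 1] by (auto simp: hfun_def momentum_def eq_neg_iff_add_eq_0 add.commute)
    then show ?thesis by blast
  qed
  ultimately show ?thesis
    unfolding open_dense_in_def dense_intersects_open by blast
qed

text \<open>Points of the image are perturbed by moving their preimages along fibre lines, on which
  \<open>g\<^sub>0\<close> is a nonconstant affine function; continuity of \<open>\<Phi>\<close> keeps the image close.\<close>

lemma g0_nonzero_dense:
  defines "\<Phi> \<equiv> \<lambda>z i. if i < 4 then integrals i z else 0"
  shows "open_dense_in (subtopology (Euclidean_space 4) (\<Phi> ` points T_star))
    {y \<in> \<Phi> ` points T_star. y 1 \<noteq> 0}"
proof -
  interpret cot: diff_atlas T_star by (rule cot_diff_atlas)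
  let ?X = "subtopology (Euclidean_space 4) (\<Phi> ` points T_star)"
  have \<Phi>: "continuous_map (mtop T_star) (Euclidean_space 4) \<Phi>"
    unfolding \<Phi>_def continuous_map_componentwise_Euclidean_space
    using cot.continuous_map_smooth_fun integrals_smooth by blast
  then have img: "\<Phi> ` points T_star \<subseteq> topspace (Euclidean_space 4)"
    using continuous_map_image_subset_topspace cot.topspace_mtop by metis
  have "continuous_map (powertop_real UNIV) euclideanreal (\<lambda>y :: nat \<Rightarrow> real. y 1)"
    by (rule continuous_map_product_projection) simp
  then have "continuous_map ?X euclideanreal (\<lambda>y. y 1)"
    unfolding Euclidean_space_def by (intro continuous_map_from_subtopology)
  then have "openin ?X {y \<in> topspace ?X. y 1 \<in> - {0}}"
    by (rule openin_continuous_map_preimage) (simp add: open_Compl)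
  moreover have "{y \<in> topspace ?X. y 1 \<in> - {0}} = {y \<in> \<Phi> ` points T_star. y 1 \<noteq> 0}"
    using img by auto
  ultimately have "openin ?X {y \<in> \<Phi> ` points T_star. y 1 \<noteq> 0}" by simp
  moreover have "{y \<in> \<Phi> ` points T_star. y 1 \<noteq> 0} \<inter> W \<noteq> {}" if W: "openin ?X W" "W \<noteq> {}" for W
  proof -
    obtain T where T: "openin (Euclidean_space 4) T" "W = T \<inter> \<Phi> ` points T_star"
      using W(1) by (auto simp: openin_subtopology)
    let ?W = "{z \<in> topspace (mtop T_star). \<Phi> z \<in> T}"
    have op: "openin (mtop T_star) ?W" by (rule openin_continuous_map_preimage[OF \<Phi> T(1)])
    obtain z where z: "z \<in> ?W" using W(2) T(2) by (auto simp: cot.topspace_mtop)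
    obtain p l where "z = (p, l)" by (cases z)
    then have pl: "(p, l) \<in> ?W" using z by simp
    then have p: "p \<in> carrier G" and l: "l \<in> cotangent_space A p"
      by (auto simp: cot.topspace_mtop points_T_star)
    have ind: "independent ((\<lambda>i. e i p) ` {..<3})"
      using push_inv_independent(2)[of "{..<3}" f p] frame_smooth frame_inj frame_independent p by auto
    obtain m where m: "m \<in> cotangent_space A p"
      and "\<forall>v\<in>(\<lambda>i. e i p) ` {..<3} \<inter> tangent_space A p. m v = 1"
      using covector_extension[OF ind, of p "\<lambda>_. 1"] by blast
    then have me: "m (e 0 p) = 1" using e_tangent[OF _ p, of 0] by auto
    obtain d where d: "d > 0" "\<And>t. \<bar>t\<bar> < d \<Longrightarrow> (p, \<lambda>v. l v + t * m v) \<in> ?W"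
      using fibre_line_in_open[OF op pl m] by blast
    obtain t where t: "\<bar>t\<bar> < d" "t \<notin> {- l (e 0 p)}"
      using obtain_small_avoiding[OF d(1), of "{- l (e 0 p)}"] by auto
    let ?z = "(p, \<lambda>v. l v + t * m v)"
    have "g 0 ?z \<noteq> 0" using t(2) me by (simp add: gfun_def momentum_def eq_neg_iff_add_eq_0 add.commute)
    then have "\<Phi> ?z 1 \<noteq> 0" by (simp add: \<Phi>_def nth_integrals)
    moreover have "\<Phi> ?z \<in> T" "?z \<in> points T_star" using d(2)[OF t(1)] by (auto simp: cot.topspace_mtop)
    ultimately have "\<Phi> ?z \<in> {y \<in> \<Phi> ` points T_star. y 1 \<noteq> 0} \<inter> W" using T(2) by blast
    then show ?thesis by blast
  qed
  ultimately show ?thesis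
    unfolding open_dense_in_def dense_intersects_open by blast
qed

lemma superintegrable_Ham:
  assumes "DIM('e) = 3"
  shows "superintegrable T_star (symplectic_form A) (Ham f)"
  unfolding superintegrable_def
proof (intro exI conjI)
  \<comment> \<open>Here \<open>d = 3\<close> and \<open>n = 2\<close>, and the rank \<open>2d - 2n\<close> is \<open>2\<close>.\<close>
  let ?\<Phi> = "\<lambda>z i. if i < 4 then integrals i z else 0"
  show "DIM('e \<times> 'e) = 2 * 3" using assms by simp
  show "1 \<le> (2::nat)" "(2::nat) \<le> 3" "(4::nat) = 2 * 3 - 2" by simp_all
  show "?\<Phi> = (\<lambda>p i. if i < 4 then integrals i p else 0)" ..
  show "integrals 0 = Ham f" by simp
  show "\<forall>i<4. smooth_fun T_star (integrals i)" using integrals_smooth by blast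
  show "open_dense_in (mtop T_star) {z \<in> points T_star. h 0 z * h 1 z \<noteq> 0}" by (rule h0_h1_nonzero_dense)
  show "functionally_independent T_star {z \<in> points T_star. h 0 z * h 1 z \<noteq> 0} 4 integrals"
    by (rule integrals_independent)
  show "\<forall>i<4. \<forall>j<4. \<forall>z\<in>points T_star. pb (integrals i) (integrals j) z
      = poisson_matrix (chi + kappa) (chi - kappa) i j (?\<Phi> z)"
    using integrals_poisson by blast
  show "open_dense_in (subtopology (Euclidean_space 4) (?\<Phi> ` points T_star)) {y \<in> ?\<Phi> ` points T_star. y 1 \<noteq> 0}"
    by (rule g0_nonzero_dense)
  show "\<forall>y\<in>{y \<in> ?\<Phi> ` points T_star. y 1 \<noteq> 0}.
      matrix_rank 4 (\<lambda>i j. poisson_matrix (chi + kappa) (chi - kappa) i j y) = 2 * 3 - 2 * 2"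
    using rank_poisson_matrix by simp
qed

end

theorem theorem2:
  fixes G :: "('p, 'm) monoid_scheme"
    and A :: "('p, real ^ 3) chart set"
    and D :: "'p \<Rightarrow> ('p, real ^ 3) tvec set"
    and ip :: "'p \<Rightarrow> ('p, real ^ 3) tvec \<Rightarrow> ('p, real ^ 3) tvec \<Rightarrow> real"
    and f :: "nat \<Rightarrow> ('p, real ^ 3) vfield"
    and chi kappa :: real
  assumes "lie_group G A"
    and "connected_space (mtop A)"
    and "unimodular G A"
    and "contact_subriemannian G A D ip"
    and "\<forall>i<3. left_invariant_vf G A (f i)"
    and "frame_on A (tangent_space A) 3 (carrier G) f"
    and "orthonormal_frame2 A D ip (f 1) (f 2)"
    and "\<forall>q\<in>carrier G. lie_bracket A (f 2) (f 1) q = f 0 q"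
    and "\<forall>q\<in>carrier G. lie_bracket A (f 1) (f 0) q = (chi + kappa) *\<^sub>R f 2 q"
    and "\<forall>q\<in>carrier G. lie_bracket A (f 2) (f 0) q = (chi - kappa) *\<^sub>R f 1 q"
    and "chi \<ge> 0"
  shows "(\<forall>a\<in>{Ham f, gfun G A f 0, gfun G A f 1, gfun G A f 2}.
            integral_of (cot_atlas A) (symplectic_form A) (Ham f) a) \<and>
         functionally_independent (cot_atlas A)
            {l \<in> points (cot_atlas A). hfun f 0 l * hfun f 1 l \<noteq> 0}
            4 (\<lambda>i. [Ham f, gfun G A f 0, gfun G A f 1, gfun G A f 2] ! i) \<and>
         superintegrable (cot_atlas A) (symplectic_form A) (Ham f)"
proof -
  interpret lie_group G A by fact
  interpret contact_frame G A f chi kappa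
    using assms(5,6,8-10) carrier_eq
    by unfold_locales (auto simp: left_invariant_vf_def frame_on_def)
  show ?thesis
    using first_integrals integrals_independent superintegrable_Ham by simp
qed

end
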